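(* Assume $A$ is associative and fix a bounded domain $G$ in the hypercomplex subspace $M$ of $A$, with a $\mathscr{C}^1$ boundary $\partial G$. If $\phi\in\mathscr{C}^1(\overline{G},A)$, then \[\int_{\partial G}E_m(y-x)\,dy^*\,\phi(y)-\int_GE_m(y-x)\,\overline{\partial}_{\mathcal{B}}\phi(y)\,d\sigma_y=\begin{cases}\phi(x)&\text{if }x\in G,\\0&\text{if }x\in M\setminus\overline{G}.\end{cases}\]
   Context: $\mathbb{N}$ includes $0$. $A$ is a finite-dimensional (unital) real $*$-algebra: a finite-dimensional real vector space with an $\mathbb{R}$-bilinear multiplication (here associative) and an involutive real-linear antiautomorphism $x\mapsto x^c$; $\mathbb{R}$ is identified with $\mathbb{R}1$. Set $t(x)=x+x^c$, $n(x)=xx^c$, $\mathbb{S}_A=\{x\in A:t(x)=0,\ n(x)=1\}$, assumed nonempty, and $Q_A=\bigcup_{J\in\mathbb{S}_A}(\mathbb{R}+J\mathbb{R})$. A hypercomplex subspace of $A$ is a real vector subspace $M$ with $\mathbb{R}\subsetneq M\subseteq Q_A$; a hypercomplex basis of $M$ is an ordered real basis $(v_0,\ldots,v_m)$ with $m\ge1$, $v_0=1$, $v_s\in\mathbb{S}_A$ and $v_sv_u=-v_uv_s$ for distinct $s,u\in\{1,\ldots,m\}$. Setting. $M$ is a hypercomplex subspace of $A$ with a fixed hypercomplex basis $\mathcal{B}=(v_0,\ldots,v_m)$, completed to a real basis $\mathcal{B}'=(v_0,\ldots,v_d)$ of $A$; $\|\cdot\|$ is the Euclidean norm on $A$ making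 $\mathcal{B}'$ orthonormal. Points of $M$ are written $x=\sum_{s=0}^mx_sv_s$. A domain is a nonempty connected open subset; $\overline{G}$ is the closure of $G$ in $M$; $\mathscr{C}^1(\overline{G},A)$ consists of the restrictions to $\overline{G}$ of $\mathscr{C}^1$ functions from some open neighborhood of $\overline{G}$ in $M$ to $A$. $\partial_s\phi(x)=\lim_{\mathbb{R}\ni\varepsilon\to0}\varepsilon^{-1}(\phi(x+\varepsilon v_s)-\phi(x))$ and $\overline{\partial}_{\mathcal{B}}\phi=\sum_{s=0}^mv_s\,\partial_s\phi$. The Cauchy kernel $E_m:M\setminus\{0\}\to A$ is $E_m(x)=\frac{1}{\sigma_m}\frac{x^c}{\|x\|^{m+1}}$, with $\sigma_m=2\,\Gamma(\tfrac12)^{m+1}/\Gamma(\tfrac{m+1}{2})$ (surface volume of the unit $m$-sphere in $\mathbb{R}^{m+1}$). $d\sigma_y=dy_0\wedge dy_1\wedge\cdots\wedge dy_m$ is the volume element; integrals of $A$-valued functions are taken componentwise with respect to $\mathcal{B}'$. $dy^*=\sum_{s=0}^mv_s\,dy_s^*$ with $dy_s^*=(-1)^sdy_0\wedge\cdots\wedge dy_{s-1}\wedge dy_{s+1}\wedge\cdots\wedge dy_m$; $\int_{\partial G}\psi\,dy^*\,\phi$ is the integral over $\partial G$ (oriented as boundary of $G$) of the $A$-valued form $\sum_s\psi v_s\phi\,dy_s^*$, i.e. $\int_{\partial G}\psi\,\nu\,\phi\,dS$ with $\nu$ the outward unit normal regarded as an element of $M\subset A$ and $dS$ the surface measure. 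*)

theory Defs
  imports "HOL-Analysis.Analysis"
begin

section \<open>Real *-algebras and hypercomplex subspaces\<close>

definition star_involution :: "('a::real_algebra_1 \<Rightarrow> 'a) \<Rightarrow> bool" where
  "star_involution c \<longleftrightarrow>
     linear c \<and> (\<forall>x y. c (x * y) = c y * c x) \<and> (\<forall>x. c (c x) = x)"

definition star_trace :: "('a::real_algebra_1 \<Rightarrow> 'a) \<Rightarrow> 'a \<Rightarrow> 'a" where
  "star_trace c x = x + c x"

definition star_norm :: "('a::real_algebra_1 \<Rightarrow> 'a) \<Rightarrow> 'a \<Rightarrow> 'a" where
  "star_norm c x = x * c x"

definition imag_units :: "('a::real_algebra_1 \<Rightarrow> 'a) \<Rightarrow> 'a set" where
  "imag_units c = {x. star_trace c x = 0 \<and> star_norm c x = 1}"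

definition quadratic_cone :: "('a::real_algebra_1 \<Rightarrow> 'a) \<Rightarrow> 'a set" where
  "quadratic_cone c = (\<Union>J\<in>imag_units c. {of_real a + J * of_real b | a b. True})"

definition hypercomplex_subspace :: "('a::real_algebra_1 \<Rightarrow> 'a) \<Rightarrow> 'a set \<Rightarrow> bool" where
  "hypercomplex_subspace c M \<longleftrightarrow> subspace M \<and> \<real> \<subset> M \<and> M \<subseteq> quadratic_cone c"

text \<open>A tuple \<open>(v\<^sub>0, \<dots>, v\<^sub>k)\<close> is encoded by the first \<open>k + 1\<close> values of a
  function on the naturals; the other values are irrelevant.\<close>

definition ordered_basis :: "(nat \<Rightarrow> 'a::real_vector) \<Rightarrow> nat \<Rightarrow> 'a set \<Rightarrow> bool" where
  "ordered_basis v k V \<longleftrightarrow>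
     inj_on v {..k} \<and> independent (v ` {..k}) \<and> span (v ` {..k}) = V"

definition hypercomplex_basis ::
    "('a::real_algebra_1 \<Rightarrow> 'a) \<Rightarrow> 'a set \<Rightarrow> nat \<Rightarrow> (nat \<Rightarrow> 'a) \<Rightarrow> bool" where
  "hypercomplex_basis c M m v \<longleftrightarrow>
     m \<ge> 1 \<and> ordered_basis v m M \<and> v 0 = 1 \<and>
     (\<forall>s\<in>{1..m}. v s \<in> imag_units c) \<and>
     (\<forall>s\<in>{1..m}. \<forall>u\<in>{1..m}. s \<noteq> u \<longrightarrow> v s * v u = - (v u * v s))"

definition orthonormal_family :: "(nat \<Rightarrow> 'a::real_inner) \<Rightarrow> nat \<Rightarrow> bool" where
  "orthonormal_family v d \<longleftrightarrow>
     (\<forall>s\<le>d. \<forall>u\<le>d. v s \<bullet> v u = (if s = u then 1 else 0))"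


section \<open>Differentiation on \<open>M\<close>\<close>

definition partial :: "(nat \<Rightarrow> 'a) \<Rightarrow> nat \<Rightarrow> ('a::real_vector \<Rightarrow> 'b::real_normed_vector) \<Rightarrow> 'a \<Rightarrow> 'b" where
  "partial v s f x = Lim (at (0::real)) (\<lambda>\<epsilon>. inverse \<epsilon> *\<^sub>R (f (x + \<epsilon> *\<^sub>R v s) - f x))"

definition dbar :: "(nat \<Rightarrow> 'a) \<Rightarrow> nat \<Rightarrow> ('a \<Rightarrow> 'a) \<Rightarrow> 'a \<Rightarrow> 'a::{real_algebra_1, euclidean_space}" where
  "dbar v m f x = (\<Sum>s\<le>m. v s * partial v s f x)"

text \<open>For \<open>U\<close> open in the subspace \<open>M\<close>. A derivative within \<open>M\<close> is determined only on
  directions in \<open>M\<close>, so continuity is required only there.\<close>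

definition C1_on :: "'a::real_normed_vector set \<Rightarrow> 'a set \<Rightarrow> ('a \<Rightarrow> 'b::real_normed_vector) \<Rightarrow> bool" where
  "C1_on M U f \<longleftrightarrow> (\<exists>f'. (\<forall>y\<in>U. (f has_derivative f' y) (at y within M)) \<and>
                        (\<forall>h\<in>M. continuous_on U (\<lambda>y. f' y h)))"

definition C1_closure :: "'a::real_normed_vector set \<Rightarrow> 'a set \<Rightarrow> ('a \<Rightarrow> 'b::real_normed_vector) \<Rightarrow> bool" where
  "C1_closure M G f \<longleftrightarrow>
     (\<exists>U F. openin (top_of_set M) U \<and> top_of_set M closure_of G \<subseteq> U \<and> C1_on M U F \<and>
            (\<forall>y \<in> top_of_set M closure_of G. f y = F y))"


section \<open>Domains with \<open>C\<^sup>1\<close> boundary, surface measure and outward normal\<close>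

definition bounded_domain :: "'a::real_normed_vector set \<Rightarrow> 'a set \<Rightarrow> bool" where
  "bounded_domain M G \<longleftrightarrow>
     openin (top_of_set M) G \<and> connected G \<and> G \<noteq> {} \<and> bounded G"

text \<open>The boundary is taken relative to \<open>M\<close>; \<open>frontier G\<close> would be wrong when \<open>M\<close> is a proper
  subspace of the ambient type.\<close>

abbreviation bd :: "'a::topological_space set \<Rightarrow> 'a set \<Rightarrow> 'a set" where
  "bd M G \<equiv> top_of_set M frontier_of G"

text \<open>\<open>coord_volume v I\<close> is Lebesgue measure in the coordinates \<open>y\<^sub>s\<close>, \<open>s \<in> I\<close>, carried over to
  the span of \<open>{v s | s \<in> I}\<close> and regarded as a Borel measure on the ambient space. For
  \<open>I = {..m}\<close> it is the volume \<open>dy\<^sub>0 \<dots> dy\<^sub>m\<close> of \<open>M\<close>.\<close>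

definition coord_volume :: "(nat \<Rightarrow> 'a::euclidean_space) \<Rightarrow> nat set \<Rightarrow> 'a measure" where
  "coord_volume v I = distr (\<Pi>\<^sub>M s\<in>I. lborel) borel (\<lambda>y. \<Sum>s\<in>I. y s *\<^sub>R v s)"

text \<open>Inside \<open>W\<close> the set \<open>G\<close> is the side \<open>y\<^sub>i < \<gamma>(y)\<close> (\<open>sg = 1\<close>) or \<open>y\<^sub>i > \<gamma>(y)\<close> (\<open>sg = -1\<close>)
  of a \<open>C\<^sup>1\<close> graph, where \<open>\<gamma>\<close> depends only on the coordinates other than \<open>y\<^sub>i\<close>.
  As \<open>v\<close> is orthonormal, \<open>y\<^sub>i = y \<bullet> v i\<close>.\<close>

definition graph_chart :: "'a::euclidean_space set \<Rightarrow> (nat \<Rightarrow> 'a) \<Rightarrow> nat \<Rightarrow> 'a set \<Rightarrow>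
    'a set \<Rightarrow> nat \<Rightarrow> real \<Rightarrow> ('a \<Rightarrow> real) \<Rightarrow> bool" where
  "graph_chart M v m G W i sg \<gamma> \<longleftrightarrow>
     openin (top_of_set M) W \<and> i \<le> m \<and> sg \<in> {1, -1} \<and>
     C1_on M M \<gamma> \<and> (\<forall>y\<in>M. \<forall>t. \<gamma> (y + t *\<^sub>R v i) = \<gamma> y) \<and>
     G \<inter> W = {y\<in>W. sg * (y \<bullet> v i) < sg * \<gamma> y}"

definition C1_boundary :: "'a::euclidean_space set \<Rightarrow> (nat \<Rightarrow> 'a) \<Rightarrow> nat \<Rightarrow> 'a set \<Rightarrow> bool" where
  "C1_boundary M v m G \<longleftrightarrow>
     (\<forall>p \<in> bd M G. \<exists>W i sg \<gamma>. graph_chart M v m G W i sg \<gamma> \<and> p \<in> W)"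

definition area_factor :: "(nat \<Rightarrow> 'a) \<Rightarrow> nat \<Rightarrow> ('a::euclidean_space \<Rightarrow> real) \<Rightarrow> 'a \<Rightarrow> real" where
  "area_factor v m \<gamma> y = sqrt (1 + (\<Sum>s\<le>m. (partial v s \<gamma> y)\<^sup>2))"

text \<open>The surface measure \<open>dS\<close> is the Borel measure concentrated on \<open>\<partial>G\<close> that on each graph
  \<open>y\<^sub>i = \<gamma>(y)\<close> is the classical surface area \<open>\<integral> sqrt (1 + |\<nabla>\<gamma>|\<^sup>2)\<close> over the coordinates other than
  \<open>y\<^sub>i\<close>. (\<open>\<gamma>\<close> does not depend on \<open>y\<^sub>i\<close>, so its \<open>i\<close>-th partial derivative vanishes.)\<close>

definition is_surface_measure ::
    "'a::euclidean_space set \<Rightarrow> (nat \<Rightarrow> 'a) \<Rightarrow> nat \<Rightarrow> 'a set \<Rightarrow> 'a measure \<Rightarrow> bool" where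
  "is_surface_measure M v m G S \<longleftrightarrow>
     sets S = sets borel \<and> emeasure S (- bd M G) = 0 \<and>
     (\<forall>W i sg \<gamma> B. graph_chart M v m G W i sg \<gamma> \<longrightarrow> B \<in> sets borel \<longrightarrow> B \<subseteq> W \<longrightarrow>
        emeasure S B =
          (\<integral>\<^sup>+ z. indicator B (z + \<gamma> z *\<^sub>R v i) * ennreal (area_factor v m \<gamma> z)
             \<partial>coord_volume v ({..m} - {i})))"

definition surface_measure ::
    "'a::euclidean_space set \<Rightarrow> (nat \<Rightarrow> 'a) \<Rightarrow> nat \<Rightarrow> 'a set \<Rightarrow> 'a measure" where
  "surface_measure M v m G = (THE S. is_surface_measure M v m G S)"

definition outward_normal ::
    "'a::euclidean_space set \<Rightarrow> (nat \<Rightarrow> 'a) \<Rightarrow> nat \<Rightarrow> 'a set \<Rightarrow> 'a \<Rightarrow> 'a" where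
  "outward_normal M v m G p =
     (THE n. \<exists>W i sg \<gamma>. graph_chart M v m G W i sg \<gamma> \<and> p \<in> W \<inter> bd M G \<and>
        n = (sg / area_factor v m \<gamma> p) *\<^sub>R (v i - (\<Sum>s\<le>m. partial v s \<gamma> p *\<^sub>R v s)))"


section \<open>The Cauchy kernel\<close>

definition sphere_area :: "nat \<Rightarrow> real" where
  "sphere_area m = 2 * Gamma (1/2) ^ (m + 1) / Gamma ((real m + 1) / 2)"

definition cauchy_kernel ::
    "('a \<Rightarrow> 'a) \<Rightarrow> nat \<Rightarrow> 'a \<Rightarrow> 'a::{real_algebra_1, euclidean_space}" where
  "cauchy_kernel c m x = (1 / sphere_area m) *\<^sub>R (c x /\<^sub>R norm x ^ (m + 1))"

end

(* A C^1 domain is locally a half-space bounded by a graph y_i = g(y). There the divergence theorem is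
Fubini along v_i after the volume-preserving shear y |-> y + g(y) v_i, and a C^1 partition of unity
globalizes it. The same local identity, applied to the derivative in the graph direction of one chart,
shows that two charts induce the same surface measure, so the surface measure exists without a change
of variables on the surface. For the Cauchy formula, 1/|y|^(m+1) in the kernel is replaced near 0 by a
C^1 function of |y|^(m+1). The divergence of the regularized kernel is a nonnegative radial bump of
integral 1 concentrating at 0; letting its radius tend to 0 gives the value at x inside G and 0 outside
the closure. *)

theory Submission
  imports Defs
begin

section \<open>Coordinate volumes\<close>

text \<open>\<open>M\<close> may be a proper subspace of the type, while derivatives and measures
  are handled most easily on the whole type. So functions on \<open>M\<close> are extended by
  composing with the orthogonal projection, measures on \<open>M\<close> are Borel measures on
  \<open>'a\<close>, and membership in \<open>M\<close> is an almost-everywhere fact. As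
  \<open>surface_measure\<close> and \<open>outward_normal\<close> are definite descriptions,
  existence and uniqueness of both must precede any boundary integral; uniqueness of the normal is
  also what lets two charts be compared. Smoothing the kernel avoids removing a ball around x, which
  would create a second boundary with its own charts. The power |y|^(m+1) has two merits. With u =
  |y|^(m+1), the derivatives of k(u) c(y), multiplied on the right by the basis vectors, sum to
  (m+1) (k + u k') = (m+1) (u k)', so k is found by prescribing the product u k. And the image of
  the volume under u is a constant multiple of Lebesgue measure on the half-line, so radial
  integrals become one-dimensional.\<close>

interpretation lborel_PiM: product_sigma_finite "\<lambda>_::nat. lborel :: real measure"
  by standard

definition comb :: "(nat \<Rightarrow> 'a::euclidean_space) \<Rightarrow> nat set \<Rightarrow> (nat \<Rightarrow> real) \<Rightarrow> 'a" where
  "comb v I y = (\<Sum>s\<in>I. y s *\<^sub>R v s)"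

lemma comb_measurable [measurable]:
  "comb v I \<in> borel_measurable (\<Pi>\<^sub>M s\<in>I. lborel)"
  unfolding comb_def by measurable

lemma coord_volume_comb: "coord_volume v I = distr (\<Pi>\<^sub>M s\<in>I. lborel) borel (comb v I)"
  unfolding coord_volume_def comb_def ..

lemma sets_coord_volume [measurable_cong, simp]: "sets (coord_volume v I) = sets borel"
  by (simp add: coord_volume_def)

lemma space_coord_volume [simp]: "space (coord_volume v I) = UNIV"
  by (simp add: coord_volume_def)

lemma comb_insert:
  assumes "finite J" "i \<notin> J"
  shows "comb v (insert i J) (y(i := t)) = comb v J y + t *\<^sub>R v i"
proof -
  have "(\<Sum>s\<in>J. (y(i := t)) s *\<^sub>R v s) = (\<Sum>s\<in>J. y s *\<^sub>R v s)"
    using assms by (intro sum.cong) auto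
  then show ?thesis using assms by (simp add: comb_def)
qed

text \<open>Fubini for the product measure, carried over by \<open>comb\<close>: raising the
  coordinate \<open>i\<close> moves a point along the line in direction \<open>v i\<close>.\<close>

lemma nn_integral_coord_volume_insert:
  assumes J: "finite J" "i \<notin> J" and f [measurable]: "f \<in> borel_measurable borel"
  shows "(\<integral>\<^sup>+ y. f y \<partial>coord_volume v (insert i J)) =
    (\<integral>\<^sup>+ z. (\<integral>\<^sup>+ t. f (z + t *\<^sub>R v i) \<partial>lborel) \<partial>coord_volume v J)"
proof -
  have "(\<integral>\<^sup>+ y. f y \<partial>coord_volume v (insert i J)) =
      (\<integral>\<^sup>+ y. f (comb v (insert i J) y) \<partial>(\<Pi>\<^sub>M s\<in>insert i J. lborel))"
    by (simp add: coord_volume_comb nn_integral_distr)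
  also have "\<dots> = (\<integral>\<^sup>+ z. (\<integral>\<^sup>+ t. f (comb v (insert i J) (z(i := t))) \<partial>lborel) \<partial>(\<Pi>\<^sub>M s\<in>J. lborel))"
    by (rule lborel_PiM.product_nn_integral_insert) (use J in measurable)
  also have "\<dots> = (\<integral>\<^sup>+ z. (\<integral>\<^sup>+ t. f (z + t *\<^sub>R v i) \<partial>lborel) \<partial>coord_volume v J)"
    by (simp add: coord_volume_comb nn_integral_distr comb_insert J)
  finally show ?thesis .
qed

lemma integral_coord_volume_insert:
  fixes f :: "'a::euclidean_space \<Rightarrow> 'b::euclidean_space"
  assumes J: "finite J" "i \<notin> J" and f: "integrable (coord_volume v (insert i J)) f"
  shows "(LINT y|coord_volume v (insert i J). f y) =
    (LINT z|coord_volume v J. LINT t|lborel. f (z + t *\<^sub>R v i))"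
proof -
  have [measurable]: "f \<in> borel_measurable borel"
    using borel_measurable_integrable[OF f] by simp
  have "(LINT y|coord_volume v (insert i J). f y) =
      (LINT y|(\<Pi>\<^sub>M s\<in>insert i J. lborel). f (comb v (insert i J) y))"
    by (simp add: coord_volume_comb integral_distr)
  also have "\<dots> = (LINT z|(\<Pi>\<^sub>M s\<in>J. lborel). LINT t|lborel. f (comb v (insert i J) (z(i := t))))"
    using f by (intro lborel_PiM.product_integral_insert J)
      (simp add: coord_volume_comb integrable_distr_eq)
  also have "\<dots> = (LINT z|coord_volume v J. LINT t|lborel. f (z + t *\<^sub>R v i))"
    by (simp add: coord_volume_comb integral_distr comb_insert J)
  finally show ?thesis .
qed

text \<open>All of the real analysis, up to the divergence theorem and the radial integrals, takes
  place over an orthonormal frame in a Euclidean space; the algebra enters only with the Cauchy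
  kernel.\<close>

locale orthonormal_frame =
  fixes v :: "nat \<Rightarrow> 'a::euclidean_space" and m :: nat
  assumes orth: "orthonormal_family v m"
begin

lemma inner_v: "s \<le> m \<Longrightarrow> u \<le> m \<Longrightarrow> v s \<bullet> v u = (if s = u then 1 else 0)"
  using orth by (auto simp: orthonormal_family_def)

lemma norm_v [simp]: "s \<le> m \<Longrightarrow> norm (v s) = 1"
  using inner_v[of s s] by (simp add: norm_eq_sqrt_inner)

lemma inner_comb:
  assumes "I \<subseteq> {..m}" "u \<le> m"
  shows "comb v I y \<bullet> v u = (if u \<in> I then y u else 0)"
proof -
  have "comb v I y \<bullet> v u = (\<Sum>s\<in>I. y s * (if s = u then 1 else 0))"
    unfolding comb_def inner_sum_left using assms
    by (intro sum.cong) (auto simp: inner_v)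
  also have "\<dots> = (if u \<in> I then y u else 0)"
    using finite_subset[OF assms(1)] by (simp add: if_distrib sum.delta cong: if_cong)
  finally show ?thesis .
qed

lemma norm_comb:
  assumes "I \<subseteq> {..m}"
  shows "norm (comb v I y) = sqrt (\<Sum>s\<in>I. (y s)\<^sup>2)"
proof -
  have "comb v I y \<bullet> comb v I y = (\<Sum>s\<in>I. y s * (comb v I y \<bullet> v s))"
    by (subst (2) comb_def) (simp add: inner_sum_right inner_commute)
  also have "\<dots> = (\<Sum>s\<in>I. (y s)\<^sup>2)"
  proof (intro sum.cong refl)
    fix s assume "s \<in> I"
    then show "y s * (comb v I y \<bullet> v s) = (y s)\<^sup>2"
      using inner_comb[OF assms, of s y] assms by (auto simp: power2_eq_square)
  qed
  finally show ?thesis by (simp add: norm_eq_sqrt_inner)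
qed

abbreviation "vol \<equiv> coord_volume v {..m}"
abbreviation "vol_minus i \<equiv> coord_volume v ({..m} - {i})"

lemma nn_integral_vol:
  assumes "i \<le> m" "f \<in> borel_measurable borel"
  shows "(\<integral>\<^sup>+ y. f y \<partial>vol) = (\<integral>\<^sup>+ z. (\<integral>\<^sup>+ t. f (z + t *\<^sub>R v i) \<partial>lborel) \<partial>vol_minus i)"
  using nn_integral_coord_volume_insert[of "{..m} - {i}" i f v] assms
  by (simp add: insert_absorb)

lemma integral_vol:
  fixes f :: "'a \<Rightarrow> 'b::euclidean_space"
  assumes "i \<le> m" "integrable vol f"
  shows "(LINT y|vol. f y) = (LINT z|vol_minus i. LINT t|lborel. f (z + t *\<^sub>R v i))"
  using integral_coord_volume_insert[of "{..m} - {i}" i v f] assms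
  by (simp add: insert_absorb)

text \<open>By \<open>norm_comb\<close> the preimage of the ball is the ball in coordinates, whose
  product measure is known. The value serves twice: for finiteness on bounded sets, and as the
  source of the constant \<omega> in the radial integrals.\<close>

lemma emeasure_cball_coord_volume:
  assumes I: "I \<subseteq> {..m}" and r: "r > 0"
  shows "emeasure (coord_volume v I) (cball 0 r) = ennreal (unit_ball_vol (card I) * r ^ card I)"
proof -
  have "finite I" using I finite_subset by blast
  have "emeasure (coord_volume v I) (cball 0 r) =
     emeasure (\<Pi>\<^sub>M s\<in>I. lborel) (comb v I -` cball 0 r \<inter> space (\<Pi>\<^sub>M s\<in>I. lborel))"
    by (simp add: coord_volume_comb emeasure_distr)
  also have "comb v I -` cball 0 r \<inter> space (\<Pi>\<^sub>M s\<in>I. lborel) =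
     {f. sqrt (\<Sum>i\<in>I. (f i)\<^sup>2) \<le> r} \<inter> space (\<Pi>\<^sub>M s\<in>I. lborel)"
    by (auto simp: norm_comb I)
  also have "emeasure (\<Pi>\<^sub>M s\<in>I. lborel) \<dots> = ennreal (unit_ball_vol (card I) * r ^ card I)"
    by (rule emeasure_cball_aux) fact+
  finally show ?thesis .
qed

lemma emeasure_coord_volume_bounded:
  assumes I: "I \<subseteq> {..m}" and "bounded B"
  shows "emeasure (coord_volume v I) B < \<infinity>"
proof -
  obtain R where R: "B \<subseteq> cball 0 R" "R > 0"
    using bounded_subset_ballD[OF \<open>bounded B\<close>, of 0] ball_subset_cball by blast
  have "emeasure (coord_volume v I) B \<le> emeasure (coord_volume v I) (cball 0 R)"
    by (rule emeasure_mono) (use R in auto)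
  then show ?thesis
    using emeasure_cball_coord_volume[OF I R(2)] by (simp add: le_less_trans)
qed

lemma integrable_coord_volume:
  fixes f :: "'a \<Rightarrow> 'b::euclidean_space"
  assumes I: "I \<subseteq> {..m}" and f [measurable]: "f \<in> borel_measurable borel"
    and bd: "\<And>y. norm (f y) \<le> C" and supp: "\<And>y. norm y > R \<Longrightarrow> f y = 0"
  shows "integrable (coord_volume v I) f"
proof (rule integrableI_bounded_set[of "cball 0 R" _ _ C])
  show "AE x in coord_volume v I. x \<in> cball 0 R \<longrightarrow> norm (f x) \<le> C" by (simp add: bd)
  show "AE x in coord_volume v I. x \<notin> cball 0 R \<longrightarrow> f x = 0" using supp by auto
qed (use emeasure_coord_volume_bounded[OF I] in auto)

text \<open>The measures live on all of \<open>'a\<close>. What holds only on \<open>M\<close>, or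
  only where the coordinates outside \<open>I\<close> vanish, is brought into integrals through this
  statement.\<close>

lemma AE_coord_volume:
  assumes I: "I \<subseteq> {..m}"
  shows "AE z in coord_volume v I. z \<in> span (v ` {..m}) \<and> (\<forall>s\<le>m. s \<notin> I \<longrightarrow> z \<bullet> v s = 0)"
proof -
  have meas: "{z. z \<in> span (v ` {..m}) \<and> (\<forall>s\<le>m. s \<notin> I \<longrightarrow> z \<bullet> v s = 0)} \<in> sets borel"
    (is "?A \<in> _")
  proof -
    have "?A = span (v ` {..m}) \<inter> (\<Inter>s\<in>{s. s \<le> m \<and> s \<notin> I}. {z. z \<bullet> v s = 0})"
      by auto
    moreover have "closed \<dots>"
      by (intro closed_Int closed_span closed_INT ballI closed_Collect_eq continuous_intros)
    ultimately show ?thesis by (simp add: borel_closed)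
  qed
  have "comb v I y \<in> span (v ` {..m})" for y
    unfolding comb_def using I by (intro span_sum span_scale span_base) auto
  moreover have "comb v I y \<bullet> v s = 0" if "s \<le> m" "s \<notin> I" for y s
    using that I by (simp add: inner_comb)
  ultimately show ?thesis
    unfolding coord_volume_comb by (subst AE_distr_iff) (use meas in auto)
qed

text \<open>Invariance under shears along \<open>v i\<close>; it replaces every other change of variables.\<close>

lemma distr_shear:
  assumes i: "i \<le> m" and \<gamma> [measurable]: "\<gamma> \<in> borel_measurable borel"
    and inv: "\<And>y t. \<gamma> (y + t *\<^sub>R v i) = \<gamma> y"
  shows "distr vol borel (\<lambda>y. y + \<gamma> y *\<^sub>R v i) = vol"
proof (rule measure_eqI)
  fix A assume "A \<in> sets (distr vol borel (\<lambda>y. y + \<gamma> y *\<^sub>R v i))"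
  then have A [measurable]: "A \<in> sets borel" by simp
  have "emeasure (distr vol borel (\<lambda>y. y + \<gamma> y *\<^sub>R v i)) A =
      (\<integral>\<^sup>+ y. indicator A (y + \<gamma> y *\<^sub>R v i) \<partial>vol)"
    by (subst nn_integral_indicator[symmetric]) (simp_all add: nn_integral_distr del: nn_integral_indicator)
  also have "\<dots> = (\<integral>\<^sup>+ z. (\<integral>\<^sup>+ t. indicator A (z + t *\<^sub>R v i + \<gamma> (z + t *\<^sub>R v i) *\<^sub>R v i) \<partial>lborel) \<partial>vol_minus i)"
    by (rule nn_integral_vol[OF i]) measurable
  also have "\<dots> = (\<integral>\<^sup>+ z. (\<integral>\<^sup>+ t. indicator A (z + (\<gamma> z + 1 * t) *\<^sub>R v i) \<partial>lborel) \<partial>vol_minus i)"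
    by (simp add: inv algebra_simps)
  also have "\<dots> = (\<integral>\<^sup>+ z. (\<integral>\<^sup>+ t. indicator A (z + t *\<^sub>R v i) \<partial>lborel) \<partial>vol_minus i)"
  proof (rule nn_integral_cong)
    fix z
    show "(\<integral>\<^sup>+ t. indicator A (z + (\<gamma> z + 1 * t) *\<^sub>R v i) \<partial>lborel) =
        (\<integral>\<^sup>+ t. indicator A (z + t *\<^sub>R v i) \<partial>lborel)"
      using nn_integral_real_affine[of "\<lambda>t. indicator A (z + t *\<^sub>R v i)" 1 "\<gamma> z"] by simp
  qed
  also have "\<dots> = (\<integral>\<^sup>+ y. indicator A y \<partial>vol)"
    by (rule nn_integral_vol[OF i, symmetric]) measurable
  also have "\<dots> = emeasure vol A" by simp
  finally show "emeasure (distr vol borel (\<lambda>y. y + \<gamma> y *\<^sub>R v i)) A = emeasure vol A" .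
qed simp

text \<open>A translation by a vector of \<open>M\<close> is a composition of shears with constant
  \<gamma>, one for each frame vector, hence the induction over the span.\<close>

lemma distr_translate:
  assumes "x \<in> span (v ` {..m})"
  shows "distr vol borel (\<lambda>y. y + x) = vol"
  using assms
proof (induction rule: span_induct_alt)
  case base
  show ?case by (simp add: distr_id2)
next
  case (step c b y)
  then obtain i where i: "b = v i" "i \<le> m" by auto
  have "distr vol borel (\<lambda>z. z + (c *\<^sub>R b + y)) =
        distr (distr vol borel (\<lambda>z. z + c *\<^sub>R b)) borel (\<lambda>z. z + y)"
    by (subst distr_distr) (auto simp: o_def algebra_simps)
  also have "distr vol borel (\<lambda>z. z + c *\<^sub>R b) = vol"
    unfolding i by (rule distr_shear[OF i(2)]) auto
  finally show ?case using step.IH by simp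
qed

end

section \<open>Continuously differentiable functions\<close>

text \<open>The derivative is a parameter, so that the closure rules below compute it. Continuity is
  asked one direction at a time, which in finite dimension amounts to continuity of the derivative
  as a map. The domain is the whole space, so no side conditions about open sets arise.\<close>

definition C1 :: "('a::euclidean_space \<Rightarrow> 'b::euclidean_space) \<Rightarrow> ('a \<Rightarrow> 'a \<Rightarrow> 'b) \<Rightarrow> bool" where
  "C1 f f' \<longleftrightarrow> (\<forall>y. (f has_derivative f' y) (at y)) \<and> (\<forall>h. continuous_on UNIV (\<lambda>y. f' y h))"

definition bounded_support :: "('a::real_normed_vector \<Rightarrow> 'b::zero) \<Rightarrow> bool" where
  "bounded_support f \<longleftrightarrow> (\<exists>R. \<forall>y. norm y > R \<longrightarrow> f y = 0)"

lemma C1_has_derivative: "C1 f f' \<Longrightarrow> (f has_derivative f' y) (at y)"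
  by (simp add: C1_def)

lemma C1_deriv_linear: "C1 f f' \<Longrightarrow> linear (f' y)"
  using C1_has_derivative has_derivative_linear by blast

lemma C1_continuous: "C1 f f' \<Longrightarrow> continuous_on A f"
  by (meson C1_has_derivative continuous_at_imp_continuous_on has_derivative_continuous)

lemma C1_deriv_continuous: "C1 f f' \<Longrightarrow> continuous_on A (\<lambda>y. f' y h)"
  by (auto simp: C1_def intro: continuous_on_subset)

lemma C1_measurable: "C1 f f' \<Longrightarrow> f \<in> borel_measurable borel"
  by (intro borel_measurable_continuous_onI C1_continuous)

lemma C1_deriv_measurable: "C1 f f' \<Longrightarrow> (\<lambda>y. f' y h) \<in> borel_measurable borel"
  by (intro borel_measurable_continuous_onI C1_deriv_continuous)

lemma C1_line:
  assumes "C1 f f'"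
  shows "((\<lambda>t. f (z + t *\<^sub>R h)) has_vector_derivative f' (z + t *\<^sub>R h) h) (at t)"
proof -
  have "((\<lambda>t. z + t *\<^sub>R h) has_derivative (\<lambda>t. t *\<^sub>R h)) (at t)"
    by (auto intro!: derivative_eq_intros)
  from has_derivative_compose[OF this C1_has_derivative[OF assms]]
  have "((\<lambda>t. f (z + t *\<^sub>R h)) has_derivative (\<lambda>s. f' (z + t *\<^sub>R h) (s *\<^sub>R h))) (at t)" .
  then show ?thesis
    by (simp add: has_vector_derivative_def linear_cmul[OF C1_deriv_linear[OF assms]])
qed

lemma C1_deriv_eq_on_open:
  assumes f: "C1 f f'" and g: "(g has_derivative D) (at y)" and "open U" "y \<in> U"
    and eq: "\<And>z. z \<in> U \<Longrightarrow> f z = g z"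
  shows "f' y = D"
proof -
  have "(g has_derivative f' y) (at y)"
    using has_derivative_transform_within_open[OF C1_has_derivative[OF f] \<open>open U\<close> \<open>y \<in> U\<close> eq] .
  then show ?thesis using g has_derivative_unique by blast
qed

lemma C1_bounded_support_deriv:
  assumes f: "C1 f f'" and "\<And>y. norm y > R \<Longrightarrow> f y = 0" and "norm y > R"
  shows "f' y h = 0"
proof -
  have "f' y = (\<lambda>_. 0)"
    by (rule C1_deriv_eq_on_open[OF f has_derivative_const, of "{y. norm y > R}"])
      (use assms in \<open>auto intro!: open_Collect_less continuous_intros\<close>)
  then show ?thesis by simp
qed

lemma C1_const: "C1 (\<lambda>_. k) (\<lambda>_ _. 0)"
  by (auto simp: C1_def)

lemma C1_linear: "linear f \<Longrightarrow> C1 f (\<lambda>_. f)"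
  by (auto simp: C1_def linear_conv_bounded_linear bounded_linear_imp_has_derivative)

lemma C1_add: "C1 f f' \<Longrightarrow> C1 g g' \<Longrightarrow> C1 (\<lambda>y. f y + g y) (\<lambda>y h. f' y h + g' y h)"
  by (auto simp: C1_def intro!: derivative_eq_intros continuous_intros)

lemma C1_diff: "C1 f f' \<Longrightarrow> C1 g g' \<Longrightarrow> C1 (\<lambda>y. f y - g y) (\<lambda>y h. f' y h - g' y h)"
  by (auto simp: C1_def intro!: derivative_eq_intros continuous_intros)

lemma C1_sum:
  assumes "\<And>i. i \<in> I \<Longrightarrow> C1 (f i) (f' i)"
  shows "C1 (\<lambda>y. \<Sum>i\<in>I. f i y) (\<lambda>y h. \<Sum>i\<in>I. f' i y h)"
  using assms by (auto simp: C1_def intro!: derivative_eq_intros continuous_intros)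

lemma C1_bilinear:
  assumes bil: "bounded_bilinear bl" and f: "C1 f f'" and g: "C1 g g'"
  shows "C1 (\<lambda>y. bl (f y) (g y)) (\<lambda>y h. bl (f y) (g' y h) + bl (f' y h) (g y))"
proof -
  interpret bounded_bilinear bl by fact
  show ?thesis
    using f g C1_continuous[OF f] C1_continuous[OF g]
    by (auto simp: C1_def intro!: FDERIV continuous_on_add continuous_on)
qed

lemmas C1_scaleR = C1_bilinear[OF bounded_bilinear_scaleR]
lemmas C1_mult = C1_bilinear[OF bounded_bilinear_mult]
lemmas C1_inner = C1_bilinear[OF bounded_bilinear_inner]

lemma C1_compose_real:
  fixes u :: "'a::euclidean_space \<Rightarrow> real"
  assumes u: "C1 u u'" and k: "\<And>t. (k has_real_derivative k' t) (at t)"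
    and k': "continuous_on UNIV k'"
  shows "C1 (\<lambda>y. k (u y)) (\<lambda>y h. k' (u y) * u' y h)"
  unfolding C1_def
proof safe
  fix y
  have "(k has_derivative (\<lambda>h. k' (u y) * h)) (at (u y))"
    using k[of "u y"] by (simp add: has_field_derivative_def)
  from has_derivative_compose[OF C1_has_derivative[OF u] this]
  show "((\<lambda>y. k (u y)) has_derivative (\<lambda>h. k' (u y) * u' y h)) (at y)" .
next
  fix h
  show "continuous_on UNIV (\<lambda>y. k' (u y) * u' y h)"
    using continuous_on_compose2[OF k' C1_continuous[OF u]] C1_deriv_continuous[OF u]
    by (intro continuous_intros) auto
qed

lemma C1_prod:
  fixes f :: "'i \<Rightarrow> 'a::euclidean_space \<Rightarrow> real"
  assumes "finite I" "\<And>i. i \<in> I \<Longrightarrow> \<exists>f'. C1 (f i) f'"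
  shows "\<exists>f'. C1 (\<lambda>y. \<Prod>i\<in>I. f i y) f'"
  using assms
proof (induction rule: finite_induct)
  case empty
  then show ?case using C1_const by auto
next
  case (insert i I)
  then obtain a b where "C1 (f i) a" "C1 (\<lambda>y. \<Prod>i\<in>I. f i y) b" by blast
  from C1_mult[OF this] insert.hyps show ?case by auto
qed

lemma C1_shear:
  assumes f: "C1 f f'" and \<gamma>: "C1 \<gamma> \<gamma>'"
  shows "C1 (\<lambda>y. f (y + \<gamma> y *\<^sub>R w))
    (\<lambda>y h. f' (y + \<gamma> y *\<^sub>R w) h + \<gamma>' y h *\<^sub>R f' (y + \<gamma> y *\<^sub>R w) w)"
  unfolding C1_def
proof safe
  fix y
  have "((\<lambda>y. y + \<gamma> y *\<^sub>R w) has_derivative (\<lambda>h. h + \<gamma>' y h *\<^sub>R w)) (at y)"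
    using C1_has_derivative[OF \<gamma>] by (auto intro!: derivative_eq_intros)
  from has_derivative_compose[OF this C1_has_derivative[OF f]]
  show "((\<lambda>y. f (y + \<gamma> y *\<^sub>R w)) has_derivative
      (\<lambda>h. f' (y + \<gamma> y *\<^sub>R w) h + \<gamma>' y h *\<^sub>R f' (y + \<gamma> y *\<^sub>R w) w)) (at y)"
    by (simp add: linear_add[OF C1_deriv_linear[OF f]] linear_cmul[OF C1_deriv_linear[OF f]])
next
  fix h
  have *: "continuous_on UNIV (\<lambda>y. f' (y + \<gamma> y *\<^sub>R w) k)" for k
    by (intro continuous_on_compose2[OF C1_deriv_continuous[OF f, of UNIV]]
        continuous_intros C1_continuous[OF \<gamma>]) auto
  show "continuous_on UNIV (\<lambda>y. f' (y + \<gamma> y *\<^sub>R w) h + \<gamma>' y h *\<^sub>R f' (y + \<gamma> y *\<^sub>R w) w)"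
    by (intro continuous_intros * C1_deriv_continuous[OF \<gamma>])
qed

lemma C1_deriv_invariant:
  assumes \<gamma>: "C1 \<gamma> \<gamma>'" and inv: "\<And>y t. \<gamma> (y + t *\<^sub>R w) = \<gamma> y"
  shows "\<gamma>' (y + t *\<^sub>R w) h = \<gamma>' y h" and "\<gamma>' y w = 0"
proof -
  have "((\<lambda>y. \<gamma> (y + t *\<^sub>R w)) has_derivative \<gamma>' (y + t *\<^sub>R w)) (at y)"
    by (rule has_derivative_compose[OF _ C1_has_derivative[OF \<gamma>], where f' = "\<lambda>h. h"])
      (auto intro!: derivative_eq_intros)
  then have "\<gamma>' (y + t *\<^sub>R w) = \<gamma>' y"
    using C1_has_derivative[OF \<gamma>] has_derivative_unique by (simp add: inv) blast
  then show "\<gamma>' (y + t *\<^sub>R w) h = \<gamma>' y h" by simp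
  have "((\<lambda>t. \<gamma> (y + t *\<^sub>R w)) has_vector_derivative \<gamma>' y w) (at 0)"
    using C1_line[OF \<gamma>, of y w 0] by simp
  moreover have "((\<lambda>t. \<gamma> (y + t *\<^sub>R w)) has_vector_derivative 0) (at (0::real))"
    by (simp add: inv)
  ultimately show "\<gamma>' y w = 0" using vector_derivative_unique_at by blast
qed


section \<open>The divergence theorem below a graph\<close>

text \<open>The fundamental theorem of calculus on a long interval. The half-line ends at -a when sg
  = 1 and begins there when sg = -1, which gives the factor sg. Strict and weak inequality differ at
  the single point -a, a null set.\<close>

lemma integral_line_deriv:
  fixes g :: "real \<Rightarrow> 'b::euclidean_space"
  assumes g: "\<And>t. (g has_vector_derivative g' t) (at t)" and g': "continuous_on UNIV g'"
    and supp: "\<And>t. \<bar>t\<bar> > R \<Longrightarrow> g t = 0" "\<And>t. \<bar>t\<bar> > R \<Longrightarrow> g' t = 0"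
  shows "(LINT t|lborel. g' t) = 0"
    and "sg \<in> {1, -1::real} \<Longrightarrow>
      (LINT t|lborel. indicator {t. sg * (a + t) < 0} t *\<^sub>R g' t) = sg *\<^sub>R g (- a)"
proof -
  \<comment> \<open>T exceeds R and |a|: then g vanishes at both T and -T, and -a lies between
    them.\<close>
  define T where "T = \<bar>R\<bar> + \<bar>a\<bar> + 1"
  have T: "g T = 0" "g (-T) = 0" and T': "\<And>t. t \<notin> {-T..T} \<Longrightarrow> g' t = 0"
    using supp by (auto simp: T_def)
  have FTC: "(LINT t|lborel. indicator {x..y} t *\<^sub>R g' t) = g y - g x" if "x \<le> y" for x y
    by (rule integral_FTC_atLeastAtMost)
      (use that in \<open>auto intro: has_vector_derivative_at_within g continuous_on_subset[OF g']\<close>)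
  have [measurable]: "g' \<in> borel_measurable borel"
    using g' by (rule borel_measurable_continuous_onI)
  have "(LINT t|lborel. g' t) = (LINT t|lborel. indicator {-T..T} t *\<^sub>R g' t)"
    by (rule Bochner_Integration.integral_cong) (use T' in \<open>auto simp: indicator_def\<close>)
  also have "\<dots> = 0"
    by (subst FTC) (auto simp: T, auto simp: T_def)
  finally show "(LINT t|lborel. g' t) = 0" .
  assume "sg \<in> {1, -1}"
  then consider "sg = 1" | "sg = -1" by auto
  then show "(LINT t|lborel. indicator {t. sg * (a + t) < 0} t *\<^sub>R g' t) = sg *\<^sub>R g (- a)"
  proof cases
    case 1
    have "(LINT t|lborel. indicator {t. sg * (a + t) < 0} t *\<^sub>R g' t) =
        (LINT t|lborel. indicator {-T..-a} t *\<^sub>R g' t)"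
    proof (rule integral_cong_AE)
      show "AE t in lborel. indicator {t. sg * (a + t) < 0} t *\<^sub>R g' t =
          indicator {-T..-a} t *\<^sub>R g' t"
        using AE_lborel_singleton[of "-a"] by eventually_elim (use T' 1 in \<open>auto simp: indicator_def\<close>)
    qed measurable
    also have "\<dots> = sg *\<^sub>R g (- a)"
      by (subst FTC) (auto simp: T 1, auto simp: T_def)
    finally show ?thesis .
  next
    case 2
    have "(LINT t|lborel. indicator {t. sg * (a + t) < 0} t *\<^sub>R g' t) =
        (LINT t|lborel. indicator {-a..T} t *\<^sub>R g' t)"
    proof (rule integral_cong_AE)
      show "AE t in lborel. indicator {t. sg * (a + t) < 0} t *\<^sub>R g' t =
          indicator {-a..T} t *\<^sub>R g' t"
        using AE_lborel_singleton[of "-a"] by eventually_elim (use T' 2 in \<open>auto simp: indicator_def\<close>)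
    qed measurable
    also have "\<dots> = sg *\<^sub>R g (- a)"
      by (subst FTC) (auto simp: T 2, auto simp: T_def)
    finally show ?thesis .
  qed
qed

lemma continuous_bounded_support_imp_bounded:
  fixes f :: "'a::euclidean_space \<Rightarrow> 'b::real_normed_vector"
  assumes "continuous_on UNIV f" and supp: "\<And>y. norm y > R \<Longrightarrow> f y = 0"
  obtains C where "\<And>y. norm (f y) \<le> C"
proof -
  have "compact (f ` cball 0 R)"
    by (intro compact_continuous_image continuous_on_subset[OF assms(1)]) auto
  then obtain C where "\<And>y. y \<in> cball 0 R \<Longrightarrow> norm (f y) \<le> C"
    using compact_imp_bounded bounded_iff by (metis image_eqI)
  then have "norm (f y) \<le> max C 0" for y
    by (cases "norm y > R") (auto simp: supp le_max_iff_disj)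
  then show ?thesis using that by blast
qed

context orthonormal_frame begin

lemma integrable_continuous_bounded_support:
  fixes f :: "'a \<Rightarrow> 'b::euclidean_space"
  assumes I: "I \<subseteq> {..m}" and f: "continuous_on UNIV f" and "bounded_support f"
    and [measurable]: "A \<in> sets borel"
  shows "integrable (coord_volume v I) (\<lambda>y. indicator A y *\<^sub>R f y)"
proof -
  have [measurable]: "f \<in> borel_measurable borel"
    using f by (rule borel_measurable_continuous_onI)
  obtain R where R: "\<And>y. norm y > R \<Longrightarrow> f y = 0"
    using assms by (auto simp: bounded_support_def)
  obtain C where C: "\<And>y. norm (f y) \<le> C"
    using continuous_bounded_support_imp_bounded[OF f R] by blast
  have "C \<ge> 0" using C[of 0] norm_ge_zero order_trans by blast
  show ?thesis
    by (rule integrable_coord_volume[OF I, of _ C R])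
      (use R C \<open>C \<ge> 0\<close> in \<open>auto simp: indicator_def\<close>)
qed

text \<open>\<open>A\<close> is a union of lines parallel to \<open>v s\<close>, so on each of them
  the indicator is constant and the derivative of a function of bounded support integrates to 0. It
  is used for a half-space parallel to \<open>v s\<close>, and with \<open>A = UNIV\<close> for
  pieces supported inside the domain.\<close>

lemma integral_tangential_deriv:
  fixes g :: "'a \<Rightarrow> 'b::euclidean_space"
  assumes g: "C1 g g'" "bounded_support g" and s: "s \<le> m"
    and A: "A \<in> sets borel" "\<And>y t. y + t *\<^sub>R v s \<in> A \<longleftrightarrow> y \<in> A"
  shows "(LINT y|vol. indicator A y *\<^sub>R g' y (v s)) = 0"
proof -
  obtain R where R: "\<And>y. norm y > R \<Longrightarrow> g y = 0"
    using g(2) by (auto simp: bounded_support_def)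
  note R' = C1_bounded_support_deriv[OF g(1) R]
  have far: "norm (z + t *\<^sub>R v s) > R" if "\<bar>t\<bar> > R + norm z" for z t
    using that norm_triangle_ineq2[of "t *\<^sub>R v s" "-z"] s by (simp add: add.commute)
  have cont: "continuous_on UNIV (\<lambda>t. g' (z + t *\<^sub>R v s) (v s))" for z
    by (intro continuous_on_compose2[OF C1_deriv_continuous[OF g(1), of UNIV]] continuous_intros) auto
  have "bounded_support (\<lambda>y. g' y (v s))" unfolding bounded_support_def using R' by blast
  then have "(LINT y|vol. indicator A y *\<^sub>R g' y (v s)) =
      (LINT z|vol_minus s. LINT t|lborel. indicator A (z + t *\<^sub>R v s) *\<^sub>R g' (z + t *\<^sub>R v s) (v s))"
    by (intro integral_vol s integrable_continuous_bounded_support A(1) order_refl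
        C1_deriv_continuous[OF g(1)])
  also have "\<dots> = (LINT z|vol_minus s. indicator A z *\<^sub>R (LINT t|lborel. g' (z + t *\<^sub>R v s) (v s)))"
    by (simp add: indicator_def A(2))
  also have "\<dots> = 0"
  proof -
    have "(LINT t|lborel. g' (z + t *\<^sub>R v s) (v s)) = 0" for z
      by (rule integral_line_deriv(1)[OF C1_line[OF g(1)] cont, of "R + norm z"]) (use R R' far in auto)
    then show ?thesis by simp
  qed
  finally show ?thesis .
qed

text \<open>The divergence theorem for a half-space. The weight w is constant along
  \<open>v i\<close> and so leaves the inner integral; later it carries the slope of the graph that
  the shear produces.\<close>

lemma integral_flat:
  fixes g :: "'a \<Rightarrow> 'b::euclidean_space"
  assumes g: "C1 g g'" "bounded_support g" and i: "i \<le> m" and s: "s \<le> m" and sg: "sg \<in> {1, -1::real}"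
  shows "s \<noteq> i \<Longrightarrow> (LINT y|vol. indicator {y. sg * (y \<bullet> v i) < 0} y *\<^sub>R g' y (v s)) = 0"
    and "continuous_on UNIV w \<Longrightarrow> (\<And>y t. w (y + t *\<^sub>R v i) = w y) \<Longrightarrow>
      (LINT y|vol. indicator {y. sg * (y \<bullet> v i) < 0} y *\<^sub>R w y *\<^sub>R g' y (v i)) =
      (LINT z|vol_minus i. (sg * w z) *\<^sub>R g z)"
proof -
  obtain R where R: "\<And>y. norm y > R \<Longrightarrow> g y = 0"
    using g(2) by (auto simp: bounded_support_def)
  note R' = C1_bounded_support_deriv[OF g(1) R]
  have supp': "bounded_support (\<lambda>y. g' y h)" for h
    unfolding bounded_support_def using R' by blast
  have far: "norm (z + t *\<^sub>R v u) > R" if "\<bar>t\<bar> > R + norm z" "u \<le> m" for z t u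
    using that norm_triangle_ineq2[of "t *\<^sub>R v u" "-z"] by (simp add: add.commute)
  have cont: "continuous_on UNIV (\<lambda>t. g' (z + t *\<^sub>R v u) h)" for z u h
    by (intro continuous_on_compose2[OF C1_deriv_continuous[OF g(1), of UNIV]] continuous_intros) auto
  have half: "{y. sg * (y \<bullet> v i) < 0} \<in> sets borel" by measurable
  have inner: "(z + t *\<^sub>R v u) \<bullet> v i = z \<bullet> v i + (if u = i then t else 0)" if "u \<le> m" for z t u
    using that i by (simp add: inner_add_left inner_v)
  show "(LINT y|vol. indicator {y. sg * (y \<bullet> v i) < 0} y *\<^sub>R g' y (v s)) = 0" if "s \<noteq> i"
    by (rule integral_tangential_deriv[OF g s half]) (use that s inner in simp)
  assume w: "continuous_on UNIV w" "\<And>y t. w (y + t *\<^sub>R v i) = w y"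
  have [measurable]: "w \<in> borel_measurable borel" "g \<in> borel_measurable borel"
    using w(1) C1_measurable[OF g(1)] by (auto intro: borel_measurable_continuous_onI)
  have "(LINT y|vol. indicator {y. sg * (y \<bullet> v i) < 0} y *\<^sub>R w y *\<^sub>R g' y (v i)) =
    (LINT z|vol_minus i. LINT t|lborel. indicator {y. sg * (y \<bullet> v i) < 0} (z + t *\<^sub>R v i) *\<^sub>R
        w (z + t *\<^sub>R v i) *\<^sub>R g' (z + t *\<^sub>R v i) (v i))"
  proof (intro integral_vol i integrable_continuous_bounded_support half order_refl)
    show "continuous_on UNIV (\<lambda>y. w y *\<^sub>R g' y (v i))"
      by (intro continuous_intros w C1_deriv_continuous[OF g(1)])
    show "bounded_support (\<lambda>y. w y *\<^sub>R g' y (v i))"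
      using supp'[of "v i"] by (auto simp: bounded_support_def)
  qed
  also have "\<dots> = (LINT z|vol_minus i. w z *\<^sub>R (LINT t|lborel.
      indicator {t. sg * (z \<bullet> v i + t) < 0} t *\<^sub>R g' (z + t *\<^sub>R v i) (v i)))"
    using i by (simp add: indicator_def inner w(2) if_distrib[of "\<lambda>c. c *\<^sub>R _"]
        mult.commute scaleR_left_commute[of "w _"] flip: integral_scaleR_right cong: if_cong)
  \<comment> \<open>The line through z meets the boundary hyperplane at t = -(z . v i). For almost
    every z with respect to \<open>vol_minus i\<close> this is t = 0, which turns the value into g z
    in the next step.\<close>
  also have "\<dots> = (LINT z|vol_minus i. w z *\<^sub>R sg *\<^sub>R g (z + (- (z \<bullet> v i)) *\<^sub>R v i))"
  proof -
    have "(LINT t|lborel. indicator {t. sg * (z \<bullet> v i + t) < 0} t *\<^sub>R g' (z + t *\<^sub>R v i) (v i)) =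
        sg *\<^sub>R g (z + (- (z \<bullet> v i)) *\<^sub>R v i)" for z
      by (rule integral_line_deriv(2)[OF C1_line[OF g(1)] cont, of "R + norm z"])
        (use R R' far i sg in auto)
    then show ?thesis by simp
  qed
  also have "\<dots> = (LINT z|vol_minus i. (sg * w z) *\<^sub>R g z)"
  proof (rule integral_cong_AE)
    show "AE z in vol_minus i. w z *\<^sub>R sg *\<^sub>R g (z + (- (z \<bullet> v i)) *\<^sub>R v i) = (sg * w z) *\<^sub>R g z"
    proof (rule eventually_mono[OF AE_coord_volume[of "{..m} - {i}"]])
      fix z assume "z \<in> span (v ` {..m}) \<and> (\<forall>s\<le>m. s \<notin> {..m} - {i} \<longrightarrow> z \<bullet> v s = 0)"
      then have "z \<bullet> v i = 0" using i by simp
      then show "w z *\<^sub>R sg *\<^sub>R g (z + (- (z \<bullet> v i)) *\<^sub>R v i) = (sg * w z) *\<^sub>R g z"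
        by (simp add: mult.commute)
    qed auto
  qed measurable
  finally show "(LINT y|vol. indicator {y. sg * (y \<bullet> v i) < 0} y *\<^sub>R w y *\<^sub>R g' y (v i)) =
      (LINT z|vol_minus i. (sg * w z) *\<^sub>R g z)" .
qed

text \<open>If the sheared point lies in the ball of radius R, then \<gamma> at y equals \<gamma> at
  the sheared point by invariance, hence is bounded by its maximum over that ball; so y is bounded
  as well.\<close>

lemma bounded_support_shear:
  assumes f: "bounded_support f" and \<gamma>: "continuous_on UNIV \<gamma>"
    and inv: "\<And>y t. \<gamma> (y + t *\<^sub>R v i) = \<gamma> y" and i: "i \<le> m"
  shows "bounded_support (\<lambda>y. f (y + \<gamma> y *\<^sub>R v i))"
proof -
  obtain R where R: "\<And>y. norm y > R \<Longrightarrow> f y = 0"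
    using f by (auto simp: bounded_support_def)
  have "compact (\<gamma> ` cball 0 R)"
    by (intro compact_continuous_image continuous_on_subset[OF \<gamma>]) auto
  then obtain C where C: "\<And>y. y \<in> cball 0 R \<Longrightarrow> \<bar>\<gamma> y\<bar> \<le> C"
    using compact_imp_bounded bounded_iff by (metis image_eqI real_norm_def)
  have "f (y + \<gamma> y *\<^sub>R v i) = 0" if y: "norm y > R + C" for y
  proof (rule ccontr)
    assume "f (y + \<gamma> y *\<^sub>R v i) \<noteq> 0"
    then have *: "norm (y + \<gamma> y *\<^sub>R v i) \<le> R" using R by force
    then have "\<bar>\<gamma> y\<bar> \<le> C" using C[of "y + \<gamma> y *\<^sub>R v i"] by (simp add: inv)
    moreover have "norm y \<le> norm (y + \<gamma> y *\<^sub>R v i) + norm (\<gamma> y *\<^sub>R v i)"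
      using norm_triangle_ineq4[of "y + \<gamma> y *\<^sub>R v i" "\<gamma> y *\<^sub>R v i"] by simp
    ultimately show False using * y i by simp
  qed
  then show ?thesis unfolding bounded_support_def by blast
qed

text \<open>With g the sheared f, the derivative of f along \<open>v s\<close> at the sheared point
  is \<open>g' y (v s)\<close> minus \<gamma>'(v s) times \<open>g' y (v i)\<close>. Applied to
  these two terms, the flat case yields the two summands of the boundary weight. That weight is the
  component of the normal before normalization, so no area factor appears at this stage.\<close>

theorem divergence_below_graph:
  fixes f :: "'a \<Rightarrow> 'b::euclidean_space"
  assumes f: "C1 f f'" "bounded_support f" and \<gamma>: "C1 \<gamma> \<gamma>'" "\<And>y t. \<gamma> (y + t *\<^sub>R v i) = \<gamma> y"
    and i: "i \<le> m" and s: "s \<le> m" and sg: "sg \<in> {1, -1::real}"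
  shows "(LINT y|vol. indicator {y. sg * (y \<bullet> v i) < sg * \<gamma> y} y *\<^sub>R f' y (v s)) =
    (LINT z|vol_minus i. (sg * ((if s = i then 1 else 0) - \<gamma>' z (v s))) *\<^sub>R f (z + \<gamma> z *\<^sub>R v i))"
proof -
  have [measurable]: "\<gamma> \<in> borel_measurable borel" "(\<lambda>y. f' y (v s)) \<in> borel_measurable borel"
    using C1_measurable[OF \<gamma>(1)] C1_deriv_measurable[OF f(1)] .
  define g where "g y = f (y + \<gamma> y *\<^sub>R v i)" for y
  define g' where "g' y h = f' (y + \<gamma> y *\<^sub>R v i) h + \<gamma>' y h *\<^sub>R f' (y + \<gamma> y *\<^sub>R v i) (v i)" for y h
  have g: "C1 g g'"
    unfolding g_def g'_def by (rule C1_shear[OF f(1) \<gamma>(1)])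
  have gsupp: "bounded_support g"
    unfolding g_def by (rule bounded_support_shear[OF f(2) C1_continuous[OF \<gamma>(1)] \<gamma>(2) i])
  have gi: "g' y (v i) = f' (y + \<gamma> y *\<^sub>R v i) (v i)" for y
    by (simp add: g'_def C1_deriv_invariant(2)[OF \<gamma>])
  have supp': "bounded_support (\<lambda>y. g' y h)" for h
    using gsupp C1_bounded_support_deriv[OF g] unfolding bounded_support_def by blast
  let ?H = "{y. sg * (y \<bullet> v i) < 0}"
  have half: "?H \<in> sets borel" by measurable
  define w where "w y = \<gamma>' y (v s)" for y
  have w: "continuous_on UNIV w" "\<And>y t. w (y + t *\<^sub>R v i) = w y"
    unfolding w_def using C1_deriv_continuous[OF \<gamma>(1)] C1_deriv_invariant(1)[OF \<gamma>] by auto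
  have "(LINT y|vol. indicator {y. sg * (y \<bullet> v i) < sg * \<gamma> y} y *\<^sub>R f' y (v s)) =
      (LINT y|distr vol borel (\<lambda>y. y + \<gamma> y *\<^sub>R v i).
         indicator {y. sg * (y \<bullet> v i) < sg * \<gamma> y} y *\<^sub>R f' y (v s))"
    using distr_shear[OF i _ \<gamma>(2)] by simp
  also have "\<dots> = (LINT y|vol. indicator {y. sg * (y \<bullet> v i) < sg * \<gamma> y} (y + \<gamma> y *\<^sub>R v i) *\<^sub>R
        f' (y + \<gamma> y *\<^sub>R v i) (v s))"
    by (rule integral_distr) measurable
  also have "\<dots> = (LINT y|vol. indicator ?H y *\<^sub>R g' y (v s) - indicator ?H y *\<^sub>R w y *\<^sub>R g' y (v i))"
  proof (rule Bochner_Integration.integral_cong[OF refl])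
    fix y
    have "indicator {y. sg * (y \<bullet> v i) < sg * \<gamma> y} (y + \<gamma> y *\<^sub>R v i) = (indicator ?H y :: real)"
      using i by (auto simp: indicator_def inner_add_left inner_v \<gamma>(2) algebra_simps)
    then show "indicator {y. sg * (y \<bullet> v i) < sg * \<gamma> y} (y + \<gamma> y *\<^sub>R v i) *\<^sub>R
        f' (y + \<gamma> y *\<^sub>R v i) (v s) = indicator ?H y *\<^sub>R g' y (v s) - indicator ?H y *\<^sub>R w y *\<^sub>R g' y (v i)"
      by (simp add: gi) (simp add: g'_def w_def algebra_simps)
  qed
  also have "\<dots> = (LINT y|vol. indicator ?H y *\<^sub>R g' y (v s)) -
      (LINT y|vol. indicator ?H y *\<^sub>R w y *\<^sub>R g' y (v i))"
  proof (intro Bochner_Integration.integral_diff integrable_continuous_bounded_support half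
      C1_deriv_continuous[OF g] supp' order_refl continuous_intros w)
    show "bounded_support (\<lambda>y. w y *\<^sub>R g' y (v i))"
      using supp'[of "v i"] by (auto simp: bounded_support_def)
  qed
  \<comment> \<open>The first integral is tangential and vanishes for s other than i; for s = i it
    is the weighted flat identity with weight 1.\<close>
  also have "\<dots> = (LINT z|vol_minus i. (sg * (if s = i then 1 else 0)) *\<^sub>R g z) -
      (LINT z|vol_minus i. (sg * w z) *\<^sub>R g z)"
    using integral_flat(1)[OF g gsupp i s sg] integral_flat(2)[OF g gsupp i s sg w]
      integral_flat(2)[OF g gsupp i s sg, of "\<lambda>_. 1"]
    by (cases "s = i") auto
  also have "\<dots> = (LINT z|vol_minus i. (sg * (if s = i then 1 else 0)) *\<^sub>R g z - (sg * w z) *\<^sub>R g z)"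
  proof -
    have I: "integrable (vol_minus i) (\<lambda>z. a z *\<^sub>R g z)" if "continuous_on UNIV a" for a
    proof -
      have "bounded_support (\<lambda>z. a z *\<^sub>R g z)"
        using gsupp by (auto simp: bounded_support_def)
      from integrable_continuous_bounded_support[OF _ _ this, of "{..m} - {i}" UNIV] show ?thesis
        using that C1_continuous[OF g] by (auto intro!: continuous_intros)
    qed
    show ?thesis
      by (intro Bochner_Integration.integral_diff[symmetric] I continuous_intros w)
  qed
  also have "\<dots> = (LINT z|vol_minus i. (sg * ((if s = i then 1 else 0) - \<gamma>' z (v s))) *\<^sub>R f (z + \<gamma> z *\<^sub>R v i))"
    by (simp add: g_def w_def algebra_simps)
  finally show ?thesis .
qed

end

section \<open>Boundary charts and the outward normal\<close>

lemma partial_eqI: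
  assumes "((\<lambda>t. f (x + t *\<^sub>R v s)) has_vector_derivative D) (at 0)"
  shows "partial v s f x = D"
proof -
  have "((\<lambda>\<epsilon>. inverse \<epsilon> *\<^sub>R (f (x + \<epsilon> *\<^sub>R v s) - f x)) \<longlongrightarrow> D) (at (0::real))"
  proof (subst Lim_null, subst tendsto_norm_zero_iff[symmetric])
    have "((\<lambda>h. norm (f (x + h *\<^sub>R v s) - f x - h *\<^sub>R D) / norm h) \<longlongrightarrow> 0) (at 0)"
      using assms by (simp add: has_vector_derivative_def has_derivative_at)
    then show "((\<lambda>\<epsilon>. norm (inverse \<epsilon> *\<^sub>R (f (x + \<epsilon> *\<^sub>R v s) - f x) - D)) \<longlongrightarrow> 0) (at 0)"
    proof (rule Lim_transform_eventually)
      show "\<forall>\<^sub>F \<epsilon> in at 0. norm (f (x + \<epsilon> *\<^sub>R v s) - f x - \<epsilon> *\<^sub>R D) / norm \<epsilon> =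
          norm (inverse \<epsilon> *\<^sub>R (f (x + \<epsilon> *\<^sub>R v s) - f x) - D)"
      proof (rule eventually_at_filter[THEN iffD2], intro always_eventually allI impI)
        fix \<epsilon> :: real assume "\<epsilon> \<noteq> 0"
        then have "inverse \<epsilon> *\<^sub>R (f (x + \<epsilon> *\<^sub>R v s) - f x) - D =
            inverse \<epsilon> *\<^sub>R (f (x + \<epsilon> *\<^sub>R v s) - f x - \<epsilon> *\<^sub>R D)"
          by (simp add: scaleR_diff_right)
        then show "norm (f (x + \<epsilon> *\<^sub>R v s) - f x - \<epsilon> *\<^sub>R D) / norm \<epsilon> =
            norm (inverse \<epsilon> *\<^sub>R (f (x + \<epsilon> *\<^sub>R v s) - f x) - D)"
          by (simp add: divide_inverse mult.commute)
      qed
    qed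
  qed
  then show ?thesis
    unfolding partial_def by (intro tendsto_Lim) auto
qed

section \<open>Extension from M to the ambient space; uniqueness of the unit normal\<close>

context orthonormal_frame begin

abbreviation "M \<equiv> span (v ` {..m})"

lemma v_in_M [simp]: "s \<le> m \<Longrightarrow> v s \<in> M"
  by (simp add: span_base)

definition proj :: "'a \<Rightarrow> 'a" where
  "proj y = (\<Sum>s\<le>m. (y \<bullet> v s) *\<^sub>R v s)"

lemma linear_proj: "linear proj"
  by (rule linearI) (simp_all add: proj_def inner_add_left algebra_simps sum.distrib scaleR_sum_right)

lemma continuous_proj: "continuous_on A proj"
  using linear_proj linear_continuous_on linear_conv_bounded_linear by blast

lemma proj_in_M [simp]: "proj y \<in> M"
  unfolding proj_def by (intro span_sum span_scale v_in_M) auto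

lemma proj_v [simp]: "s \<le> m \<Longrightarrow> proj (v s) = v s"
  by (simp add: proj_def inner_v if_distrib[of "\<lambda>c. c *\<^sub>R _"] sum.delta cong: if_cong)

lemma proj_eq [simp]: "y \<in> M \<Longrightarrow> proj y = y"
proof (induction rule: span_induct_alt)
  case base
  show ?case by (simp add: proj_def)
next
  case (step c b y)
  then obtain s where "b = v s" "s \<le> m" by auto
  then show ?case using step by (simp add: linear_add[OF linear_proj] linear_cmul[OF linear_proj])
qed

lemma expand_M: "y \<in> M \<Longrightarrow> y = (\<Sum>s\<le>m. (y \<bullet> v s) *\<^sub>R v s)"
  using proj_eq unfolding proj_def by simp

text \<open>A partial derivative in a frame direction sees only a short segment inside
  \<open>M\<close>, so agreement with g on a relatively open set is enough.\<close>

lemma C1_line_partial: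
  assumes g: "C1 g g'" and x: "x \<in> M" and T: "openin (top_of_set M) T" "x \<in> T" and s: "s \<le> m"
    and eq: "\<And>y. y \<in> T \<Longrightarrow> f y = g y"
  shows "partial v s f x = g' x (v s)"
proof (rule partial_eqI)
  obtain U where U: "open U" "T = M \<inter> U"
    using T(1) by (metis openin_open)
  have "((\<lambda>t. g (x + t *\<^sub>R v s)) has_vector_derivative g' x (v s)) (at 0)"
    using C1_line[OF g, of x "v s" 0] by simp
  then show "((\<lambda>t. f (x + t *\<^sub>R v s)) has_vector_derivative g' x (v s)) (at 0)"
  proof (rule has_vector_derivative_transform_within_open)
    show "open ((\<lambda>t. x + t *\<^sub>R v s) -` U)"
      by (intro open_vimage U continuous_intros)
    show "0 \<in> (\<lambda>t. x + t *\<^sub>R v s) -` U" using U T by auto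
    show "g (x + t *\<^sub>R v s) = f (x + t *\<^sub>R v s)" if "t \<in> (\<lambda>t. x + t *\<^sub>R v s) -` U" for t
      using that eq[of "x + t *\<^sub>R v s"] x s U by (simp add: span_add span_scale)
  qed
qed

text \<open>Since \<open>proj\<close> takes values in \<open>M\<close>, the chain rule turns a
  derivative within \<open>M\<close> into a full derivative of the composition.\<close>

lemma C1_on_proj:
  assumes f: "\<And>y. y \<in> U \<Longrightarrow> (f has_derivative f' y) (at y within M)"
    and f': "\<And>h. h \<in> M \<Longrightarrow> continuous_on U (\<lambda>y. f' y h)"
  shows "proj y \<in> U \<Longrightarrow> ((\<lambda>y. f (proj y)) has_derivative (\<lambda>h. f' (proj y) (proj h))) (at y)"
    and "continuous_on (proj -` U) (\<lambda>y. f' (proj y) (proj h))"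
proof -
  assume "proj y \<in> U"
  have "(f has_derivative f' (proj y)) (at (proj y) within range proj)"
    by (rule has_derivative_subset[OF f[OF \<open>proj y \<in> U\<close>]]) auto
  moreover have "(proj has_derivative proj) (at y)"
    using linear_proj by (simp add: bounded_linear_imp_has_derivative linear_conv_bounded_linear)
  ultimately show "((\<lambda>y. f (proj y)) has_derivative (\<lambda>h. f' (proj y) (proj h))) (at y)"
    by (rule has_derivative_in_compose[rotated])
next
  show "continuous_on (proj -` U) (\<lambda>y. f' (proj y) (proj h))"
    by (rule continuous_on_compose2[OF f' continuous_proj]) auto
qed

text \<open>The counterpart of \<open>graph_chart\<close> whose function is C^1 and invariant along
  \<open>v i\<close> on the whole space, with its derivative as a parameter. This is the form that
  the shear and the local divergence theorem take as input.\<close>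

definition chart :: "'a set \<Rightarrow> 'a set \<Rightarrow> nat \<Rightarrow> real \<Rightarrow> ('a \<Rightarrow> real) \<Rightarrow> ('a \<Rightarrow> 'a \<Rightarrow> real) \<Rightarrow> bool" where
  "chart G W i sg \<gamma> \<gamma>' \<longleftrightarrow>
     openin (top_of_set M) W \<and> i \<le> m \<and> sg \<in> {1, -1} \<and> C1 \<gamma> \<gamma>' \<and>
     (\<forall>y t. \<gamma> (y + t *\<^sub>R v i) = \<gamma> y) \<and> G \<inter> W = {y\<in>W. sg * (y \<bullet> v i) < sg * \<gamma> y}"

lemma chart_mem_iff:
  assumes "chart G W i sg \<gamma> \<gamma>'" "y \<in> W"
  shows "y \<in> G \<longleftrightarrow> sg * (y \<bullet> v i) < sg * \<gamma> y"
proof -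
  have "G \<inter> W = {y\<in>W. sg * (y \<bullet> v i) < sg * \<gamma> y}" using assms(1) unfolding chart_def by blast
  then show ?thesis using assms(2) by blast
qed

definition area :: "('a \<Rightarrow> 'a \<Rightarrow> real) \<Rightarrow> 'a \<Rightarrow> real" where
  "area \<gamma>' y = sqrt (1 + (\<Sum>s\<le>m. (\<gamma>' y (v s))\<^sup>2))"

text \<open>The gradient within \<open>M\<close> of sg (y . v i - \<gamma> y). This function is
  negative exactly on the part of \<open>G\<close> in the chart, so the vector points out of
  \<open>G\<close>.\<close>

definition conormal :: "nat \<Rightarrow> real \<Rightarrow> ('a \<Rightarrow> 'a \<Rightarrow> real) \<Rightarrow> 'a \<Rightarrow> 'a" where
  "conormal i sg \<gamma>' y = sg *\<^sub>R (v i - (\<Sum>s\<le>m. \<gamma>' y (v s) *\<^sub>R v s))"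

definition chart_normal :: "nat \<Rightarrow> real \<Rightarrow> ('a \<Rightarrow> 'a \<Rightarrow> real) \<Rightarrow> 'a \<Rightarrow> 'a" where
  "chart_normal i sg \<gamma>' y = (1 / area \<gamma>' y) *\<^sub>R conormal i sg \<gamma>' y"

lemma graph_chart_extends:
  assumes "graph_chart M v m G W i sg \<gamma>"
  obtains \<gamma>' where "chart G W i sg (\<lambda>y. \<gamma> (proj y)) \<gamma>'"
    "\<And>y. y \<in> M \<Longrightarrow> area_factor v m \<gamma> y = area \<gamma>' y"
    "\<And>y. y \<in> M \<Longrightarrow> (sg / area_factor v m \<gamma> y) *\<^sub>R (v i - (\<Sum>s\<le>m. partial v s \<gamma> y *\<^sub>R v s)) =
       chart_normal i sg \<gamma>' y"
proof -
  have i: "i \<le> m" using assms by (simp add: graph_chart_def)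
  have W: "W \<subseteq> M" using assms openin_imp_subset by (auto simp: graph_chart_def)
  obtain f' where f': "\<And>y. y \<in> M \<Longrightarrow> (\<gamma> has_derivative f' y) (at y within M)"
      "\<And>h. h \<in> M \<Longrightarrow> continuous_on M (\<lambda>y. f' y h)"
    using assms unfolding graph_chart_def C1_on_def by blast
  define \<gamma>' where "\<gamma>' y h = f' (proj y) (proj h)" for y h
  have C: "C1 (\<lambda>y. \<gamma> (proj y)) \<gamma>'"
  proof -
    have "\<gamma>' = (\<lambda>y h. f' (proj y) (proj h))" by (simp add: \<gamma>'_def fun_eq_iff)
    then show ?thesis
      using C1_on_proj(1)[OF f'] C1_on_proj(2)[OF f'] by (auto simp: C1_def vimage_def)
  qed
  have inv: "\<gamma> (proj (y + t *\<^sub>R v i)) = \<gamma> (proj y)" for y t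
    using assms i by (simp add: linear_add[OF linear_proj] linear_cmul[OF linear_proj] graph_chart_def)
  have eq: "{y \<in> W. sg * (y \<bullet> v i) < sg * \<gamma> y} = {y \<in> W. sg * (y \<bullet> v i) < sg * \<gamma> (proj y)}"
    using W by (intro Collect_cong) (auto simp: subset_iff)
  have chart: "chart G W i sg (\<lambda>y. \<gamma> (proj y)) \<gamma>'"
    using assms C inv eq unfolding chart_def graph_chart_def by simp
  have "partial v s \<gamma> y = \<gamma>' y (v s)" if "y \<in> M" "s \<le> m" for y s
    by (rule C1_line_partial[OF C, of _ M]) (use that in auto)
  then have "area_factor v m \<gamma> y = area \<gamma>' y"
    "(sg / area_factor v m \<gamma> y) *\<^sub>R (v i - (\<Sum>s\<le>m. partial v s \<gamma> y *\<^sub>R v s)) = chart_normal i sg \<gamma>' y"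
    if "y \<in> M" for y
    using that by (simp_all add: area_factor_def area_def chart_normal_def conormal_def)
  with chart show ?thesis using that by blast
qed

lemma area_ge_1: "area \<gamma>' y \<ge> 1"
  by (simp add: area_def sum_nonneg)

lemma area_pos [simp]: "area \<gamma>' y > 0"
  using area_ge_1[of \<gamma>' y] by linarith

lemma area_simps [simp]: "area \<gamma>' y \<noteq> 0" "\<not> area \<gamma>' y < 0" "0 \<le> area \<gamma>' y" "\<bar>area \<gamma>' y\<bar> = area \<gamma>' y"
  using area_pos[of \<gamma>' y] by linarith+

lemma continuous_area: "C1 \<gamma> \<gamma>' \<Longrightarrow> continuous_on A (area \<gamma>')"
  unfolding area_def by (intro continuous_intros C1_deriv_continuous)

lemma continuous_chart_normal: "C1 \<gamma> \<gamma>' \<Longrightarrow> continuous_on A (chart_normal i sg \<gamma>')"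
  unfolding chart_normal_def conormal_def
  by (intro continuous_intros C1_deriv_continuous continuous_area ballI)
    (use area_pos in \<open>auto simp: less_imp_neq[THEN not_sym]\<close>)

lemma inner_conormal:
  assumes "chart G W i sg \<gamma> \<gamma>'" "h \<in> M"
  shows "conormal i sg \<gamma>' y \<bullet> h = sg * (h \<bullet> v i - \<gamma>' y h)"
proof -
  have lin: "linear (\<gamma>' y)" using assms(1) C1_deriv_linear by (auto simp: chart_def)
  have "\<gamma>' y h = (\<Sum>s\<le>m. (h \<bullet> v s) * \<gamma>' y (v s))"
    by (subst expand_M[OF assms(2)]) (simp add: linear_sum[OF lin] linear_cmul[OF lin])
  then show ?thesis
    by (simp add: conormal_def inner_diff_left inner_sum_left inner_commute[of "v _" h] mult.commute)
qed

text \<open>Invariance gives \<gamma>'(v i) = 0, so \<open>v i\<close> is orthogonal to the gradient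
  of \<gamma> and Pythagoras applies. Thus the area factor is the length of the conormal, and the
  two cancel in surface integrals.\<close>

lemma norm_conormal:
  assumes "chart G W i sg \<gamma> \<gamma>'"
  shows "norm (conormal i sg \<gamma>' y) = area \<gamma>' y"
proof -
  have \<gamma>: "C1 \<gamma> \<gamma>'" "\<And>y t. \<gamma> (y + t *\<^sub>R v i) = \<gamma> y" and i: "i \<le> m" and sg: "sg * sg = 1"
    using assms by (auto simp: chart_def)
  note lin = C1_deriv_linear[OF \<gamma>(1), of y] and inv = C1_deriv_invariant(2)[OF \<gamma>, of y]
  define \<Sigma> where "\<Sigma> = (\<Sum>s\<le>m. (\<gamma>' y (v s))\<^sup>2)"
  define N where "N = conormal i sg \<gamma>' y"
  have M: "N \<in> M"
    unfolding N_def conormal_def by (intro span_scale span_diff span_sum v_in_M i) auto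
  have N1: "\<gamma>' y N = - sg * \<Sigma>"
    unfolding \<Sigma>_def N_def
    by (simp add: conormal_def linear_cmul[OF lin] linear_diff[OF lin] linear_sum[OF lin] inv power2_eq_square)
  have N2: "N \<bullet> v i = sg"
    unfolding N_def using inner_conormal[OF assms, of "v i"] i by (simp add: inv inner_v)
  have "N \<bullet> N = sg * (sg - - sg * \<Sigma>)"
    using inner_conormal[OF assms M, of y] unfolding N1 N2 N_def[symmetric] .
  also have "\<dots> = (sg * sg) * (1 + \<Sigma>)" by (simp add: algebra_simps)
  finally show ?thesis by (simp add: norm_eq_sqrt_inner area_def \<Sigma>_def sg flip: N_def)
qed

lemma openin_M_line:
  assumes "openin (top_of_set M) T" "y \<in> T" "h \<in> M"
  obtains d where "d > 0" "\<And>t. \<bar>t\<bar> < d \<Longrightarrow> y + t *\<^sub>R h \<in> T"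
proof -
  obtain U where U: "open U" "T = M \<inter> U" using assms(1) by (metis openin_open)
  have "open ((\<lambda>t. y + t *\<^sub>R h) -` U)" "0 \<in> (\<lambda>t. y + t *\<^sub>R h) -` U"
    using U assms by (auto intro!: open_vimage continuous_intros)
  then obtain d where "d > 0" "ball 0 d \<subseteq> (\<lambda>t. y + t *\<^sub>R h) -` U"
    using open_contains_ball by blast
  with U assms show ?thesis
    by (intro that[of d]) (auto simp: span_add span_scale subset_iff)
qed

lemma bd_iff:
  assumes G: "openin (top_of_set M) G"
  shows "y \<in> bd M G \<longleftrightarrow> y \<in> top_of_set M closure_of G \<and> y \<notin> G"
  using G by (simp add: frontier_of_def interior_of_openin)

lemma bd_in_M: "y \<in> bd M G \<Longrightarrow> y \<in> M"
  using frontier_of_subset_topspace by fastforce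

text \<open>The points strictly beyond the graph form a relatively open set that misses
  \<open>G\<close>, and every point of the graph is a limit of points of \<open>G\<close> along
  \<open>v i\<close>.\<close>

lemma bd_chart_iff:
  assumes G: "openin (top_of_set M) G" and ch: "chart G W i sg \<gamma> \<gamma>'" and y: "y \<in> W"
  shows "y \<in> bd M G \<longleftrightarrow> y \<bullet> v i = \<gamma> y"
proof -
  have W: "openin (top_of_set M) W" and i: "i \<le> m" and sg: "sg \<in> {1,-1}"
    and inv: "\<And>y t. \<gamma> (y + t *\<^sub>R v i) = \<gamma> y"
    and \<gamma>: "C1 \<gamma> \<gamma>'"
    using ch by (auto simp: chart_def)
  have yM: "y \<in> M" using W y openin_imp_subset by blast
  have sg1: "sg * sg = 1" using sg by auto
  show ?thesis
  proof
    assume "y \<in> bd M G"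
    then have cl: "y \<in> top_of_set M closure_of G" and "y \<notin> G" using bd_iff[OF G] by blast+
    then have "sg * (y \<bullet> v i) \<ge> sg * \<gamma> y" using chart_mem_iff[OF ch y] by linarith
    moreover have "\<not> sg * (y \<bullet> v i) > sg * \<gamma> y"
    proof
      assume *: "sg * (y \<bullet> v i) > sg * \<gamma> y"
      have "open {z. sg * (z \<bullet> v i) > sg * \<gamma> z}"
        by (intro open_Collect_less continuous_intros C1_continuous[OF \<gamma>])
      then have "openin (top_of_set M) (W \<inter> {z. sg * (z \<bullet> v i) > sg * \<gamma> z})"
        using W openin_Int_open by blast
      moreover have "y \<in> W \<inter> {z. sg * (z \<bullet> v i) > sg * \<gamma> z}" using * y by simp
      ultimately have "\<exists>z. z \<in> G \<and> z \<in> W \<inter> {z. sg * (z \<bullet> v i) > sg * \<gamma> z}"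
        using cl by (metis (no_types, lifting) in_closure_of)
      then obtain z where "z \<in> G" "z \<in> W" "sg * (z \<bullet> v i) > sg * \<gamma> z" by blast
      with chart_mem_iff[OF ch, of z] show False by linarith
    qed
    ultimately have "sg * (y \<bullet> v i) = sg * \<gamma> y" by linarith
    then show "y \<bullet> v i = \<gamma> y" using sg by auto
  next
    assume eq: "y \<bullet> v i = \<gamma> y"
    have "y \<notin> G" using chart_mem_iff[OF ch y] eq by simp
    moreover have "y \<in> top_of_set M closure_of G"
      unfolding in_closure_of
    proof (intro conjI allI impI)
      fix T assume T: "y \<in> T \<and> openin (top_of_set M) T"
      then have "openin (top_of_set M) (T \<inter> W)" "y \<in> T \<inter> W" using W y by auto
      then obtain d where d: "d > 0" "\<And>t. \<bar>t\<bar> < d \<Longrightarrow> y + t *\<^sub>R v i \<in> T \<inter> W"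
        by (rule openin_M_line[OF _ _ v_in_M[OF i]]) blast
      \<comment> \<open>The sign -sg moves off the graph into \<open>G\<close>, and d / 2 keeps the
        point within both neighborhoods.\<close>
      define z where "z = y + (- sg * d / 2) *\<^sub>R v i"
      have z: "z \<in> T \<inter> W" unfolding z_def by (intro d(2)) (use d sg in auto)
      have "sg * (z \<bullet> v i) < sg * \<gamma> z"
        unfolding z_def inv using i d(1) sg1
        by (simp add: inner_add_left inner_v eq algebra_simps)
      then show "\<exists>y. y \<in> G \<and> y \<in> T" using z chart_mem_iff[OF ch, of z] by blast
    qed (use yM in simp)
    ultimately show "y \<in> bd M G" using bd_iff[OF G] by blast
  qed
qed

lemma chart_rho_deriv:
  assumes ch: "chart G W i sg \<gamma> \<gamma>'" and h: "h \<in> M"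
  shows "((\<lambda>t. sg * ((p + t *\<^sub>R h) \<bullet> v i) - sg * \<gamma> (p + t *\<^sub>R h)) has_real_derivative
      conormal i sg \<gamma>' p \<bullet> h) (at 0)"
proof -
  have "((\<lambda>t. \<gamma> (p + t *\<^sub>R h)) has_real_derivative \<gamma>' p h) (at 0)"
    using C1_line[of \<gamma> \<gamma>' p h 0] ch
    by (simp add: chart_def has_real_derivative_iff_has_vector_derivative)
  then show ?thesis
    unfolding inner_conormal[OF ch h] inner_add_left inner_scaleR_left
    by (auto intro!: derivative_eq_intros simp: algebra_simps)
qed

text \<open>A direction that enters \<open>G\<close> according to one chart cannot leave it
  according to another: a short segment from p would lie both in \<open>G\<close> and outside
  it.\<close>

lemma conormal_halfspace:
  assumes G: "openin (top_of_set M) G"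
    and c1: "chart G W1 i1 sg1 \<gamma>1 \<gamma>1'" and c2: "chart G W2 i2 sg2 \<gamma>2 \<gamma>2'"
    and p: "p \<in> W1" "p \<in> W2" "p \<in> bd M G"
    and h: "h \<in> M" and neg: "conormal i1 sg1 \<gamma>1' p \<bullet> h < 0"
  shows "conormal i2 sg2 \<gamma>2' p \<bullet> h \<le> 0"
proof (rule ccontr)
  assume "\<not> ?thesis"
  then have pos: "conormal i2 sg2 \<gamma>2' p \<bullet> h > 0" by simp
  have eq: "p \<bullet> v i1 = \<gamma>1 p" "p \<bullet> v i2 = \<gamma>2 p"
    using bd_chart_iff[OF G c1] bd_chart_iff[OF G c2] p by auto
  obtain d1 where d1: "d1 > 0" "\<And>t. 0 < t \<Longrightarrow> t < d1 \<Longrightarrow>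
      sg1 * ((p + t *\<^sub>R h) \<bullet> v i1) - sg1 * \<gamma>1 (p + t *\<^sub>R h) < 0"
    using DERIV_neg_dec_right[OF chart_rho_deriv[OF c1 h] neg] eq by auto
  obtain d2 where d2: "d2 > 0" "\<And>t. 0 < t \<Longrightarrow> t < d2 \<Longrightarrow>
      sg2 * ((p + t *\<^sub>R h) \<bullet> v i2) - sg2 * \<gamma>2 (p + t *\<^sub>R h) > 0"
    using DERIV_pos_inc_right[OF chart_rho_deriv[OF c2 h] pos] eq by auto
  have "openin (top_of_set M) (W1 \<inter> W2)" using c1 c2 by (auto simp: chart_def)
  then obtain d where d: "d > 0" "\<And>t. \<bar>t\<bar> < d \<Longrightarrow> p + t *\<^sub>R h \<in> W1 \<inter> W2"
    using openin_M_line[of "W1 \<inter> W2" p h] p h by auto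
  define t where "t = min d (min d1 d2) / 2"
  have t: "0 < t" "t < d1" "t < d2" "\<bar>t\<bar> < d" using d d1 d2 by (auto simp: t_def)
  define z where "z = p + t *\<^sub>R h"
  have z: "z \<in> W1" "z \<in> W2" "sg1 * (z \<bullet> v i1) < sg1 * \<gamma>1 z" "sg2 * (z \<bullet> v i2) > sg2 * \<gamma>2 z"
    using d(2)[OF t(4)] d1(2)[OF t(1,2)] d2(2)[OF t(1,3)] by (auto simp: z_def)
  then show False using chart_mem_iff[OF c1, of z] chart_mem_iff[OF c2, of z] by linarith
qed

lemma norm_chart_normal: "chart G W i sg \<gamma> \<gamma>' \<Longrightarrow> norm (chart_normal i sg \<gamma>' y) = 1"
  using area_pos[of \<gamma>' y] by (simp add: chart_normal_def norm_conormal)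

lemma chart_normal_in_M: "chart G W i sg \<gamma> \<gamma>' \<Longrightarrow> chart_normal i sg \<gamma>' y \<in> M"
  unfolding conormal_def chart_normal_def chart_def
  by (intro span_scale span_diff span_sum v_in_M) auto

text \<open>If the unit vectors n1 and n2 differed, then h = n2 - n1 would satisfy n1 . h < 0 and n2
  . h > 0, against the half-space lemma. This makes the description in \<open>outward_normal\<close>
  well defined, without comparing the two graph functions.\<close>

lemma chart_normal_unique:
  assumes G: "openin (top_of_set M) G"
    and c1: "chart G W1 i1 sg1 \<gamma>1 \<gamma>1'" and c2: "chart G W2 i2 sg2 \<gamma>2 \<gamma>2'"
    and p: "p \<in> W1" "p \<in> W2" "p \<in> bd M G"
  shows "chart_normal i1 sg1 \<gamma>1' p = chart_normal i2 sg2 \<gamma>2' p"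
proof (rule ccontr)
  let ?n1 = "chart_normal i1 sg1 \<gamma>1' p" and ?n2 = "chart_normal i2 sg2 \<gamma>2' p"
  assume "?n1 \<noteq> ?n2"
  have n: "?n1 \<bullet> ?n1 = 1" "?n2 \<bullet> ?n2 = 1"
    using norm_chart_normal[OF c1, of p] norm_chart_normal[OF c2, of p] by (simp_all add: norm_eq_1)
  have "(?n2 - ?n1) \<bullet> (?n2 - ?n1) > 0" using \<open>?n1 \<noteq> ?n2\<close> by simp
  then have lt: "?n1 \<bullet> ?n2 < 1"
    using n by (simp add: inner_diff_left inner_diff_right inner_commute)
  have M: "?n2 - ?n1 \<in> M" using chart_normal_in_M c1 c2 by (auto intro: span_diff)
  have "?n1 \<bullet> (?n2 - ?n1) < 0" using lt n by (simp add: inner_diff_right)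
  then have "conormal i1 sg1 \<gamma>1' p \<bullet> (?n2 - ?n1) < 0"
    by (subst (asm) (1) chart_normal_def) (simp add: divide_less_0_iff)
  from conormal_halfspace[OF G c1 c2 p M this]
  have "?n2 \<bullet> (?n2 - ?n1) \<le> 0"
    by (subst (1) chart_normal_def) (simp add: divide_le_0_iff)
  then show False using lt n by (simp add: inner_diff_right inner_commute)
qed

lemma outward_normal_eq:
  assumes G: "openin (top_of_set M) G" and gc: "graph_chart M v m G W i sg \<gamma>"
    and ch: "chart G W i sg \<gamma>1 \<gamma>'" and p: "p \<in> W" "p \<in> bd M G"
  shows "outward_normal M v m G p = chart_normal i sg \<gamma>' p"
proof -
  have pM: "p \<in> M" using bd_in_M p by blast
  have all: "n = chart_normal i sg \<gamma>' p"
    if "graph_chart M v m G W2 i2 sg2 \<gamma>2 \<and> p \<in> W2 \<inter> bd M G \<and>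
        n = (sg2 / area_factor v m \<gamma>2 p) *\<^sub>R (v i2 - (\<Sum>s\<le>m. partial v s \<gamma>2 p *\<^sub>R v s))" for n W2 i2 sg2 \<gamma>2
  proof -
    from that have "graph_chart M v m G W2 i2 sg2 \<gamma>2" ..
    then show ?thesis
    proof (rule graph_chart_extends)
      fix \<gamma>2'
      assume "chart G W2 i2 sg2 (\<lambda>y. \<gamma>2 (proj y)) \<gamma>2'"
        and *: "\<And>y. y \<in> M \<Longrightarrow> (sg2 / area_factor v m \<gamma>2 y) *\<^sub>R
            (v i2 - (\<Sum>s\<le>m. partial v s \<gamma>2 y *\<^sub>R v s)) = chart_normal i2 sg2 \<gamma>2' y"
      with chart_normal_unique[OF G this(1) ch, of p] that p *[OF pM] show ?thesis by auto
    qed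
  qed
  define n where "n = (sg / area_factor v m \<gamma> p) *\<^sub>R (v i - (\<Sum>s\<le>m. partial v s \<gamma> p *\<^sub>R v s))"
  have *: "graph_chart M v m G W i sg \<gamma> \<and> p \<in> W \<inter> bd M G \<and>
     n = (sg / area_factor v m \<gamma> p) *\<^sub>R (v i - (\<Sum>s\<le>m. partial v s \<gamma> p *\<^sub>R v s))"
    using gc p by (simp add: n_def)
  show ?thesis
    unfolding outward_normal_def
  proof (rule the_equality)
    show "\<exists>W j sg' \<gamma>. graph_chart M v m G W j sg' \<gamma> \<and> p \<in> W \<inter> bd M G \<and>
        chart_normal i sg \<gamma>' p = (sg' / area_factor v m \<gamma> p) *\<^sub>R (v j - (\<Sum>s\<le>m. partial v s \<gamma> p *\<^sub>R v s))"
      by (intro exI) (rule *[unfolded all[OF *]])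
    show "n = chart_normal i sg \<gamma>' p"
      if "\<exists>W i sg \<gamma>. graph_chart M v m G W i sg \<gamma> \<and> p \<in> W \<inter> bd M G \<and>
        n = (sg / area_factor v m \<gamma> p) *\<^sub>R (v i - (\<Sum>s\<le>m. partial v s \<gamma> p *\<^sub>R v s))" for n
      using that all by blast
  qed
qed

end

section \<open>The surface measure\<close>

definition test_function :: "('a::euclidean_space \<Rightarrow> real) \<Rightarrow> bool" where
  "test_function f \<longleftrightarrow> (\<exists>f'. C1 f f') \<and> bounded_support f \<and> (\<forall>y. 0 \<le> f y \<and> f y \<le> 1)"

lemma C1_norm_sq: "\<exists>f'. C1 (\<lambda>y. (norm (y - p))\<^sup>2 :: real) f'" for p :: "'a::euclidean_space"
proof -
  have "C1 (\<lambda>y. y - p) (\<lambda>y h. h - 0)"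
    by (intro C1_diff C1_const C1_linear) (rule linear_id[unfolded id_def])
  from C1_inner[OF this this] show ?thesis by (auto simp: power2_norm_eq_inner)
qed

text \<open>Only C^1 regularity is ever required, so the squared positive part is the building block
  of every bump, plateau and cutoff here.\<close>

lemma has_real_derivative_pos_part_sq:
  "((\<lambda>t. (max 0 t)\<^sup>2) has_real_derivative 2 * max 0 t) (at t)" for t :: real
proof -
  consider "t > 0" | "t < 0" | "t = 0" by linarith
  then show ?thesis
  proof cases
    case 1
    have "((\<lambda>t. t\<^sup>2) has_real_derivative 2 * max 0 t) (at t)"
      using 1 by (auto intro!: derivative_eq_intros)
    then show ?thesis
      by (rule has_field_derivative_transform_within_open[of _ _ _ "{0<..}"]) (use 1 in auto)
  next
    case 2
    have "((\<lambda>t. 0) has_real_derivative 2 * max 0 t) (at t)"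
      using 2 by (auto intro!: derivative_eq_intros)
    then show ?thesis
      by (rule has_field_derivative_transform_within_open[of _ _ _ "{..<0}"]) (use 2 in auto)
  next
    case 3
    have "((\<lambda>h. (max 0 h)\<^sup>2 / h) \<longlongrightarrow> 0) (at (0::real))"
    proof (rule Lim_null_comparison[where g = "\<lambda>h. \<bar>h\<bar>"])
      show "\<forall>\<^sub>F h in at 0. norm ((max 0 h)\<^sup>2 / h) \<le> \<bar>h\<bar>"
        by (rule always_eventually) (auto simp: max_def power2_eq_square)
    qed (auto intro: tendsto_eq_intros)
    then show ?thesis using 3 by (simp add: DERIV_def)
  qed
qed

lemma C1_pos_part_sq:
  fixes u :: "'a::euclidean_space \<Rightarrow> real"
  assumes "\<exists>u'. C1 u u'"
  shows "\<exists>f'. C1 (\<lambda>y. (max 0 (u y))\<^sup>2) f'"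
proof -
  obtain u' where "C1 u u'" using assms by blast
  moreover have "continuous_on UNIV (\<lambda>t::real. 2 * max 0 t)" by (intro continuous_intros)
  ultimately show ?thesis
    using C1_compose_real[OF _ has_real_derivative_pos_part_sq] by blast
qed

lemma C1_affine_real:
  fixes u :: "'a::euclidean_space \<Rightarrow> real"
  assumes "\<exists>u'. C1 u u'"
  shows "\<exists>f'. C1 (\<lambda>y. a + b * u y) f'"
proof -
  obtain u' where "C1 u u'" using assms by blast
  from C1_add[OF C1_const C1_mult[OF C1_const this]] show ?thesis by blast
qed

lemma bump:
  fixes p :: "'a::euclidean_space"
  assumes "r > 0"
  obtains f where "test_function f" "\<And>y. f y \<noteq> 0 \<longleftrightarrow> y \<in> ball p r"
proof -
  define f where "f y = (max 0 (1 - (norm (y - p))\<^sup>2 / r\<^sup>2))\<^sup>2" for y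
  have "\<exists>f'. C1 f f'"
    using C1_pos_part_sq[OF C1_affine_real[OF C1_norm_sq[of p], of 1 "- inverse (r\<^sup>2)"]]
    by (simp add: f_def[abs_def] divide_inverse mult.commute)
  moreover have "0 \<le> f y \<and> f y \<le> 1" for y
    by (auto simp: f_def intro!: power_le_one)
  moreover have f: "f y \<noteq> 0 \<longleftrightarrow> y \<in> ball p r" for y
  proof -
    have "f y \<noteq> 0 \<longleftrightarrow> (norm (y - p))\<^sup>2 < r\<^sup>2"
    proof -
      have "1 - (norm (y - p))\<^sup>2 / r\<^sup>2 > 0 \<longleftrightarrow> (norm (y - p))\<^sup>2 < r\<^sup>2"
        using assms by (simp add: divide_less_eq_1 del: power_mono_iff)
      then show ?thesis by (auto simp: f_def max_def)
    qed
    also have "\<dots> \<longleftrightarrow> norm (y - p) < r"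
    proof
      show "norm (y - p) < r" if "(norm (y - p))\<^sup>2 < r\<^sup>2"
        by (rule power2_less_imp_less[OF that]) (use assms in simp)
      show "(norm (y - p))\<^sup>2 < r\<^sup>2" if "norm (y - p) < r"
        by (rule power_strict_mono[OF that]) auto
    qed
    finally show ?thesis by (simp add: dist_norm norm_minus_commute)
  qed
  moreover have "bounded_support f"
    unfolding bounded_support_def
  proof (intro exI allI impI)
    fix y :: 'a assume "norm y > norm p + r"
    then have "y \<notin> ball p r"
      using norm_triangle_ineq2[of y p] by (auto simp: dist_norm norm_minus_commute)
    then show "f y = 0" using f by blast
  qed
  ultimately show ?thesis using that by (auto simp: test_function_def)
qed

lemma test_function_measurable: "test_function f \<Longrightarrow> f \<in> borel_measurable borel"
  using C1_measurable by (auto simp: test_function_def)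

text \<open>The Lindelof property selects countably many balls that fill \<open>U\<close>. The bump
  of a ball is nonzero exactly on it, so no point of \<open>U\<close> is lost.\<close>

lemma open_as_countable_bumps:
  fixes U :: "'a::euclidean_space set"
  assumes "open U" "U \<noteq> {}"
  obtains \<psi> :: "nat \<Rightarrow> 'a \<Rightarrow> real" where "\<And>n. test_function (\<psi> n)"
    "\<And>y. y \<in> U \<longleftrightarrow> (\<exists>n. \<psi> n y \<noteq> 0)"
proof -
  define \<F> where "\<F> = {ball p r | p r. r > 0 \<and> ball p r \<subseteq> U}"
  have un: "\<Union>\<F> = U"
  proof
    show "\<Union>\<F> \<subseteq> U" by (auto simp: \<F>_def)
    show "U \<subseteq> \<Union>\<F>"
    proof
      fix y assume "y \<in> U"
      then obtain e where "e > 0" "ball y e \<subseteq> U"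
        using assms(1) open_contains_ball by blast
      then have "ball y e \<in> \<F>" "y \<in> ball y e" unfolding \<F>_def by auto
      then show "y \<in> \<Union>\<F>" by blast
    qed
  qed
  obtain \<F>' where F: "\<F>' \<subseteq> \<F>" "countable \<F>'" "\<Union>\<F>' = \<Union>\<F>"
    using Lindelof[of \<F>] by (auto simp: \<F>_def)
  then have ne: "\<F>' \<noteq> {}" using un assms(2) by auto
  have "\<exists>f. test_function f \<and> (\<forall>y. f y \<noteq> 0 \<longleftrightarrow> y \<in> B)" if "B \<in> \<F>'" for B
  proof -
    have "B \<in> \<F>" using that F by blast
    then obtain p r where "B = ball p r" "r > 0" by (auto simp: \<F>_def)
    with bump[of r p] show ?thesis by metis
  qed
  then obtain g where g: "\<And>B. B \<in> \<F>' \<Longrightarrow> test_function (g B)"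
    "\<And>B y. B \<in> \<F>' \<Longrightarrow> g B y \<noteq> 0 \<longleftrightarrow> y \<in> B" by metis
  define \<psi> where "\<psi> n = g (from_nat_into \<F>' n)" for n
  have in_F: "from_nat_into \<F>' n \<in> \<F>'" for n using ne by (rule from_nat_into)
  have "y \<in> U \<longleftrightarrow> (\<exists>n. \<psi> n y \<noteq> 0)" for y
  proof -
    have "y \<in> U \<longleftrightarrow> (\<exists>B\<in>\<F>'. y \<in> B)" using un F by auto
    also have "\<dots> \<longleftrightarrow> (\<exists>B\<in>\<F>'. g B y \<noteq> 0)" using g by auto
    also have "\<dots> \<longleftrightarrow> (\<exists>n. \<psi> n y \<noteq> 0)"
      unfolding \<psi>_def using F(2) in_F by (metis from_nat_into_surj)
    finally show ?thesis .
  qed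
  then show ?thesis using that[of \<psi>] g(1) in_F by (auto simp: \<psi>_def)
qed

lemma prod_antimono_set:
  fixes f :: "'i \<Rightarrow> real"
  assumes "finite B" "A \<subseteq> B" "\<And>k. k \<in> B \<Longrightarrow> 0 \<le> f k \<and> f k \<le> 1"
  shows "prod f B \<le> prod f A"
proof -
  have "prod f B = prod f (B - A) * prod f A"
    by (rule prod.subset_diff) fact+
  also have "\<dots> \<le> 1 * prod f A"
    using assms by (intro mult_right_mono prod_le_1 prod_nonneg) auto
  finally show ?thesis by simp
qed

lemma open_as_limit_of_test_functions:
  fixes U :: "'a::euclidean_space set"
  assumes "open U"
  obtains f :: "nat \<Rightarrow> 'a \<Rightarrow> real" where "\<And>n. test_function (f n)" "\<And>n y. y \<notin> U \<Longrightarrow> f n y = 0"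
    "\<And>y. mono (\<lambda>n. f n y)" "\<And>y. (\<lambda>n. f n y) \<longlonglongrightarrow> indicator U y"
proof (cases "U = {}")
  case True
  have "test_function (\<lambda>_::'a. 0)"
    using C1_const by (auto simp: test_function_def bounded_support_def)
  then show ?thesis using that[of "\<lambda>_ _. 0"] True by (auto simp: mono_def)
next
  case False
  obtain \<psi> :: "nat \<Rightarrow> 'a \<Rightarrow> real" where \<psi>: "\<And>n. test_function (\<psi> n)"
    "\<And>y. y \<in> U \<longleftrightarrow> (\<exists>n. \<psi> n y \<noteq> 0)"
    using open_as_countable_bumps[OF assms False] by blast
  \<comment> \<open>The product decreases with n, since factors in [0,1] are added and the exponent
    grows. At a point where some \<psi> k is positive, the n-th power of that one factor already
    forces the product to 0; off \<open>U\<close> every factor is 1.\<close>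
  define f where "f n y = 1 - (\<Prod>k<n. (1 - \<psi> k y) ^ n)" for n y
  have b: "0 \<le> 1 - \<psi> k y" "1 - \<psi> k y \<le> 1" for k y
    using \<psi>(1)[of k] by (auto simp: test_function_def)
  have pr: "0 \<le> (\<Prod>k<n. (1 - \<psi> k y) ^ n)" "(\<Prod>k<n. (1 - \<psi> k y) ^ n) \<le> 1" for n y
    using b by (auto intro!: prod_nonneg prod_le_1 power_le_one)
  show ?thesis
  proof (rule that)
    show "f n y = 0" if "y \<notin> U" for n y
      using that \<psi>(2) by (auto simp: f_def)
    show "test_function (f n)" for n
      unfolding test_function_def
    proof (intro conjI allI)
      have "\<exists>g'. C1 (\<lambda>y. (1 - \<psi> k y) ^ n) g'" for k
      proof -
        obtain p' where "C1 (\<psi> k) p'" using \<psi>(1) by (auto simp: test_function_def)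
        from C1_diff[OF C1_const this] have "C1 (\<lambda>y. 1 - \<psi> k y) (\<lambda>y h. 0 - p' y h)" .
        then have "\<exists>g'. C1 (\<lambda>y. \<Prod>i<n. 1 - \<psi> k y) g'" by (intro C1_prod) auto
        then show ?thesis by simp
      qed
      then have "\<exists>g'. C1 (\<lambda>y. \<Prod>k<n. (1 - \<psi> k y) ^ n) g'" by (intro C1_prod) auto
      then obtain g' where "C1 (\<lambda>y. \<Prod>k<n. (1 - \<psi> k y) ^ n) g'" ..
      from C1_diff[OF C1_const this] show "\<exists>f'. C1 (f n) f'" unfolding f_def by blast
      show "0 \<le> f n y" "f n y \<le> 1" for y using pr[where n = n and y = y] by (auto simp: f_def)
      have "\<forall>k. \<exists>R. \<forall>y. norm y > R \<longrightarrow> \<psi> k y = 0"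
        using \<psi>(1) by (auto simp: test_function_def bounded_support_def)
      then obtain R where R: "\<And>k y. norm y > R k \<Longrightarrow> \<psi> k y = 0" by metis
      have "f n y = 0" if "norm y > (\<Sum>k<n. \<bar>R k\<bar>)" for y
      proof -
        have "\<psi> k y = 0" if "k < n" for k
        proof (rule R)
          have "\<bar>R k\<bar> \<le> (\<Sum>k<n. \<bar>R k\<bar>)" using that by (intro member_le_sum) auto
          then show "R k < norm y" using \<open>norm y > _\<close> by linarith
        qed
        then show ?thesis by (simp add: f_def)
      qed
      then show "bounded_support (f n)" unfolding bounded_support_def by blast
    qed
    show "mono (\<lambda>n. f n y)" for y
    proof (rule monoI)
      fix a c :: nat assume "a \<le> c"
      have "(\<Prod>k<c. (1 - \<psi> k y) ^ c) \<le> (\<Prod>k<a. (1 - \<psi> k y) ^ c)"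
        using \<open>a \<le> c\<close> b by (intro prod_antimono_set) (auto intro: power_le_one)
      also have "\<dots> \<le> (\<Prod>k<a. (1 - \<psi> k y) ^ a)"
        using \<open>a \<le> c\<close> b by (intro prod_mono conjI power_decreasing) auto
      finally show "f a y \<le> f c y" by (simp add: f_def)
    qed
    show "(\<lambda>n. f n y) \<longlonglongrightarrow> indicator U y" for y
    proof (cases "y \<in> U")
      case True
      then obtain k where k: "\<psi> k y \<noteq> 0" using \<psi>(2) by blast
      have "(\<lambda>n. \<Prod>k<n. (1 - \<psi> k y) ^ n) \<longlonglongrightarrow> 0"
      proof (rule Lim_null_comparison)
        show "\<forall>\<^sub>F n in sequentially. norm (\<Prod>k<n. (1 - \<psi> k y) ^ n) \<le> (1 - \<psi> k y) ^ n"
        proof (rule eventually_mono[OF eventually_gt_at_top[of k]])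
          fix n assume "k < n"
          have "(\<Prod>k<n. (1 - \<psi> k y) ^ n) \<le> (\<Prod>k\<in>{k}. (1 - \<psi> k y) ^ n)"
            using \<open>k < n\<close> b by (intro prod_antimono_set) (auto intro: power_le_one)
          then show "norm (\<Prod>k<n. (1 - \<psi> k y) ^ n) \<le> (1 - \<psi> k y) ^ n" using pr by simp
        qed
        have "1 - \<psi> k y < 1" using k \<psi>(1)[of k] by (auto simp: test_function_def less_le)
        then show "(\<lambda>n. (1 - \<psi> k y) ^ n) \<longlonglongrightarrow> 0" using b by (intro LIMSEQ_power_zero) auto
      qed
      from tendsto_diff[OF tendsto_const[of 1] this] show ?thesis using True by (simp add: f_def)
    next
      case False
      then have "f n y = 0" for n using \<psi>(2) by (auto simp: f_def)
      then show ?thesis using False by simp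
    qed
  qed
qed

lemma plateau:
  fixes p :: "'a::euclidean_space"
  assumes "r > 0"
  obtains f :: "'a \<Rightarrow> real" where "\<exists>f'. C1 f f'" "\<And>y. y \<in> ball p (r/2) \<Longrightarrow> f y = 1" "\<And>y. y \<notin> cball p r \<Longrightarrow> f y = 0"
proof -
  \<comment> \<open>The constants are chosen so that u = 1 at distance r/2 from p and u = 0 at
    distance r. The nested squares in f take the value 1 for u \<ge> 1 and 0 for u \<le> 0.\<close>
  define u where "u y = (4 * r\<^sup>2 - 4 * (norm (y - p))\<^sup>2) / (3 * r\<^sup>2)" for y
  define f where "f y = 1 - (max 0 (1 - (max 0 (u y))\<^sup>2))\<^sup>2" for y
  have "\<exists>u'. C1 u u'"
    using C1_affine_real[OF C1_norm_sq[of p], of "4 / 3" "- 4 / (3 * r\<^sup>2)"] assms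
    by (simp add: u_def[abs_def] diff_divide_distrib)
  from C1_affine_real[OF C1_pos_part_sq[OF C1_affine_real[OF C1_pos_part_sq[OF this],
        of 1 "-1"]], of 1 "-1"]
  have f1: "\<exists>f'. C1 f f'" by (simp add: f_def[abs_def])
  have f2: "f y = 1" if "y \<in> ball p (r/2)" for y
  proof -
    have "norm (y - p) < r/2" using that by (simp add: dist_norm norm_minus_commute)
    from power_strict_mono[OF this, of 2] have "(norm (y - p))\<^sup>2 < r\<^sup>2 / 4" by (simp add: power_divide)
    then have "u y \<ge> 1" using assms by (simp add: u_def)
    then have "(max 0 (u y))\<^sup>2 \<ge> 1" by (simp add: one_le_power)
    then show ?thesis by (simp add: f_def)
  qed
  have f3: "f y = 0" if "y \<notin> cball p r" for y
  proof -
    have r: "r < norm (y - p)" using that by (simp add: dist_norm norm_minus_commute)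
    from power_strict_mono[OF this, of 2] have "r\<^sup>2 < (norm (y - p))\<^sup>2" using assms by simp
    then have "u y \<le> 0" using assms r by (simp add: u_def divide_le_0_iff)
    then show ?thesis by (simp add: f_def)
  qed
  show ?thesis by (rule that[of f, OF f1 f2 f3])
qed

lemma sum_telescoping_partition:
  fixes \<psi> :: "nat \<Rightarrow> real"
  shows "(\<Sum>k<n. \<psi> k * (\<Prod>j<k. 1 - \<psi> j)) = 1 - (\<Prod>k<n. 1 - \<psi> k)"
  by (induction n) (simp_all add: algebra_simps)

text \<open>The sum is 1 on a neighborhood \<open>V\<close> of \<open>K\<close> and not merely on
  \<open>K\<close>, so that the derivatives of the \<eta> k sum to 0 on \<open>K\<close>. The
  compact sets \<open>C k\<close> control the supports inside the members of the cover.\<close>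

definition C1_partition :: "'a::euclidean_space set \<Rightarrow> 'a set set \<Rightarrow> nat \<Rightarrow> (nat \<Rightarrow> 'a \<Rightarrow> real) \<Rightarrow>
    (nat \<Rightarrow> 'a set) \<Rightarrow> (nat \<Rightarrow> 'a set) \<Rightarrow> 'a set \<Rightarrow> bool" where
  "C1_partition K \<W> n \<eta> W C V \<longleftrightarrow>
     (\<forall>k<n. (\<exists>f'. C1 (\<eta> k) f') \<and> W k \<in> \<W> \<and> compact (C k) \<and> C k \<subseteq> W k \<and>
       (\<forall>y. y \<notin> C k \<longrightarrow> \<eta> k y = 0)) \<and> open V \<and> K \<subseteq> V \<and> (\<forall>y\<in>V. (\<Sum>k<n. \<eta> k y) = 1)"

lemma C1_partition_of_unity:
  fixes K :: "'a::euclidean_space set"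
  assumes "compact K" and op: "\<And>W. W \<in> \<W> \<Longrightarrow> open W" and "K \<subseteq> \<Union>\<W>"
  shows "\<exists>n \<eta> W C V. C1_partition K \<W> n \<eta> W C V"
proof -
  have "\<exists>W r. W \<in> \<W> \<and> r > 0 \<and> cball p r \<subseteq> W" if "p \<in> K" for p
  proof -
    obtain W where "W \<in> \<W>" "p \<in> W" using \<open>p \<in> K\<close> assms(3) by blast
    then show ?thesis using op open_contains_cball by metis
  qed
  then obtain W r where W: "\<And>p. p \<in> K \<Longrightarrow> W p \<in> \<W> \<and> r p > 0 \<and> cball p (r p) \<subseteq> W p" by metis
  have "K \<subseteq> (\<Union>p\<in>K. ball p (r p / 2))" using W by force
  then obtain P where P: "P \<subseteq> K" "finite P" "K \<subseteq> (\<Union>p\<in>P. ball p (r p / 2))"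
    using compactE_image[OF \<open>compact K\<close>, of K "\<lambda>p. ball p (r p / 2)"] by auto
  obtain n and q :: "nat \<Rightarrow> 'a" where q: "P = q ` {i. i < n}"
    using finite_imp_nat_seg_image_inj_on[OF P(2)] by auto
  have qK: "q k \<in> K" if "k < n" for k using that q P by auto
  have "\<exists>f. (\<exists>f'. C1 f f') \<and> (\<forall>y. y \<in> ball (q k) (r (q k) / 2) \<longrightarrow> f y = 1) \<and>
      (\<forall>y. y \<notin> cball (q k) (r (q k)) \<longrightarrow> f y = (0::real))" if "k < n" for k
    using plateau[of "r (q k)" "q k"] W[OF qK[OF that]] by metis
  then obtain \<psi> where \<psi>: "\<And>k. k < n \<Longrightarrow> \<exists>f'. C1 (\<psi> k) f'"
    "\<And>k y. k < n \<Longrightarrow> y \<in> ball (q k) (r (q k) / 2) \<Longrightarrow> \<psi> k y = 1"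
    "\<And>k y. k < n \<Longrightarrow> y \<notin> cball (q k) (r (q k)) \<Longrightarrow> \<psi> k y = (0::real)" by metis
  \<comment> \<open>The partition is built by products and not by dividing by a sum: the terms
    telescope to 1 minus the product of all 1 - \<psi> k, which is 1 wherever some plateau equals
    1.\<close>
  define \<eta> where "\<eta> k y = \<psi> k y * (\<Prod>j<k. 1 - \<psi> j y)" for k y
  have "\<exists>f'. C1 (\<eta> k) f'" if "k < n" for k
  proof -
    have "\<exists>f'. C1 (\<lambda>y. 1 - \<psi> j y) f'" if "j < k" for j
      using C1_affine_real[OF \<psi>(1), of j 1 "-1"] that \<open>k < n\<close> by simp
    then have "\<exists>f'. C1 (\<lambda>y. \<Prod>j<k. 1 - \<psi> j y) f'" by (intro C1_prod) auto
    then show ?thesis using \<psi>(1)[OF that] C1_mult unfolding \<eta>_def[abs_def] by blast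
  qed
  moreover have "W (q k) \<in> \<W> \<and> compact (cball (q k) (r (q k))) \<and> cball (q k) (r (q k)) \<subseteq> W (q k)"
    if "k < n" for k
    using W[OF qK[OF that]] by auto
  moreover have "\<eta> k y = 0" if "k < n" "y \<notin> cball (q k) (r (q k))" for k y
    using \<psi>(3)[OF that] by (simp add: \<eta>_def)
  ultimately have "\<forall>k<n. (\<exists>f'. C1 (\<eta> k) f') \<and> W (q k) \<in> \<W> \<and> compact (cball (q k) (r (q k))) \<and>
      cball (q k) (r (q k)) \<subseteq> W (q k) \<and> (\<forall>y. y \<notin> cball (q k) (r (q k)) \<longrightarrow> \<eta> k y = 0)"
    by blast
  moreover have "open (\<Union>k<n. ball (q k) (r (q k) / 2))" by blast
  moreover have "K \<subseteq> (\<Union>k<n. ball (q k) (r (q k) / 2))" using P(3) q by force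
  moreover have "\<forall>y\<in>(\<Union>k<n. ball (q k) (r (q k) / 2)). (\<Sum>k<n. \<eta> k y) = 1"
  proof
    fix y assume "y \<in> (\<Union>k<n. ball (q k) (r (q k) / 2))"
    then obtain k where k: "k < n" "y \<in> ball (q k) (r (q k) / 2)" by blast
    note \<psi>(2)[OF this]
    with k have "(\<Prod>k<n. 1 - \<psi> k y) = 0" by (intro prod_zero) auto
    then show "(\<Sum>k<n. \<eta> k y) = 1" by (simp add: \<eta>_def sum_telescoping_partition)
  qed
  ultimately show ?thesis
    unfolding C1_partition_def
    by (intro exI[of _ n] exI[of _ \<eta>] exI[of _ "\<lambda>k. W (q k)"] exI[of _ "\<lambda>k. cball (q k) (r (q k))"]
        exI[of _ "\<Union>k<n. ball (q k) (r (q k) / 2)"] conjI)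
qed

text \<open>Test functions increase to the indicator of any open subset of \<open>U\<close>, so
  monotone convergence gives equality on open sets. These are an intersection-stable generator of
  the Borel sets, and balls exhaust the space with finite measure.\<close>

lemma measure_eq_on_open_by_test_functions:
  fixes \<alpha> \<beta> :: "'a::euclidean_space measure"
  assumes sets: "sets \<alpha> = sets borel" "sets \<beta> = sets borel" and "open U"
    and eq: "\<And>f. test_function f \<Longrightarrow> (\<And>y. y \<notin> U \<Longrightarrow> f y = 0) \<Longrightarrow>
      (\<integral>\<^sup>+ y. ennreal (f y) \<partial>\<alpha>) = (\<integral>\<^sup>+ y. ennreal (f y) \<partial>\<beta>)"
    and fin: "\<And>r. emeasure \<alpha> (ball 0 r) < \<infinity>"
  shows "density \<alpha> (indicator U) = density \<beta> (indicator U)"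
proof -
  note [measurable_cong, simp] = sets
  have U [measurable]: "U \<in> sets borel" using \<open>open U\<close> by simp
  have eq_open: "emeasure \<alpha> T = emeasure \<beta> T" if T: "open T" "T \<subseteq> U" for T
  proof -
    obtain f :: "nat \<Rightarrow> 'a \<Rightarrow> real" where f: "\<And>n. test_function (f n)" "\<And>n y. y \<notin> T \<Longrightarrow> f n y = 0"
      "\<And>y. mono (\<lambda>n. f n y)" "\<And>y. (\<lambda>n. f n y) \<longlonglongrightarrow> indicator T y"
      using open_as_limit_of_test_functions[OF T(1)] by blast
    have [measurable]: "f n \<in> borel_measurable borel" for n
      by (rule test_function_measurable[OF f(1)])
    have lim: "(\<lambda>n. \<integral>\<^sup>+ y. ennreal (f n y) \<partial>\<mu>) \<longlonglongrightarrow> emeasure \<mu> T" if [measurable_cong]: "sets \<mu> = sets borel" for \<mu>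
    proof -
      have "(\<lambda>n. \<integral>\<^sup>+ y. ennreal (f n y) \<partial>\<mu>) \<longlonglongrightarrow> (\<integral>\<^sup>+ y. indicator T y \<partial>\<mu>)"
      proof (rule nn_integral_LIMSEQ)
        show "incseq (\<lambda>n y. ennreal (f n y))"
          using f(3) by (auto simp: incseq_def le_fun_def mono_def intro!: ennreal_leI)
        show "(\<lambda>y. ennreal (f n y)) \<in> borel_measurable \<mu>" for n by measurable
        show "(\<lambda>n. ennreal (f n y)) \<longlonglongrightarrow> indicator T y" for y
          using tendsto_ennrealI[OF f(4)[of y]] by (simp add: ennreal_indicator)
      qed
      then show ?thesis using T(1) by (simp add: that borel_open)
    qed
    have *: "(\<integral>\<^sup>+ y. ennreal (f n y) \<partial>\<alpha>) = (\<integral>\<^sup>+ y. ennreal (f n y) \<partial>\<beta>)" for n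
      by (rule eq[OF f(1)]) (use f(2) T(2) in blast)
    show ?thesis
      by (rule LIMSEQ_unique[OF lim[OF sets(1), unfolded *] lim[OF sets(2)]])
  qed
  show ?thesis
  proof (rule measure_eqI_generator_eq[of "{T. open T}" UNIV _ _ "\<lambda>n. ball 0 (real n)"])
    show "Int_stable {T. open (T::'a set)}" by (auto simp: Int_stable_def)
    have borel: "sets (borel :: 'a measure) = sigma_sets UNIV {T. open T}"
      unfolding borel_def by (simp add: sets_measure_of)
    show "sets (density \<alpha> (indicator U)) = sigma_sets UNIV {T. open T}"
      "sets (density \<beta> (indicator U)) = sigma_sets UNIV {T. open T}"
      by (simp_all add: borel)
    show "emeasure (density \<alpha> (indicator U)) T = emeasure (density \<beta> (indicator U)) T" if "T \<in> {T. open T}" for T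
    proof -
      have "emeasure (density \<mu> (indicator U)) T = emeasure \<mu> (U \<inter> T)" if [measurable_cong]: "sets \<mu> = sets borel" for \<mu>
        using \<open>T \<in> _\<close> by (subst emeasure_density)
          (auto simp: that borel_open nn_integral_indicator simp flip: indicator_inter_arith)
      then show ?thesis using eq_open[of "U \<inter> T"] that \<open>open U\<close> sets by auto
    qed
    show "(\<Union>n. ball 0 (real n)) = (UNIV :: 'a set)" by (auto intro: reals_Archimedean2)
    fix n
    have "emeasure (density \<alpha> (indicator U)) (ball 0 (real n)) \<le> emeasure \<alpha> (ball 0 (real n))"
      by (subst emeasure_density)
        (auto simp: nn_integral_indicator[symmetric] simp del: nn_integral_indicator
          intro!: nn_integral_mono split: split_indicator)
    then show "emeasure (density \<alpha> (indicator U)) (ball 0 (real n)) \<noteq> \<infinity>"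
      using fin[of n] by (auto simp: top_unique)
  qed auto
qed

section \<open>The area measure of a graph and its independence of the chart\<close>

context orthonormal_frame begin

lemma chartD:
  assumes "chart G W i sg \<gamma> \<gamma>'"
  shows "openin (top_of_set M) W" "i \<le> m" "sg \<in> {1, -1}" "C1 \<gamma> \<gamma>'"
    "\<And>y t. \<gamma> (y + t *\<^sub>R v i) = \<gamma> y"
  using assms unfolding chart_def by blast+

lemma openin_M_borel: "openin (top_of_set M) W \<Longrightarrow> W \<in> sets borel"
  unfolding openin_open using sets.Int[OF borel_closed[OF closed_span] borel_open] by blast

text \<open>The area of the entire graph of \<gamma>; it says something about the boundary of
  \<open>G\<close> only on Borel subsets of the chart domain \<open>W\<close>.\<close>

definition chart_measure :: "nat \<Rightarrow> ('a \<Rightarrow> real) \<Rightarrow> ('a \<Rightarrow> 'a \<Rightarrow> real) \<Rightarrow> 'a measure" where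
  "chart_measure i \<gamma> \<gamma>' =
     distr (density (vol_minus i) (\<lambda>z. ennreal (area \<gamma>' z))) borel (\<lambda>z. z + \<gamma> z *\<^sub>R v i)"

lemma sets_chart_measure [simp, measurable_cong]: "sets (chart_measure i \<gamma> \<gamma>') = sets borel"
  by (simp add: chart_measure_def)

lemma area_measurable: "C1 \<gamma> \<gamma>' \<Longrightarrow> area \<gamma>' \<in> borel_measurable borel"
  by (intro borel_measurable_continuous_onI continuous_area)

lemma nn_integral_chart_measure:
  assumes \<gamma>: "C1 \<gamma> \<gamma>'" and [measurable]: "f \<in> borel_measurable borel"
  shows "(\<integral>\<^sup>+ y. f y \<partial>chart_measure i \<gamma> \<gamma>') =
    (\<integral>\<^sup>+ z. ennreal (area \<gamma>' z) * f (z + \<gamma> z *\<^sub>R v i) \<partial>vol_minus i)"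
proof -
  have [measurable]: "\<gamma> \<in> borel_measurable borel" "area \<gamma>' \<in> borel_measurable borel"
    using C1_measurable[OF \<gamma>] area_measurable[OF \<gamma>] .
  show ?thesis
    unfolding chart_measure_def by (simp add: nn_integral_distr nn_integral_density)
qed

lemma emeasure_chart_measure:
  assumes \<gamma>: "C1 \<gamma> \<gamma>'" and B: "B \<in> sets borel"
  shows "emeasure (chart_measure i \<gamma> \<gamma>') B =
    (\<integral>\<^sup>+ z. ennreal (area \<gamma>' z) * indicator B (z + \<gamma> z *\<^sub>R v i) \<partial>vol_minus i)"
  using nn_integral_chart_measure[OF \<gamma>, of "indicator B" i] B by simp

lemma integral_chart_measure:
  fixes f :: "'a \<Rightarrow> 'b::euclidean_space"
  assumes \<gamma>: "C1 \<gamma> \<gamma>'" and [measurable]: "f \<in> borel_measurable borel"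
  shows "(LINT y|chart_measure i \<gamma> \<gamma>'. f y) =
    (LINT z|vol_minus i. area \<gamma>' z *\<^sub>R f (z + \<gamma> z *\<^sub>R v i))"
proof -
  have [measurable]: "\<gamma> \<in> borel_measurable borel" "area \<gamma>' \<in> borel_measurable borel"
    using C1_measurable[OF \<gamma>] area_measurable[OF \<gamma>] .
  show ?thesis
    unfolding chart_measure_def by (simp add: integral_distr integral_density)
qed

lemma AE_vol_minus: "AE z in vol_minus i. z \<in> M"
  using AE_coord_volume[of "{..m} - {i}"] by (auto elim: eventually_mono)

lemma graph_point_in_bd:
  assumes G: "openin (top_of_set M) G" and ch: "chart G W i sg \<gamma> \<gamma>'"
    and z: "z \<bullet> v i = 0" "z + \<gamma> z *\<^sub>R v i \<in> W"
  shows "z + \<gamma> z *\<^sub>R v i \<in> bd M G"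
  using bd_chart_iff[OF G ch z(2)] z(1) chartD(5)[OF ch] chartD(2)[OF ch]
  by (simp add: inner_add_left inner_v)

lemma AE_graph_point_in_bd:
  assumes G: "openin (top_of_set M) G" and ch: "chart G W i sg \<gamma> \<gamma>'"
  shows "AE z in vol_minus i. z \<in> M \<and> (z + \<gamma> z *\<^sub>R v i \<in> W \<longrightarrow> z + \<gamma> z *\<^sub>R v i \<in> bd M G)"
proof (rule eventually_mono[OF AE_coord_volume[of "{..m} - {i}"]])
  fix z assume "z \<in> M \<and> (\<forall>s\<le>m. s \<notin> {..m} - {i} \<longrightarrow> z \<bullet> v s = 0)"
  then show "z \<in> M \<and> (z + \<gamma> z *\<^sub>R v i \<in> W \<longrightarrow> z + \<gamma> z *\<^sub>R v i \<in> bd M G)"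
    using graph_point_in_bd[OF G ch, of z] chartD(2)[OF ch] by simp
qed auto

lemma finite_graph_measure:
  assumes \<gamma>: "continuous_on UNIV \<gamma>" "\<And>y t. \<gamma> (y + t *\<^sub>R v i) = \<gamma> y" and i: "i \<le> m"
  shows "emeasure (distr (vol_minus i) borel (\<lambda>z. z + \<gamma> z *\<^sub>R v i)) (cball 0 r) < \<infinity>"
    and "\<exists>R. \<forall>z. z + \<gamma> z *\<^sub>R v i \<in> cball 0 r \<longrightarrow> norm z \<le> R"
proof -
  have [measurable]: "\<gamma> \<in> borel_measurable borel"
    using \<gamma>(1) by (rule borel_measurable_continuous_onI)
  \<comment> \<open>The indicator of a ball counts as a function of bounded support, so the bound
    for shears shows that the preimage of the ball is bounded.\<close>
  have "bounded_support (indicator (cball 0 r) :: 'a \<Rightarrow> real)"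
    unfolding bounded_support_def by (intro exI[of _ r]) auto
  from bounded_support_shear[OF this \<gamma> i] obtain R where
    R: "\<And>z. norm z > R \<Longrightarrow> indicator (cball 0 r) (z + \<gamma> z *\<^sub>R v i) = (0::real)"
    unfolding bounded_support_def by blast
  then have *: "norm z \<le> R" if "z + \<gamma> z *\<^sub>R v i \<in> cball 0 r" for z
    using that R[of z] by (cases "norm z > R") auto
  then show "\<exists>R. \<forall>z. z + \<gamma> z *\<^sub>R v i \<in> cball 0 r \<longrightarrow> norm z \<le> R" by blast
  have "emeasure (distr (vol_minus i) borel (\<lambda>z. z + \<gamma> z *\<^sub>R v i)) (cball 0 r) =
      emeasure (vol_minus i) ((\<lambda>z. z + \<gamma> z *\<^sub>R v i) -` cball 0 r)"
    by (subst emeasure_distr) auto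
  also have "\<dots> < \<infinity>"
  proof (rule emeasure_coord_volume_bounded)
    show "bounded ((\<lambda>z. z + \<gamma> z *\<^sub>R v i) -` cball 0 r)"
      unfolding bounded_iff using * by blast
  qed auto
  finally show "emeasure (distr (vol_minus i) borel (\<lambda>z. z + \<gamma> z *\<^sub>R v i)) (cball 0 r) < \<infinity>" .
qed

text \<open>Every zero of a nonnegative function is a minimum. Hence for a test function vanishing
  off \<open>U\<close> the derivative vanishes off \<open>U\<close> too, without any argument about
  closed supports.\<close>

lemma deriv_zero_at_min:
  fixes f :: "'a \<Rightarrow> real"
  assumes f: "C1 f f'" and "\<And>y. 0 \<le> f y" "f y = 0"
  shows "f' y h = 0"
proof -
  have "f' y = (\<lambda>h. 0)"
    by (rule has_derivative_local_min[OF C1_has_derivative[OF f]])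
      (use assms in auto)
  then show ?thesis by simp
qed

text \<open>Inside \<open>W\<close> the set \<open>G\<close> is the region bounded by the graph;
  elsewhere on \<open>M\<close> the two may differ, but there the integrand is 0.\<close>

lemma chart_divergence:
  fixes f :: "'a \<Rightarrow> 'b::euclidean_space"
  assumes ch: "chart G W i sg \<gamma> \<gamma>'" and G: "openin (top_of_set M) G"
    and f: "C1 f f'" "bounded_support f" and s: "s \<le> m"
    and f': "\<And>y. y \<in> M \<Longrightarrow> y \<notin> W \<Longrightarrow> f' y (v s) = 0"
  shows "(LINT y|vol. indicator G y *\<^sub>R f' y (v s)) =
    (LINT z|vol_minus i. (sg * ((if s = i then 1 else 0) - \<gamma>' z (v s))) *\<^sub>R f (z + \<gamma> z *\<^sub>R v i))"
proof -
  note [measurable] = C1_measurable[OF chartD(4)[OF ch]] C1_deriv_measurable[OF f(1)]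
    openin_M_borel[OF G]
  have "(LINT y|vol. indicator G y *\<^sub>R f' y (v s)) =
      (LINT y|vol. indicator {y. sg * (y \<bullet> v i) < sg * \<gamma> y} y *\<^sub>R f' y (v s))"
  proof (rule integral_cong_AE)
    show "AE y in vol. indicator G y *\<^sub>R f' y (v s) =
        indicator {y. sg * (y \<bullet> v i) < sg * \<gamma> y} y *\<^sub>R f' y (v s)"
    proof (rule eventually_mono[OF AE_coord_volume[OF order_refl]])
      fix y assume "y \<in> M \<and> (\<forall>s\<le>m. s \<notin> {..m} \<longrightarrow> y \<bullet> v s = 0)"
      then have "y \<in> M" by blast
      show "indicator G y *\<^sub>R f' y (v s) = indicator {y. sg * (y \<bullet> v i) < sg * \<gamma> y} y *\<^sub>R f' y (v s)"
      proof (cases "y \<in> W")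
        case True
        then show ?thesis using chart_mem_iff[OF ch True] by (simp add: indicator_def)
      qed (use f' \<open>y \<in> M\<close> in simp)
    qed
  qed measurable
  also have "\<dots> = (LINT z|vol_minus i. (sg * ((if s = i then 1 else 0) - \<gamma>' z (v s))) *\<^sub>R f (z + \<gamma> z *\<^sub>R v i))"
    by (rule divergence_below_graph[OF f chartD(4,5)[OF ch] chartD(2)[OF ch] s chartD(3)[OF ch]])
  finally show ?thesis .
qed

lemma inner_chart_normal:
  assumes ch: "chart G W i sg \<gamma> \<gamma>'" and s: "s \<le> m"
  shows "area \<gamma>' y * (chart_normal i sg \<gamma>' y \<bullet> v s) = sg * ((if s = i then 1 else 0) - \<gamma>' y (v s))"
  using inner_conormal[OF ch v_in_M[OF s], of y] s chartD(2)[OF ch]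
  by (simp add: chart_normal_def inner_v)

text \<open>Both charts compute the same integral of \<open>\<partial>f/\<partial>y\<^sub>i\<close> over \<open>G\<close>, where \<open>i\<close> is the graph direction
  of the first chart. Since the \<open>i\<close>-th component of the normal does not vanish in that chart, this
  identifies the two surface measures without any change of variables on the surface.\<close>

lemma chart_measure_consistent:
  assumes G: "openin (top_of_set M) G"
    and c1: "chart G W1 i1 sg1 \<gamma>1 \<gamma>1'" and c2: "chart G W2 i2 sg2 \<gamma>2 \<gamma>2'"
    and B: "B \<in> sets borel" "B \<subseteq> W1" "B \<subseteq> W2"
  shows "emeasure (chart_measure i1 \<gamma>1 \<gamma>1') B = emeasure (chart_measure i2 \<gamma>2 \<gamma>2') B"
proof -
  note C1 = chartD[OF c1] and C2 = chartD[OF c2]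
  note [measurable] = C1_measurable[OF C1(4)] C1_measurable[OF C2(4)] area_measurable[OF C1(4)]
    area_measurable[OF C2(4)] C1_deriv_measurable[OF C1(4)] C1_deriv_measurable[OF C2(4)] B(1)
  have "openin (top_of_set M) (W1 \<inter> W2)" using C1(1) C2(1) by (rule openin_Int)
  then obtain U where U: "open U" "W1 \<inter> W2 = M \<inter> U" unfolding openin_open by blast
  define Y1 where "Y1 z = z + \<gamma>1 z *\<^sub>R v i1" for z
  define Y2 where "Y2 z = z + \<gamma>2 z *\<^sub>R v i2" for z
  define w where "w z = sg1 * (sg2 * ((if i1 = i2 then 1 else 0) - \<gamma>2' z (v i1)))" for z
  have [measurable]: "Y1 \<in> borel_measurable borel" "Y2 \<in> borel_measurable borel" "w \<in> borel_measurable borel"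
    unfolding Y1_def Y2_def w_def by measurable
  have sg1: "sg1 * sg1 = 1" using C1(3) by auto
  have dY: "\<gamma>1' (Y1 z) h = \<gamma>1' z h" "\<gamma>2' (Y2 z) h = \<gamma>2' z h" for z h
    unfolding Y1_def Y2_def using C1_deriv_invariant(1) C1(4,5) C2(4,5) by metis+
  then have areaY: "area \<gamma>1' (Y1 z) = area \<gamma>1' z" "area \<gamma>2' (Y2 z) = area \<gamma>2' z" for z
    by (simp_all add: area_def)
  \<comment> \<open>Both charts have the same unit normal n. The first gives area1 * (n . v i1) =
    sg1, the second gives area2 * (n . v i1) = sg1 * w. So w is the quotient of the two area
    factors, and in particular positive.\<close>
  have wU: "AE z in vol_minus i2. Y2 z \<in> U \<longrightarrow> area \<gamma>1' (Y2 z) * w z = area \<gamma>2' z"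
  proof (rule eventually_mono[OF AE_graph_point_in_bd[OF G c2]])
    fix z assume *: "z \<in> M \<and> (z + \<gamma>2 z *\<^sub>R v i2 \<in> W2 \<longrightarrow> z + \<gamma>2 z *\<^sub>R v i2 \<in> bd M G)"
    show "Y2 z \<in> U \<longrightarrow> area \<gamma>1' (Y2 z) * w z = area \<gamma>2' z"
    proof
      assume "Y2 z \<in> U"
      moreover have "Y2 z \<in> M" using * C2(2) by (simp add: Y2_def span_add span_scale)
      ultimately have W: "Y2 z \<in> W1" "Y2 z \<in> W2" using U by auto
      then have bd: "Y2 z \<in> bd M G" using * by (simp add: Y2_def)
      let ?n = "chart_normal i2 sg2 \<gamma>2' (Y2 z) \<bullet> v i1"
      have "area \<gamma>1' (Y2 z) * ?n = sg1"
        using inner_chart_normal[OF c1 C1(2), of "Y2 z"] chart_normal_unique[OF G c1 c2 W bd]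
          C1_deriv_invariant(2)[OF C1(4,5)] by simp
      moreover have "area \<gamma>2' z * ?n = sg1 * w z"
        using inner_chart_normal[OF c2 C1(2), of "Y2 z"] sg1
        by (simp add: w_def dY areaY flip: mult.assoc)
      ultimately have "area \<gamma>1' (Y2 z) * (sg1 * w z) = area \<gamma>2' z * sg1"
        by (metis mult.left_commute)
      then show "area \<gamma>1' (Y2 z) * w z = area \<gamma>2' z" using C1(3) by auto
    qed
  qed
  \<comment> \<open>\<alpha> is the first graph measured without its area factor. \<beta> is the
    same measure over \<open>U\<close> as the second chart computes it; restoring the factor area1
    on both sides then gives the two chart measures.\<close>
  define \<alpha> where "\<alpha> = distr (vol_minus i1) borel Y1"
  define \<beta> where "\<beta> = distr (density (vol_minus i2) (\<lambda>z. ennreal (w z))) borel Y2"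
  have [measurable_cong, simp]: "sets \<alpha> = sets borel" "sets \<beta> = sets borel"
    by (simp_all add: \<alpha>_def \<beta>_def)
  have eq: "density \<alpha> (indicator U) = density \<beta> (indicator U)"
  proof (rule measure_eq_on_open_by_test_functions[OF _ _ U(1)])
    fix r show "emeasure \<alpha> (ball 0 r) < \<infinity>"
    proof -
      have "emeasure \<alpha> (ball 0 r) \<le> emeasure \<alpha> (cball 0 r)"
        by (rule emeasure_mono) auto
      also have "\<dots> < \<infinity>"
        using finite_graph_measure(1)[OF C1_continuous[OF C1(4)] C1(5,2)]
        by (simp add: \<alpha>_def Y1_def[abs_def])
      finally show ?thesis .
    qed
  next
    fix f :: "'a \<Rightarrow> real" assume tf: "test_function f" and fU: "\<And>y. y \<notin> U \<Longrightarrow> f y = 0"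
    note [measurable] = test_function_measurable[OF tf]
    obtain f' where f': "C1 f f'" and supp: "bounded_support f" and f0: "\<And>y. 0 \<le> f y"
      using tf by (auto simp: test_function_def)
    have f'0: "f' y h = 0" if "y \<in> M" "y \<notin> W" "W1 \<inter> W2 \<subseteq> W" for y h W
      by (rule deriv_zero_at_min[OF f' f0 fU]) (use that U in auto)
    \<comment> \<open>Here \<gamma>1'(v i1) = 0, so the boundary weight of the first chart is the
      constant sg1.\<close>
    have int1: "(LINT y|vol. indicator G y *\<^sub>R f' y (v i1)) = sg1 * (LINT z|vol_minus i1. f (Y1 z))"
      using chart_divergence[OF c1 G f' supp C1(2)] f'0[of _ W1] C1_deriv_invariant(2)[OF C1(4,5)]
      by (simp add: Y1_def)
    have "(LINT y|vol. indicator G y *\<^sub>R f' y (v i1)) =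
        (LINT z|vol_minus i2. sg1 * (w z * f (Y2 z)))"
      using chart_divergence[OF c2 G f' supp C1(2)] f'0[of _ W2] sg1
      by (simp add: Y2_def w_def flip: mult.assoc)
    with int1 have int: "(LINT z|vol_minus i1. f (Y1 z)) = (LINT z|vol_minus i2. w z * f (Y2 z))"
      using C1(3) by auto
    have I: "integrable (vol_minus i) (\<lambda>z. a z * f (z + \<gamma> z *\<^sub>R v i))"
      if "chart G W i sg \<gamma> \<gamma>'" "continuous_on UNIV a" for i sg \<gamma> \<gamma>' a W
    proof -
      note D = chartD[OF that(1)]
      have "bounded_support (\<lambda>z. a z *\<^sub>R f (z + \<gamma> z *\<^sub>R v i))"
        using bounded_support_shear[OF supp C1_continuous[OF D(4)] D(5,2)]
        by (auto simp: bounded_support_def)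
      moreover have "continuous_on UNIV (\<lambda>z. a z *\<^sub>R f (z + \<gamma> z *\<^sub>R v i))"
        by (intro continuous_intros that(2) continuous_on_compose2[OF C1_continuous[OF f', of UNIV]]
            C1_continuous[OF D(4)]) auto
      ultimately show ?thesis
        using integrable_continuous_bounded_support[of "{..m} - {i}" _ UNIV] by fastforce
    qed
    have "(\<integral>\<^sup>+ y. ennreal (f y) \<partial>\<alpha>) = (\<integral>\<^sup>+ z. ennreal (f (Y1 z)) \<partial>vol_minus i1)"
      unfolding \<alpha>_def by (rule nn_integral_distr) measurable
    also have "\<dots> = ennreal (LINT z|vol_minus i1. f (Y1 z))"
      using I[OF c1, of "\<lambda>_. 1"] f0 by (intro nn_integral_eq_integral) (auto simp: Y1_def)
    also have "\<dots> = ennreal (LINT z|vol_minus i2. w z * f (Y2 z))" by (simp add: int)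
    also have "\<dots> = (\<integral>\<^sup>+ z. ennreal (w z * f (Y2 z)) \<partial>vol_minus i2)"
    proof (rule nn_integral_eq_integral[symmetric])
      show "integrable (vol_minus i2) (\<lambda>z. w z * f (Y2 z))"
        unfolding Y2_def w_def
        by (intro I[OF c2] continuous_intros C1_deriv_continuous[OF C2(4)])
      show "AE z in vol_minus i2. 0 \<le> w z * f (Y2 z)"
      proof (rule eventually_mono[OF wU])
        fix z assume *: "Y2 z \<in> U \<longrightarrow> area \<gamma>1' (Y2 z) * w z = area \<gamma>2' z"
        show "0 \<le> w z * f (Y2 z)"
        proof (cases "Y2 z \<in> U")
          case True
          then have "0 < area \<gamma>1' (Y2 z) * w z" using * by simp
          then have "0 < w z" by (simp add: zero_less_mult_iff)
          then show ?thesis using f0 by simp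
        qed (simp add: fU)
      qed
    qed
    also have "\<dots> = (\<integral>\<^sup>+ z. ennreal (w z) * ennreal (f (Y2 z)) \<partial>vol_minus i2)"
      using f0 by (simp add: ennreal_mult'')
    also have "\<dots> = (\<integral>\<^sup>+ y. ennreal (f y) \<partial>\<beta>)"
      unfolding \<beta>_def by (simp add: nn_integral_distr nn_integral_density)
    finally show "(\<integral>\<^sup>+ y. ennreal (f y) \<partial>\<alpha>) = (\<integral>\<^sup>+ y. ennreal (f y) \<partial>\<beta>)" .
  qed auto
  have [measurable]: "U \<in> sets borel" using U by simp
  have BU: "B \<subseteq> U" using B U by blast
  have iB: "indicator U y * (indicator B y * c) = indicator B y * (c :: ennreal)" for y c
    using BU by (auto simp: indicator_def)
  have "emeasure (chart_measure i1 \<gamma>1 \<gamma>1') B =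
      (\<integral>\<^sup>+ z. indicator B (Y1 z) * ennreal (area \<gamma>1' (Y1 z)) \<partial>vol_minus i1)"
    by (simp add: emeasure_chart_measure[OF C1(4)] Y1_def[symmetric] areaY mult.commute)
  also have "\<dots> = (\<integral>\<^sup>+ y. indicator B y * ennreal (area \<gamma>1' y) \<partial>\<alpha>)"
    unfolding \<alpha>_def by (rule nn_integral_distr[symmetric]) measurable
  also have "\<dots> = (\<integral>\<^sup>+ y. indicator B y * ennreal (area \<gamma>1' y) \<partial>density \<alpha> (indicator U))"
    by (subst nn_integral_density) (auto simp: iB)
  also have "\<dots> = (\<integral>\<^sup>+ y. indicator B y * ennreal (area \<gamma>1' y) \<partial>density \<beta> (indicator U))"
    by (simp only: eq)
  also have "\<dots> = (\<integral>\<^sup>+ y. indicator B y * ennreal (area \<gamma>1' y) \<partial>\<beta>)"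
    by (subst nn_integral_density) (auto simp: iB)
  also have "\<dots> = (\<integral>\<^sup>+ z. ennreal (w z) * (indicator B (Y2 z) * ennreal (area \<gamma>1' (Y2 z))) \<partial>vol_minus i2)"
    unfolding \<beta>_def by (simp add: nn_integral_distr nn_integral_density)
  also have "\<dots> = (\<integral>\<^sup>+ z. ennreal (area \<gamma>2' z) * indicator B (Y2 z) \<partial>vol_minus i2)"
  proof (rule nn_integral_cong_AE, rule eventually_mono[OF wU])
    fix z assume *: "Y2 z \<in> U \<longrightarrow> area \<gamma>1' (Y2 z) * w z = area \<gamma>2' z"
    show "ennreal (w z) * (indicator B (Y2 z) * ennreal (area \<gamma>1' (Y2 z))) =
        ennreal (area \<gamma>2' z) * indicator B (Y2 z)"
    proof (cases "Y2 z \<in> B")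
      case True
      then have "area \<gamma>1' (Y2 z) * w z = area \<gamma>2' z" using * BU by blast
      then have "ennreal (area \<gamma>1' (Y2 z)) * ennreal (w z) = ennreal (area \<gamma>2' z)"
        by (simp flip: ennreal_mult')
      then show ?thesis using True by (simp add: mult.commute)
    qed simp
  qed
  also have "\<dots> = emeasure (chart_measure i2 \<gamma>2 \<gamma>2') B"
    by (simp add: emeasure_chart_measure[OF C2(4)] Y2_def)
  finally show ?thesis .
qed

end

section \<open>Existence and uniqueness of the surface measure\<close>

lemma emeasure_disjoint_cover:
  fixes n :: nat
  assumes A: "\<And>k. k < n \<Longrightarrow> A k \<in> sets N" "disjoint_family_on A {..<n}" and B: "B \<in> sets N"
    and null: "emeasure N (B - (\<Union>k<n. A k)) = 0"
  shows "emeasure N B = (\<Sum>k<n. emeasure N (B \<inter> A k))"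
proof -
  let ?U = "\<Union>k<n. A k"
  have U: "?U \<in> sets N" using A(1) by (intro sets.finite_UN) auto
  have "(\<Sum>k<n. emeasure N (B \<inter> A k)) = emeasure N (\<Union>k<n. B \<inter> A k)"
    by (rule sum_emeasure) (use A B in \<open>auto simp: disjoint_family_on_def\<close>)
  also have "(\<Union>k<n. B \<inter> A k) = B \<inter> ?U" by blast
  also have "emeasure N (B \<inter> ?U) = emeasure N ((B - ?U) \<union> (B \<inter> ?U))"
    by (rule emeasure_Un_null_set[symmetric, of _ N "B - ?U", unfolded Un_commute[of _ "B - ?U"]])
      (use U B null in \<open>auto simp: null_sets_def\<close>)
  also have "(B - ?U) \<union> (B \<inter> ?U) = B" by blast
  finally show ?thesis ..
qed

context orthonormal_frame begin

lemma graph_chart_ex: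
  assumes gc: "graph_chart M v m G W i sg \<gamma>"
  shows "\<exists>\<gamma>'. chart G W i sg (\<lambda>y. \<gamma> (proj y)) \<gamma>' \<and> (\<forall>y\<in>M. area_factor v m \<gamma> y = area \<gamma>' y)"
proof (rule graph_chart_extends[OF gc])
  fix \<gamma>'
  assume "chart G W i sg (\<lambda>y. \<gamma> (proj y)) \<gamma>'" "\<And>y. y \<in> M \<Longrightarrow> area_factor v m \<gamma> y = area \<gamma>' y"
  then show ?thesis by (intro exI[of _ \<gamma>'] conjI ballI)
qed

text \<open>\<open>is_surface_measure\<close> expressed through ambient charts and
  \<open>chart_measure\<close>, which is the form that the consistency of charts speaks
  about.\<close>

definition surface_spec :: "'a set \<Rightarrow> 'a measure \<Rightarrow> bool" where
  "surface_spec G S \<longleftrightarrow> sets S = sets borel \<and> emeasure S (- bd M G) = 0 \<and>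
     (\<forall>W i sg \<gamma> \<gamma>' B. graph_chart M v m G W i sg \<gamma> \<longrightarrow> chart G W i sg (\<lambda>y. \<gamma> (proj y)) \<gamma>' \<longrightarrow>
        B \<in> sets borel \<longrightarrow> B \<subseteq> W \<longrightarrow> emeasure S B = emeasure (chart_measure i (\<lambda>y. \<gamma> (proj y)) \<gamma>') B)"

lemma emeasure_chart_measure_area_factor:
  assumes ch: "chart G W i sg (\<lambda>y. \<gamma> (proj y)) \<gamma>'"
    and area: "\<And>y. y \<in> M \<Longrightarrow> area_factor v m \<gamma> y = area \<gamma>' y" and B: "B \<in> sets borel"
  shows "(\<integral>\<^sup>+ z. indicator B (z + \<gamma> z *\<^sub>R v i) * ennreal (area_factor v m \<gamma> z) \<partial>vol_minus i) =
    emeasure (chart_measure i (\<lambda>y. \<gamma> (proj y)) \<gamma>') B"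
  unfolding emeasure_chart_measure[OF chartD(4)[OF ch] B]
proof (rule nn_integral_cong_AE, rule eventually_mono[OF AE_vol_minus])
  fix z assume "z \<in> M"
  then show "indicator B (z + \<gamma> z *\<^sub>R v i) * ennreal (area_factor v m \<gamma> z) =
      ennreal (area \<gamma>' z) * indicator B (z + \<gamma> (proj z) *\<^sub>R v i)"
    using area[OF \<open>z \<in> M\<close>] by (simp add: mult.commute)
qed

lemma is_surface_measure_iff:
  assumes G: "openin (top_of_set M) G"
  shows "is_surface_measure M v m G S \<longleftrightarrow> surface_spec G S"
proof
  assume S: "is_surface_measure M v m G S"
  show "surface_spec G S"
    unfolding surface_spec_def
  proof (intro conjI allI impI)
    fix W i sg \<gamma> \<gamma>' B
    assume gc: "graph_chart M v m G W i sg \<gamma>" and ch: "chart G W i sg (\<lambda>y. \<gamma> (proj y)) \<gamma>'"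
      and B: "B \<in> sets borel" "B \<subseteq> W"
    obtain \<gamma>1' where "chart G W i sg (\<lambda>y. \<gamma> (proj y)) \<gamma>1' \<and> (\<forall>y\<in>M. area_factor v m \<gamma> y = area \<gamma>1' y)"
      using graph_chart_ex[OF gc] ..
    then have c1: "chart G W i sg (\<lambda>y. \<gamma> (proj y)) \<gamma>1'"
      "\<And>y. y \<in> M \<Longrightarrow> area_factor v m \<gamma> y = area \<gamma>1' y" by simp_all
    have "emeasure S B =
        (\<integral>\<^sup>+ z. indicator B (z + \<gamma> z *\<^sub>R v i) * ennreal (area_factor v m \<gamma> z) \<partial>vol_minus i)"
      using S gc B unfolding is_surface_measure_def by blast
    also have "\<dots> = emeasure (chart_measure i (\<lambda>y. \<gamma> (proj y)) \<gamma>1') B"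
      by (rule emeasure_chart_measure_area_factor[OF c1 B(1)])
    also have "\<dots> = emeasure (chart_measure i (\<lambda>y. \<gamma> (proj y)) \<gamma>') B"
      by (rule chart_measure_consistent[OF G c1(1) ch B B(2)])
    finally show "emeasure S B = emeasure (chart_measure i (\<lambda>y. \<gamma> (proj y)) \<gamma>') B" .
  qed (use S in \<open>auto simp: is_surface_measure_def\<close>)
next
  assume S: "surface_spec G S"
  show "is_surface_measure M v m G S"
    unfolding is_surface_measure_def
  proof (intro conjI allI impI)
    fix W i sg \<gamma> B
    assume gc: "graph_chart M v m G W i sg \<gamma>" and B: "B \<in> sets borel" "B \<subseteq> W"
    obtain \<gamma>1' where "chart G W i sg (\<lambda>y. \<gamma> (proj y)) \<gamma>1' \<and> (\<forall>y\<in>M. area_factor v m \<gamma> y = area \<gamma>1' y)"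
      using graph_chart_ex[OF gc] ..
    then have c1: "chart G W i sg (\<lambda>y. \<gamma> (proj y)) \<gamma>1'"
      "\<And>y. y \<in> M \<Longrightarrow> area_factor v m \<gamma> y = area \<gamma>1' y" by simp_all
    have "emeasure S B = emeasure (chart_measure i (\<lambda>y. \<gamma> (proj y)) \<gamma>1') B"
      using S gc c1(1) B unfolding surface_spec_def by blast
    then show "emeasure S B =
        (\<integral>\<^sup>+ z. indicator B (z + \<gamma> z *\<^sub>R v i) * ennreal (area_factor v m \<gamma> z) \<partial>vol_minus i)"
      using emeasure_chart_measure_area_factor[OF c1 B(1)] by simp
  qed (use S in \<open>auto simp: surface_spec_def\<close>)
qed

lemma closure_M: "G \<subseteq> M \<Longrightarrow> top_of_set M closure_of G = closure G"
  by (simp add: closure_of_subtopology Int_absorb1 closure_minimal closed_span)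

lemma compact_bd:
  assumes G: "openin (top_of_set M) G" and "bounded G"
  shows "compact (bd M G)" "bd M G \<in> sets borel"
proof -
  have sub: "G \<subseteq> M" using G openin_imp_subset by blast
  have "closedin (top_of_set M) (bd M G)" by (rule closedin_frontier_of)
  then have "closed (bd M G)" using closedin_closed_trans[OF _ closed_span] by blast
  moreover have "bd M G \<subseteq> closure G"
    unfolding closure_M[OF sub, symmetric] using bd_iff[OF G] by blast
  ultimately show "compact (bd M G)" "bd M G \<in> sets borel"
    using bounded_subset[OF bounded_closure[OF \<open>bounded G\<close>]]
    by (simp_all add: compact_eq_bounded_closed borel_closed)
qed

lemma chart_measure_off_bd:
  assumes G: "openin (top_of_set M) G" and ch: "chart G W i sg \<gamma> \<gamma>'"
    and B: "B \<in> sets borel" "B \<subseteq> W" "B \<inter> bd M G = {}"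
  shows "emeasure (chart_measure i \<gamma> \<gamma>') B = 0"
proof -
  have "emeasure (chart_measure i \<gamma> \<gamma>') B = (\<integral>\<^sup>+ z. 0 \<partial>vol_minus i)"
    unfolding emeasure_chart_measure[OF chartD(4)[OF ch] B(1)]
  proof (rule nn_integral_cong_AE, rule eventually_mono[OF AE_graph_point_in_bd[OF G ch]])
    fix z assume "z \<in> M \<and> (z + \<gamma> z *\<^sub>R v i \<in> W \<longrightarrow> z + \<gamma> z *\<^sub>R v i \<in> bd M G)"
    then have "z + \<gamma> z *\<^sub>R v i \<notin> B" using B by blast
    then show "ennreal (area \<gamma>' z) * indicator B (z + \<gamma> z *\<^sub>R v i) = 0" by simp
  qed
  then show ?thesis by simp
qed

lemma chart_measure_bounded_finite:
  assumes ch: "chart G W i sg \<gamma> \<gamma>'" and B: "bounded B" "B \<in> sets borel"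
  shows "emeasure (chart_measure i \<gamma> \<gamma>') B < \<infinity>"
proof -
  note D = chartD[OF ch]
  note [measurable] = C1_measurable[OF D(4)]
  have [measurable]: "cball (0::'a) r \<in> sets borel" for r by simp
  obtain r where r: "B \<subseteq> cball 0 r" using bounded_subset_ballD[OF B(1), of 0] ball_subset_cball by blast
  note fin = finite_graph_measure[OF C1_continuous[OF D(4)] D(5,2), of r]
  obtain R where R: "\<And>z. z + \<gamma> z *\<^sub>R v i \<in> cball 0 r \<Longrightarrow> norm z \<le> R" using fin(2) by blast
  have "compact (area \<gamma>' ` cball 0 R)"
    by (intro compact_continuous_image continuous_area[OF D(4)]) auto
  then obtain C where C: "\<And>z. z \<in> cball 0 R \<Longrightarrow> area \<gamma>' z \<le> C"
    using compact_imp_bounded bounded_iff by (metis abs_ge_self image_eqI order_trans real_norm_def)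
  have "emeasure (chart_measure i \<gamma> \<gamma>') B \<le>
      (\<integral>\<^sup>+ z. ennreal C * indicator (cball 0 r) (z + \<gamma> z *\<^sub>R v i) \<partial>vol_minus i)"
    unfolding emeasure_chart_measure[OF D(4) B(2)]
    using r R C by (intro nn_integral_mono) (auto simp: indicator_def intro!: ennreal_leI)
  also have "\<dots> = ennreal C * emeasure (distr (vol_minus i) borel (\<lambda>z. z + \<gamma> z *\<^sub>R v i)) (cball 0 r)"
  proof -
    have "emeasure (distr (vol_minus i) borel (\<lambda>z. z + \<gamma> z *\<^sub>R v i)) (cball 0 r) =
        (\<integral>\<^sup>+ z. indicator (cball 0 r) (z + \<gamma> z *\<^sub>R v i) \<partial>vol_minus i)"
      by (subst nn_integral_indicator[symmetric], simp, rule nn_integral_distr) measurable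
    then show ?thesis by (simp only:) (rule nn_integral_cmult, measurable)
  qed
  also have "\<dots> < \<infinity>" using fin(1) by (simp add: ennreal_mult_less_top)
  finally show ?thesis .
qed

lemma finite_atlas:
  assumes G: "openin (top_of_set M) G" "bounded G" and bdry: "C1_boundary M v m G"
  shows "\<exists>(n::nat) W i sg \<gamma> \<gamma>'. (\<forall>k<n. graph_chart M v m G (W k) (i k) (sg k) (\<gamma> k) \<and>
      chart G (W k) (i k) (sg k) (\<lambda>y. \<gamma> k (proj y)) (\<gamma>' k)) \<and> bd M G \<subseteq> (\<Union>k<n. W k)"
proof -
  have "\<exists>W i sg \<gamma>. graph_chart M v m G W i sg \<gamma> \<and> p \<in> W" if "p \<in> bd M G" for p
    using bdry that by (auto simp: C1_boundary_def)
  then obtain W i sg \<gamma> where W: "\<And>p. p \<in> bd M G \<Longrightarrow> graph_chart M v m G (W p) (i p) (sg p) (\<gamma> p) \<and> p \<in> W p"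
    by metis
  have "\<exists>\<gamma>'. chart G (W p) (i p) (sg p) (\<lambda>y. \<gamma> p (proj y)) \<gamma>'" if "p \<in> bd M G" for p
    by (rule graph_chart_extends[OF conjunct1[OF W[OF that]]]) (rule exI)
  then obtain \<gamma>' where \<gamma>': "\<And>p. p \<in> bd M G \<Longrightarrow> chart G (W p) (i p) (sg p) (\<lambda>y. \<gamma> p (proj y)) (\<gamma>' p)"
    by metis
  have "\<exists>U. open U \<and> W p = M \<inter> U" if "p \<in> bd M G" for p
    using chartD(1)[OF \<gamma>'[OF that]] unfolding openin_open by blast
  then obtain U where U: "\<And>p. p \<in> bd M G \<Longrightarrow> open (U p) \<and> W p = M \<inter> U p" by metis
  have cov: "bd M G \<subseteq> (\<Union>p\<in>bd M G. U p)" using U W by blast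
  obtain P where P: "P \<subseteq> bd M G" "finite P" "bd M G \<subseteq> (\<Union>p\<in>P. U p)"
    using compactE_image[OF compact_bd(1)[OF G], of "bd M G" U] U cov by metis
  obtain n and q :: "nat \<Rightarrow> 'a" where q: "P = q ` {i. i < n}"
    using finite_imp_nat_seg_image_inj_on[OF P(2)] by auto
  have qK: "q k \<in> bd M G" if "k < n" for k using that q P by auto
  have "bd M G \<subseteq> (\<Union>k<n. W (q k))"
  proof
    fix y assume y: "y \<in> bd M G"
    then obtain p where "p \<in> P" "y \<in> U p" using P(3) by blast
    then have "y \<in> W p" using U[of p] P(1) bd_in_M[OF y] by blast
    then show "y \<in> (\<Union>k<n. W (q k))" using \<open>p \<in> P\<close> q by auto
  qed
  then show ?thesis
    using W \<gamma>' qK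
    by (intro exI[of _ n] exI[of _ "\<lambda>k. W (q k)"] exI[of _ "\<lambda>k. i (q k)"] exI[of _ "\<lambda>k. sg (q k)"]
        exI[of _ "\<lambda>k. \<gamma> (q k)"] exI[of _ "\<lambda>k. \<gamma>' (q k)"]) simp
qed

text \<open>A finite atlas cuts the boundary into disjoint Borel pieces, each inside one chart, and
  the chart measures of the pieces are added up. Consistency makes the sum agree with every other
  chart. Conversely, any measure that meets the specification is determined on each piece and is
  null off the boundary, so the definite description denotes this sum.\<close>

lemma surface_measure_properties:
  assumes G: "openin (top_of_set M) G" "bounded G" and bdry: "C1_boundary M v m G"
  shows "surface_spec G (surface_measure M v m G)" "emeasure (surface_measure M v m G) UNIV < \<infinity>"
proof -
  obtain n :: nat and W i sg \<gamma> \<gamma>' where atlas: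
    "(\<forall>k<n. graph_chart M v m G (W k) (i k) (sg k) (\<gamma> k) \<and>
      chart G (W k) (i k) (sg k) (\<lambda>y. \<gamma> k (proj y)) (\<gamma>' k)) \<and> bd M G \<subseteq> (\<Union>k<n. W k)"
    using finite_atlas[OF G bdry] by (elim exE) (rule that)
  then have gc: "\<And>k. k < n \<Longrightarrow> graph_chart M v m G (W k) (i k) (sg k) (\<gamma> k)" and
    ch: "\<And>k. k < n \<Longrightarrow> chart G (W k) (i k) (sg k) (\<lambda>y. \<gamma> k (proj y)) (\<gamma>' k)" and
    cov: "bd M G \<subseteq> (\<Union>k<n. W k)"
    by blast+
  define \<mu> where "\<mu> k = chart_measure (i k) (\<lambda>y. \<gamma> k (proj y)) (\<gamma>' k)" for k
  have [simp, measurable_cong]: "sets (\<mu> k) = sets borel" for k by (simp add: \<mu>_def)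
  \<comment> \<open>The boundary points for which \<open>W k\<close> is the first chart of the atlas
    that contains them.\<close>
  define A where "A k = bd M G \<inter> (W k - (\<Union>j<k. W j))" for k
  have A: "A k \<in> sets borel" if "k < n" for k
    unfolding A_def using that openin_M_borel[OF chartD(1)[OF ch]] compact_bd(2)[OF G] by auto
  have AW: "A k \<subseteq> W k" for k by (auto simp: A_def)
  have Adisj: "disjoint_family_on A {..<n}"
    unfolding disjoint_family_on_def
  proof (intro ballI impI)
    fix a c assume "a \<in> {..<n}" "c \<in> {..<n}" "a \<noteq> c"
    then consider "a < c" | "c < a" by linarith
    then show "A a \<inter> A c = {}" by cases (auto simp: A_def)
  qed
  have Aun: "(\<Union>k<n. A k) = bd M G"
  proof
    show "bd M G \<subseteq> (\<Union>k<n. A k)"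
    proof
      fix y assume y: "y \<in> bd M G"
      define k where "k = (LEAST k. y \<in> W k)"
      obtain k0 where k0: "k0 < n" "y \<in> W k0" using cov y by blast
      have "k \<le> k0" "y \<in> W k" unfolding k_def using k0 by (auto intro: Least_le LeastI)
      moreover have "y \<notin> W j" if "j < k" for j using that not_less_Least unfolding k_def by blast
      ultimately show "y \<in> (\<Union>k<n. A k)" using y k0(1) by (auto simp: A_def)
    qed
  qed (auto simp: A_def)
  define \<nu> where "\<nu> B = (\<Sum>k<n. emeasure (\<mu> k) (B \<inter> A k))" for B
  define S where "S = measure_of UNIV (sets borel) \<nu>"
  have sS: "sets S = sets borel" 
    using sets.sets_measure_of_eq[of "borel :: 'a measure" \<nu>] unfolding S_def by simp
  have eS: "emeasure S B = \<nu> B" if B: "B \<in> sets borel" for B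
    unfolding S_def
  proof (rule emeasure_measure_of_sigma[OF _ _ _ B])
    show "sigma_algebra UNIV (sets (borel :: 'a measure))"
      using sets.sigma_algebra_axioms[of "borel :: 'a measure"] by simp
    show "positive (sets borel) \<nu>" by (simp add: positive_def \<nu>_def)
    show "countably_additive (sets borel) \<nu>"
    proof (rule countably_additiveI)
      fix F :: "nat \<Rightarrow> 'a set"
      assume F: "range F \<subseteq> sets borel" "disjoint_family F" "(\<Union>j. F j) \<in> sets borel"
      have "(\<Sum>j. \<nu> (F j)) = (\<Sum>k<n. \<Sum>j. emeasure (\<mu> k) (F j \<inter> A k))"
        unfolding \<nu>_def by (rule suminf_sum) (simp add: summableI)
      also have "\<dots> = (\<Sum>k<n. emeasure (\<mu> k) (\<Union>j. F j \<inter> A k))"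
      proof (rule sum.cong[OF refl], rule suminf_emeasure)
        fix k assume "k \<in> {..<n}"
        then show "range (\<lambda>j. F j \<inter> A k) \<subseteq> sets (\<mu> k)" using F(1) A by auto
        show "disjoint_family (\<lambda>j. F j \<inter> A k)" using F(2) by (auto simp: disjoint_family_on_def)
      qed
      also have "\<dots> = \<nu> (\<Union>j. F j)" unfolding \<nu>_def by (intro sum.cong) (auto intro!: arg_cong2[where f = emeasure])
      finally show "(\<Sum>j. \<nu> (F j)) = \<nu> (\<Union>j. F j)" .
    qed
  qed
  have spec: "surface_spec G S"
    unfolding surface_spec_def
  proof (intro conjI allI impI)
    show "sets S = sets borel" by fact
    have "- bd M G \<inter> A k = {}" for k by (auto simp: A_def)
    then show "emeasure S (- bd M G) = 0" using compact_bd(2)[OF G] by (simp add: eS \<nu>_def)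
    fix W' i' sg' \<delta> \<delta>' B
    assume c': "chart G W' i' sg' (\<lambda>y. \<delta> (proj y)) \<delta>'" and B: "B \<in> sets borel" "B \<subseteq> W'"
    let ?\<mu> = "chart_measure i' (\<lambda>y. \<delta> (proj y)) \<delta>'"
    have "emeasure S B = (\<Sum>k<n. emeasure (\<mu> k) (B \<inter> A k))" using B by (simp add: eS \<nu>_def)
    also have "\<dots> = (\<Sum>k<n. emeasure ?\<mu> (B \<inter> A k))"
      unfolding \<mu>_def using A B AW
      by (intro sum.cong refl chart_measure_consistent[OF G(1) ch c']) (auto simp: subset_iff)
    also have "\<dots> = emeasure ?\<mu> B"
    proof (rule emeasure_disjoint_cover[symmetric])
      show "emeasure ?\<mu> (B - (\<Union>k<n. A k)) = 0"
        unfolding Aun by (rule chart_measure_off_bd[OF G(1) c']) (use B compact_bd(2)[OF G] in auto)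
    qed (use A Adisj B in auto)
    finally show "emeasure S B = emeasure ?\<mu> B" .
  qed
  have unique: "emeasure S' B = \<nu> B" if S': "surface_spec G S'" and B: "B \<in> sets borel" for S' B
  proof -
    have s: "sets S' = sets borel" using S' by (simp add: surface_spec_def)
    have "emeasure S' B = (\<Sum>k<n. emeasure S' (B \<inter> A k))"
    proof (rule emeasure_disjoint_cover)
      have "emeasure S' (B - bd M G) \<le> emeasure S' (- bd M G)"
        by (rule emeasure_mono) (use s compact_bd(2)[OF G] in auto)
      then show "emeasure S' (B - (\<Union>k<n. A k)) = 0"
        unfolding Aun using S' by (simp add: surface_spec_def)
    qed (use s A Adisj B in auto)
    also have "\<dots> = \<nu> B"
      unfolding \<nu>_def
    proof (rule sum.cong[OF refl])
      fix k assume "k \<in> {..<n}"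
      then have k: "k < n" by simp
      have "B \<inter> A k \<in> sets borel" "B \<inter> A k \<subseteq> W k" using B A[OF k] AW by auto
      then show "emeasure S' (B \<inter> A k) = emeasure (\<mu> k) (B \<inter> A k)"
        using S' gc[OF k] ch[OF k] unfolding surface_spec_def \<mu>_def by blast
    qed
    finally show ?thesis .
  qed
  have "surface_measure M v m G = S"
    unfolding surface_measure_def is_surface_measure_iff[OF G(1)]
  proof (rule the_equality)
    fix S' assume S': "surface_spec G S'"
    show "S' = S"
      by (rule measure_eqI) (use S' sS unique[OF S'] eS in \<open>auto simp: surface_spec_def\<close>)
  qed (rule spec)
  moreover have "emeasure S UNIV < \<infinity>"
  proof -
    have "emeasure (\<mu> k) (UNIV \<inter> A k) < \<infinity>" if "k < n" for k
      unfolding \<mu>_def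
      by (rule chart_measure_bounded_finite[OF ch[OF that]])
        (use compact_imp_bounded[OF compact_bd(1)[OF G]] A[OF that] bounded_subset in \<open>auto simp: A_def\<close>)
    then show ?thesis by (simp add: eS \<nu>_def)
  qed
  ultimately show "surface_spec G (surface_measure M v m G)"
    "emeasure (surface_measure M v m G) UNIV < \<infinity>" using spec by simp_all
qed

end

section \<open>The divergence theorem\<close>

locale C1_domain = orthonormal_frame v m for v :: "nat \<Rightarrow> 'a::euclidean_space" and m +
  fixes G :: "'a set"
  assumes open_G: "openin (top_of_set M) G" and bounded_G: "bounded G"
    and C1_bdry: "C1_boundary M v m G"
begin

abbreviation "S \<equiv> surface_measure M v m G"
abbreviation "\<nu> \<equiv> outward_normal M v m G"

lemma S_spec: "surface_spec G S"
  by (rule surface_measure_properties(1)[OF open_G bounded_G C1_bdry])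

lemma S_finite: "emeasure S UNIV < \<infinity>"
  by (rule surface_measure_properties(2)[OF open_G bounded_G C1_bdry])

lemma sets_S [measurable_cong, simp]: "sets S = sets borel"
  using S_spec by (simp add: surface_spec_def)

lemma bd_borel [measurable]: "bd M G \<in> sets borel"
  by (rule compact_bd(2)[OF open_G bounded_G])

lemma G_borel [measurable]: "G \<in> sets borel"
  by (rule openin_M_borel[OF open_G])

lemma AE_S: "AE y in S. y \<in> bd M G"
proof (rule AE_I[of _ _ "- bd M G"])
  show "- bd M G \<in> sets S" using bd_borel by simp
qed (use S_spec in \<open>auto simp: surface_spec_def\<close>)

lemma bd_chart:
  assumes "p \<in> bd M G"
  shows "\<exists>W i sg \<gamma> \<gamma>'. p \<in> W \<and> graph_chart M v m G W i sg \<gamma> \<and> chart G W i sg (\<lambda>y. \<gamma> (proj y)) \<gamma>'"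
proof -
  obtain W i sg \<gamma> where W: "graph_chart M v m G W i sg \<gamma>" "p \<in> W"
    using C1_bdry assms unfolding C1_boundary_def by blast
  obtain \<gamma>' where "chart G W i sg (\<lambda>y. \<gamma> (proj y)) \<gamma>' \<and> (\<forall>y\<in>M. area_factor v m \<gamma> y = area \<gamma>' y)"
    using graph_chart_ex[OF W(1)] ..
  with W show ?thesis by blast
qed

text \<open>Near a boundary point the normal equals \<open>chart_normal\<close> of one fixed chart,
  which is continuous.\<close>

lemma continuous_normal: "continuous_on (bd M G) \<nu>"
  unfolding continuous_on_eq_continuous_within
proof
  fix p assume p: "p \<in> bd M G"
  obtain W i sg \<gamma> \<gamma>' where W: "p \<in> W" "graph_chart M v m G W i sg \<gamma>"
    "chart G W i sg (\<lambda>y. \<gamma> (proj y)) \<gamma>'"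
    using bd_chart[OF p] by blast
  obtain U where U: "open U" "W = M \<inter> U" using chartD(1)[OF W(3)] unfolding openin_open by blast
  then obtain e where e: "e > 0" "ball p e \<subseteq> U" using W(1) open_contains_ball by blast
  have "continuous (at p within bd M G) (chart_normal i sg \<gamma>')"
    using continuous_chart_normal[OF chartD(4)[OF W(3)], of "bd M G"] p
    by (simp add: continuous_on_eq_continuous_within)
  then show "continuous (at p within bd M G) \<nu>"
  proof (rule continuous_transform_within[OF _ e(1) p])
    fix y assume y: "y \<in> bd M G" "dist y p < e"
    then have "y \<in> W" using U e bd_in_M[OF y(1)] by (auto simp: dist_commute subset_iff)
    then show "chart_normal i sg \<gamma>' y = \<nu> y"
      using outward_normal_eq[OF open_G W(2,3) _ y(1)] by simp
  qed
qed

text \<open>Off the boundary no vector meets the description in \<open>outward_normal\<close>, so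
  its value there is unspecified; the indicator removes it.\<close>

lemma normal_measurable [measurable]: "(\<lambda>y. indicator (bd M G) y *\<^sub>R \<nu> y) \<in> borel_measurable borel"
  by (rule borel_measurable_continuous_on_indicator[OF bd_borel continuous_normal])

lemma set_integrable_bd:
  fixes f :: "'a \<Rightarrow> 'b::euclidean_space"
  assumes f: "continuous_on (bd M G) f"
  shows "set_integrable S (bd M G) f"
proof -
  have [measurable]: "(\<lambda>y. indicator (bd M G) y *\<^sub>R f y) \<in> borel_measurable borel"
    by (rule borel_measurable_continuous_on_indicator[OF bd_borel f])
  have "compact (f ` bd M G)"
    by (rule compact_continuous_image[OF f compact_bd(1)[OF open_G bounded_G]])
  then obtain C where C: "\<And>y. y \<in> bd M G \<Longrightarrow> norm (f y) \<le> C"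
    using compact_imp_bounded bounded_iff by (metis image_eqI)
  show ?thesis
    unfolding set_integrable_def
  proof (rule integrableI_bounded_set[of "bd M G" _ _ C])
    show "(\<lambda>y. indicator (bd M G) y *\<^sub>R f y) \<in> borel_measurable S" by measurable
    show "emeasure S (bd M G) < \<infinity>"
      using S_finite emeasure_mono[of "bd M G" UNIV S] by (auto intro: le_less_trans)
  qed (use C in auto)
qed

lemma density_S_chart:
  assumes gc: "graph_chart M v m G W i sg \<gamma>" and ch: "chart G W i sg (\<lambda>y. \<gamma> (proj y)) \<gamma>'"
  shows "density S (indicator W) = density (chart_measure i (\<lambda>y. \<gamma> (proj y)) \<gamma>') (indicator W)"
proof (rule measure_eqI)
  note W = openin_M_borel[OF chartD(1)[OF ch]]
  fix B assume "B \<in> sets (density S (indicator W))"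
  then have B: "B \<in> sets borel" by simp
  have "emeasure (density N (indicator W)) B = emeasure N (W \<inter> B)" if "sets N = sets borel" for N
    using that W B by (subst emeasure_density) (auto simp: nn_integral_indicator simp flip: indicator_inter_arith)
  moreover have "emeasure S (W \<inter> B) = emeasure (chart_measure i (\<lambda>y. \<gamma> (proj y)) \<gamma>') (W \<inter> B)"
    using S_spec gc ch W B unfolding surface_spec_def by blast
  ultimately show "emeasure (density S (indicator W)) B =
      emeasure (density (chart_measure i (\<lambda>y. \<gamma> (proj y)) \<gamma>') (indicator W)) B" by simp
qed simp

text \<open>The area density of the surface measure times a component of the unit normal is the
  corresponding component of the conormal, which is the weight in the local theorem.\<close>

lemma divergence_chart:
  fixes f :: "'a \<Rightarrow> 'b::euclidean_space"
  assumes gc: "graph_chart M v m G W i sg \<gamma>"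
    and f: "C1 f f'" "bounded_support f" and s: "s \<le> m"
    and fW: "\<And>y. y \<in> M \<Longrightarrow> y \<notin> W \<Longrightarrow> f y = 0 \<and> f' y (v s) = 0"
  shows "(LINT y|vol. indicator G y *\<^sub>R f' y (v s)) =
    (LINT y|S. indicator (bd M G) y *\<^sub>R (\<nu> y \<bullet> v s) *\<^sub>R f y)"
proof -
  obtain \<gamma>' where "chart G W i sg (\<lambda>y. \<gamma> (proj y)) \<gamma>' \<and> (\<forall>y\<in>M. area_factor v m \<gamma> y = area \<gamma>' y)"
    using graph_chart_ex[OF gc] ..
  then have ch: "chart G W i sg (\<lambda>y. \<gamma> (proj y)) \<gamma>'" ..
  note D = chartD[OF ch]
  let ?Y = "\<lambda>z. z + \<gamma> (proj z) *\<^sub>R v i"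
  let ?\<mu> = "chart_measure i (\<lambda>y. \<gamma> (proj y)) \<gamma>'"
  define k where "k y = (chart_normal i sg \<gamma>' y \<bullet> v s) *\<^sub>R f y" for y
  have [measurable]: "W \<in> sets borel" by (rule openin_M_borel[OF D(1)])
  have [measurable]: "k \<in> borel_measurable borel" unfolding k_def
    by (intro borel_measurable_continuous_onI continuous_intros continuous_chart_normal[OF D(4)]
        C1_continuous[OF f(1)])
  have [measurable]: "f \<in> borel_measurable borel" by (rule C1_measurable[OF f(1)])
  note [measurable] = C1_measurable[OF D(4)] C1_deriv_measurable[OF D(4)] area_measurable[OF D(4)]
  have "(LINT y|S. indicator (bd M G) y *\<^sub>R (\<nu> y \<bullet> v s) *\<^sub>R f y) =
      (LINT y|S. ((indicator (bd M G) y *\<^sub>R \<nu> y) \<bullet> v s) *\<^sub>R f y)"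
    by simp
  also have "\<dots> = (LINT y|S. indicator W y *\<^sub>R k y)"
  proof (rule integral_cong_AE)
    show "AE y in S. ((indicator (bd M G) y *\<^sub>R \<nu> y) \<bullet> v s) *\<^sub>R f y = indicator W y *\<^sub>R k y"
    proof (rule eventually_mono[OF AE_S])
      fix y assume y: "y \<in> bd M G"
      show "((indicator (bd M G) y *\<^sub>R \<nu> y) \<bullet> v s) *\<^sub>R f y = indicator W y *\<^sub>R k y"
      proof (cases "y \<in> W")
        case True
        then show ?thesis using outward_normal_eq[OF open_G gc ch True y] y by (simp add: k_def)
      qed (use fW bd_in_M[OF y] in simp)
    qed
  qed measurable
  also have "\<dots> = (LINT y|density S (\<lambda>y. ennreal (indicator W y)). k y)"
    by (subst integral_density) auto
  also have "\<dots> = (LINT y|density ?\<mu> (\<lambda>y. ennreal (indicator W y)). k y)"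
    using density_S_chart[OF gc ch] by (simp add: ennreal_indicator)
  also have "\<dots> = (LINT y|?\<mu>. indicator W y *\<^sub>R k y)"
    by (subst integral_density) auto
  also have "\<dots> = (LINT z|vol_minus i. area \<gamma>' z *\<^sub>R indicator W (?Y z) *\<^sub>R k (?Y z))"
    by (rule integral_chart_measure[OF D(4)]) measurable
  also have "\<dots> = (LINT z|vol_minus i. (sg * ((if s = i then 1 else 0) - \<gamma>' z (v s))) *\<^sub>R f (?Y z))"
  proof (rule integral_cong_AE)
    show "AE z in vol_minus i. area \<gamma>' z *\<^sub>R indicator W (?Y z) *\<^sub>R k (?Y z) =
        (sg * ((if s = i then 1 else 0) - \<gamma>' z (v s))) *\<^sub>R f (?Y z)"
    proof (rule eventually_mono[OF AE_vol_minus])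
      fix z assume "z \<in> M"
      then have YM: "?Y z \<in> M" using D(2) by (simp add: span_add span_scale)
      have d: "\<gamma>' (?Y z) h = \<gamma>' z h" for h using C1_deriv_invariant(1)[OF D(4,5)] .
      then have a: "area \<gamma>' (?Y z) = area \<gamma>' z" by (simp add: area_def)
      show "area \<gamma>' z *\<^sub>R indicator W (?Y z) *\<^sub>R k (?Y z) =
          (sg * ((if s = i then 1 else 0) - \<gamma>' z (v s))) *\<^sub>R f (?Y z)"
      proof (cases "?Y z \<in> W")
        case True
        have "area \<gamma>' z * (chart_normal i sg \<gamma>' (?Y z) \<bullet> v s) = sg * ((if s = i then 1 else 0) - \<gamma>' z (v s))"
          using inner_chart_normal[OF ch s, of "?Y z"] unfolding a d .
        then show ?thesis using True by (simp only: k_def scaleR_scaleR indicator_simps) simp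
      qed (use fW[OF YM] in simp)
    qed
  qed measurable
  also have "\<dots> = (LINT y|vol. indicator G y *\<^sub>R f' y (v s))"
    by (rule chart_divergence[OF ch open_G f s, symmetric]) (use fW in simp)
  finally show ?thesis ..
qed

lemma continuous_normal_component:
  fixes f :: "'a \<Rightarrow> 'b::euclidean_space"
  shows "continuous_on (bd M G) f \<Longrightarrow> continuous_on (bd M G) (\<lambda>y. (\<nu> y \<bullet> v s) *\<^sub>R f y)"
  by (intro continuous_intros continuous_normal)

theorem divergence_theorem:
  fixes f :: "'a \<Rightarrow> 'b::euclidean_space"
  assumes f: "C1 f f'" and s: "s \<le> m"
  shows "(LINT y:G|vol. f' y (v s)) = (LINT y:bd M G|S. (\<nu> y \<bullet> v s) *\<^sub>R f y)"
proof -
  have sub: "G \<subseteq> M" using open_G openin_imp_subset by blast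
  \<comment> \<open>Two kinds of open sets cover the closure. A piece supported in the first kind
    stays inside \<open>G\<close> as far as \<open>M\<close> is concerned: its derivative integrates
    to 0 and it vanishes on the boundary. The second kind are charts.\<close>
  define \<W> where "\<W> = {U. open U \<and> (M \<inter> U \<subseteq> G \<or> (\<exists>i sg \<gamma>. graph_chart M v m G (M \<inter> U) i sg \<gamma>))}"
  have "compact (closure G)" using bounded_G by (simp add: compact_closure)
  moreover have "\<And>U. U \<in> \<W> \<Longrightarrow> open U" by (simp add: \<W>_def)
  moreover have "closure G \<subseteq> \<Union>\<W>"
  proof
    fix y assume y: "y \<in> closure G"
    show "y \<in> \<Union>\<W>"
    proof (cases "y \<in> G")
      case True
      obtain U where "open U" "G = M \<inter> U" using open_G unfolding openin_open by blast
      then have "U \<in> \<W>" "y \<in> U" using True by (auto simp: \<W>_def)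
      then show ?thesis by blast
    next
      case False
      then have "y \<in> bd M G" using y bd_iff[OF open_G] closure_M[OF sub] by simp
      then obtain W i sg \<gamma> \<gamma>' where W: "y \<in> W" "graph_chart M v m G W i sg \<gamma>" "chart G W i sg (\<lambda>y. \<gamma> (proj y)) \<gamma>'"
        using bd_chart by blast
      obtain U where "open U" "W = M \<inter> U" using chartD(1)[OF W(3)] unfolding openin_open by blast
      then have "U \<in> \<W>" "y \<in> U" using W by (auto simp: \<W>_def)
      then show ?thesis by blast
    qed
  qed
  ultimately have "\<exists>n \<eta> W C V. C1_partition (closure G) \<W> n \<eta> W C V"
    by (intro C1_partition_of_unity)
  then obtain n \<eta> W C V where part: "C1_partition (closure G) \<W> n \<eta> W C V" by (elim exE) (rule that)
  have \<eta>: "\<And>k. k < n \<Longrightarrow> \<exists>f'. C1 (\<eta> k) f'" and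
    W: "\<And>k. k < n \<Longrightarrow> W k \<in> \<W> \<and> compact (C k) \<and> C k \<subseteq> W k" and
    supp: "\<And>k y. k < n \<Longrightarrow> y \<notin> C k \<Longrightarrow> \<eta> k y = (0::real)" and
    V: "open V" "closure G \<subseteq> V" and one: "\<And>y. y \<in> V \<Longrightarrow> (\<Sum>k<n. \<eta> k y) = 1"
    using part unfolding C1_partition_def by blast+
  obtain \<eta>' where \<eta>': "\<And>k. k < n \<Longrightarrow> C1 (\<eta> k) (\<eta>' k)" using \<eta> by metis
  define g where "g k y = \<eta> k y *\<^sub>R f y" for k y
  define g' where "g' k y h = \<eta> k y *\<^sub>R f' y h + \<eta>' k y h *\<^sub>R f y" for k y h
  have g: "C1 (g k) (g' k)" if "k < n" for k
    using C1_scaleR[OF \<eta>'[OF that] f] by (simp add: g_def[abs_def] g'_def[abs_def])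
  have g0: "g k y = 0" if "k < n" "y \<notin> C k" for k y
    using supp[OF that] by (simp add: g_def)
  have g'0: "g' k y h = 0" if "k < n" "y \<notin> C k" for k y h
  proof -
    have "open (- C k)" using W[OF that(1)] compact_imp_closed by blast
    then have "g' k y = (\<lambda>_. 0)"
      by (rule C1_deriv_eq_on_open[OF g[OF that(1)] has_derivative_const]) (use that g0 in auto)
    then show ?thesis by simp
  qed
  have gsupp: "bounded_support (g k)" if "k < n" for k
  proof -
    obtain R where "\<And>y. y \<in> C k \<Longrightarrow> norm y \<le> R"
      using W[OF \<open>k < n\<close>] compact_imp_bounded bounded_iff by metis
    then show ?thesis unfolding bounded_support_def using g0[OF that] by (metis not_le)
  qed
  have g'supp: "bounded_support (\<lambda>y. g' k y h)" if "k < n" for k h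
    using gsupp[OF that] C1_bounded_support_deriv[OF g[OF that]] unfolding bounded_support_def by blast
  have each: "(LINT y|vol. indicator G y *\<^sub>R g' k y (v s)) =
      (LINT y|S. indicator (bd M G) y *\<^sub>R (\<nu> y \<bullet> v s) *\<^sub>R g k y)" if k: "k < n" for k
  proof -
    consider "M \<inter> W k \<subseteq> G" | i sg \<gamma> where "graph_chart M v m G (M \<inter> W k) i sg \<gamma>"
      using W[OF k] unfolding \<W>_def by blast
    then show ?thesis
    proof cases
      case 1
      have "(LINT y|vol. indicator G y *\<^sub>R g' k y (v s)) = (LINT y|vol. g' k y (v s))"
      proof (rule integral_cong_AE)
        note [measurable] = C1_deriv_measurable[OF g[OF k]]
        show "(\<lambda>y. indicator G y *\<^sub>R g' k y (v s)) \<in> borel_measurable vol"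
          "(\<lambda>y. g' k y (v s)) \<in> borel_measurable vol" by measurable
        show "AE y in vol. indicator G y *\<^sub>R g' k y (v s) = g' k y (v s)"
        proof (rule eventually_mono[OF AE_coord_volume[OF order_refl]])
          fix y assume "y \<in> M \<and> (\<forall>s\<le>m. s \<notin> {..m} \<longrightarrow> y \<bullet> v s = 0)"
          then have "y \<in> G \<or> y \<notin> C k" using 1 W[OF k] by blast
          then show "indicator G y *\<^sub>R g' k y (v s) = g' k y (v s)" using g'0[OF k] by auto
        qed
      qed
      also have "\<dots> = 0"
        using integral_tangential_deriv[OF g[OF k] gsupp[OF k] s, of UNIV] by simp
      also have "0 = (LINT y|S. indicator (bd M G) y *\<^sub>R (\<nu> y \<bullet> v s) *\<^sub>R g k y)"
      proof -
        have "indicator (bd M G) y *\<^sub>R (\<nu> y \<bullet> v s) *\<^sub>R g k y = 0" for y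
        proof (cases "y \<in> bd M G")
          case True
          then have "y \<notin> G" "y \<in> M" using bd_iff[OF open_G] bd_in_M by blast+
          then have "y \<notin> C k" using 1 W[OF k] by blast
          then show ?thesis using g0[OF k] by simp
        qed simp
        then show ?thesis by (simp only: Bochner_Integration.integral_zero)
      qed
      finally show ?thesis .
    next
      case 2
      show ?thesis
        by (rule divergence_chart[OF 2 g[OF k] gsupp[OF k] s]) (use g0[OF k] g'0[OF k] W[OF k] in blast)
    qed
  qed
  have "(LINT y:G|vol. f' y (v s)) = (LINT y|vol. (\<Sum>k<n. indicator G y *\<^sub>R g' k y (v s)))"
    unfolding set_lebesgue_integral_def
  proof (rule Bochner_Integration.integral_cong[OF refl])
    fix y
    show "indicator G y *\<^sub>R f' y (v s) = (\<Sum>k<n. indicator G y *\<^sub>R g' k y (v s))"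
    proof (cases "y \<in> G")
      case True
      then have y: "y \<in> V" using V(2) closure_subset by blast
      \<comment> \<open>On the open set \<open>V\<close> the pieces sum to f, so their derivatives
        sum to the derivative of f and the contributions of the \<eta>' k cancel.\<close>
      have "C1 (\<lambda>y. \<Sum>k<n. g k y) (\<lambda>y h. \<Sum>k<n. g' k y h)" using g by (intro C1_sum) auto
      from C1_deriv_eq_on_open[OF this C1_has_derivative[OF f] V(1) y]
      have "(\<lambda>h. \<Sum>k<n. g' k y h) = f' y"
        using one by (simp add: g_def flip: scaleR_left.sum)
      from fun_cong[OF this, of "v s"] show ?thesis using True by simp
    qed simp
  qed
  also have "\<dots> = (\<Sum>k<n. (LINT y|vol. indicator G y *\<^sub>R g' k y (v s)))"
    by (intro Bochner_Integration.integral_sum integrable_continuous_bounded_support order_refl G_borel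
        C1_deriv_continuous[OF g] g'supp) auto
  also have "\<dots> = (\<Sum>k<n. (LINT y|S. indicator (bd M G) y *\<^sub>R (\<nu> y \<bullet> v s) *\<^sub>R g k y))"
    using each by (intro sum.cong) auto
  also have "\<dots> = (LINT y|S. (\<Sum>k<n. indicator (bd M G) y *\<^sub>R (\<nu> y \<bullet> v s) *\<^sub>R g k y))"
    using set_integrable_bd[OF continuous_normal_component[OF C1_continuous[OF g]]]
    unfolding set_integrable_def
    by (intro Bochner_Integration.integral_sum[symmetric]) auto
  also have "\<dots> = (LINT y:bd M G|S. (\<nu> y \<bullet> v s) *\<^sub>R f y)"
    unfolding set_lebesgue_integral_def
  proof (rule Bochner_Integration.integral_cong[OF refl])
    fix y
    show "(\<Sum>k<n. indicator (bd M G) y *\<^sub>R (\<nu> y \<bullet> v s) *\<^sub>R g k y) =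
        indicator (bd M G) y *\<^sub>R (\<nu> y \<bullet> v s) *\<^sub>R f y"
    proof (cases "y \<in> bd M G")
      case True
      then have "y \<in> V" using V(2) bd_iff[OF open_G] closure_M[OF sub] by blast
      then have "(\<Sum>k<n. g k y) = f y"
        using one by (simp add: g_def flip: scaleR_left.sum)
      then show ?thesis using True by (simp flip: scaleR_right.sum)
    qed simp
  qed
  finally show ?thesis .
qed

end

section \<open>The regularized Cauchy kernel\<close>

text \<open>\<open>u * cutoff a u = 1 - (max 0 (1 - u / a))\<^sup>2\<close> for \<open>u \<ge> 0\<close>: the kernel \<open>1 / u\<close> is made \<open>C\<^sup>1\<close> at \<open>0\<close>
  in such a way that \<open>(u * cutoff a u)'\<close> is an elementary function supported in \<open>[0, a]\<close>.\<close>

definition cutoff :: "real \<Rightarrow> real \<Rightarrow> real" where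
  "cutoff a u = (if u \<le> a then 2 / a - u / a\<^sup>2 else 1 / u)"

definition cutoff' :: "real \<Rightarrow> real \<Rightarrow> real" where
  "cutoff' a u = (if u \<le> a then - 1 / a\<^sup>2 else - 1 / u\<^sup>2)"

lemma cutoff_deriv:
  assumes a: "a > 0"
  shows "(cutoff a has_real_derivative cutoff' a u) (at u)"
proof (cases "u < a")
  case True
  have "((\<lambda>u. 2 / a - u / a\<^sup>2) has_real_derivative cutoff' a u) (at u)"
    using True a by (auto intro!: derivative_eq_intros simp: cutoff'_def power2_eq_square)
  then show ?thesis
    by (rule has_field_derivative_transform_within_open[of _ _ _ "{..<a}"])
      (use True in \<open>auto simp: cutoff_def\<close>)
next
  case False
  then have u: "u > 0" "u \<ge> a" using a by auto
  have pos: "((\<lambda>u. (max 0 (u - a))\<^sup>2) has_real_derivative 2 * max 0 (u - a) * 1) (at u)"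
    by (rule DERIV_chain2[OF has_real_derivative_pos_part_sq]) (auto intro!: derivative_eq_intros)
  \<comment> \<open>For u \<ge> a one has 1/u = 2/a - u/a^2 + (u-a)^2 / (a^2 u). With the positive
    part of u - a in place of u - a, a single formula covers all u > 0, and no one-sided derivatives
    have to be matched at a.\<close>
  have "((\<lambda>u. 2 / a - u / a\<^sup>2 + (max 0 (u - a))\<^sup>2 / (a\<^sup>2 * u)) has_real_derivative
      - 1 / a\<^sup>2 + (2 * max 0 (u - a) * 1 * (a\<^sup>2 * u) - (max 0 (u - a))\<^sup>2 * a\<^sup>2) / ((a\<^sup>2 * u) * (a\<^sup>2 * u))) (at u)"
  proof (rule DERIV_add)
    show "((\<lambda>u. 2 / a - u / a\<^sup>2) has_real_derivative - 1 / a\<^sup>2) (at u)"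
      using a by (auto intro!: derivative_eq_intros simp: power2_eq_square)
    have "((\<lambda>u. a\<^sup>2 * u) has_real_derivative a\<^sup>2) (at u)"
      by (auto intro!: derivative_eq_intros)
    from DERIV_divide[OF pos this] show "((\<lambda>u. (max 0 (u - a))\<^sup>2 / (a\<^sup>2 * u)) has_real_derivative
        (2 * max 0 (u - a) * 1 * (a\<^sup>2 * u) - (max 0 (u - a))\<^sup>2 * a\<^sup>2) / ((a\<^sup>2 * u) * (a\<^sup>2 * u))) (at u)"
      using u a by simp
  qed
  also have "- 1 / a\<^sup>2 + (2 * max 0 (u - a) * 1 * (a\<^sup>2 * u) - (max 0 (u - a))\<^sup>2 * a\<^sup>2) / ((a\<^sup>2 * u) * (a\<^sup>2 * u)) =
      cutoff' a u"
  proof -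
    have "max 0 (u - a) = u - a" using u by simp
    then have "- 1 / a\<^sup>2 + (2 * max 0 (u - a) * 1 * (a\<^sup>2 * u) - (max 0 (u - a))\<^sup>2 * a\<^sup>2) / ((a\<^sup>2 * u) * (a\<^sup>2 * u)) =
        - 1 / u\<^sup>2"
      using u a by (simp add: field_simps power2_eq_square)
    also have "\<dots> = cutoff' a u" using u by (auto simp: cutoff'_def)
    finally show ?thesis .
  qed
  finally show ?thesis
  proof (rule has_field_derivative_transform_within_open[of _ _ _ "{0<..}"])
    fix t :: real assume "t \<in> {0<..}"
    then show "2 / a - t / a\<^sup>2 + (max 0 (t - a))\<^sup>2 / (a\<^sup>2 * t) = cutoff a t"
      using a by (auto simp: cutoff_def max_def field_simps power2_eq_square)
  qed (use u in auto)
qed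

lemma continuous_cutoff': "a > 0 \<Longrightarrow> continuous_on UNIV (cutoff' a)"
proof -
  assume a: "a > 0"
  have "continuous_on ({..a} \<union> {a..}) (\<lambda>u. if u \<le> a then - 1 / a\<^sup>2 else - 1 / u\<^sup>2)"
    using a by (intro continuous_on_If continuous_intros) auto
  moreover have "{..a} \<union> {a..} = UNIV" by auto
  ultimately show ?thesis by (simp add: cutoff'_def[abs_def])
qed

lemma cutoff_identity:
  assumes "a > 0" "u \<ge> 0"
  shows "cutoff a u + u * cutoff' a u = 2 / a * max 0 (1 - u / a)"
  using assms by (auto simp: cutoff_def cutoff'_def max_def field_simps power2_eq_square)

text \<open>This is (u/a - 1)^2 \<ge> 0 rearranged. The bound is uniform in a and therefore yields
  the dominating function when a tends to 0.\<close>

lemma cutoff_bounds: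
  assumes "a > 0" "u > 0"
  shows "0 \<le> cutoff a u" "cutoff a u \<le> 1 / u"
proof -
  show "0 \<le> cutoff a u"
    using assms by (auto simp: cutoff_def field_simps power2_eq_square)
  have "0 \<le> (u / a - 1)\<^sup>2" by simp
  then have "2 * (u / a) - (u / a)\<^sup>2 \<le> 1" by (simp add: power2_diff)
  then have "(2 / a - u / a\<^sup>2) * u \<le> 1" by (simp add: power2_eq_square algebra_simps)
  then show "cutoff a u \<le> 1 / u"
    using assms by (auto simp: cutoff_def pos_le_divide_eq)
qed

lemma C1_norm_power:
  assumes "N \<ge> 2"
  shows "C1 (\<lambda>y::'a::euclidean_space. norm y ^ N) (\<lambda>y h. real N * norm y ^ (N - 2) * (y \<bullet> h))"
  unfolding C1_def
proof safe
  fix y :: 'a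
  show "((\<lambda>y. norm y ^ N) has_derivative (\<lambda>h. real N * norm y ^ (N - 2) * (y \<bullet> h))) (at y)"
  proof (cases "y = 0")
    case True
    have "((\<lambda>h::'a. norm h ^ (N - 1)) \<longlongrightarrow> norm (0::'a) ^ (N - 1)) (at 0)"
      by (intro tendsto_intros)
    then have "((\<lambda>h::'a. norm h ^ (N - 1)) \<longlongrightarrow> 0) (at 0)" using assms by (simp add: zero_power)
    then have "((\<lambda>h::'a. norm (norm h ^ N) / norm h) \<longlongrightarrow> 0) (at 0)"
    proof (rule Lim_transform_eventually)
      show "\<forall>\<^sub>F h::'a in at 0. norm h ^ (N - 1) = norm (norm h ^ N) / norm h"
        unfolding eventually_at_filter using assms
        by (intro always_eventually) (auto simp: power_eq_if[of _ N] norm_mult)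
    qed
    then show ?thesis using True assms by (simp add: has_derivative_at zero_power)
  next
    case False
    have "(norm has_derivative (\<lambda>h. y \<bullet> h / norm y)) (at y)"
      using has_derivative_norm[OF False] by (simp add: sgn_div_norm inner_commute divide_inverse mult.commute)
    then have "((\<lambda>y. norm y ^ N) has_derivative (\<lambda>h. real N * (y \<bullet> h / norm y) * norm y ^ (N - 1))) (at y)"
      by (rule has_derivative_power)
    moreover have "real N * (y \<bullet> h / norm y) * norm y ^ (N - 1) = real N * norm y ^ (N - 2) * (y \<bullet> h)" for h
    proof -
      obtain k where N: "N = Suc (Suc k)" using assms by (metis add_2_eq_Suc le_Suc_ex)
      show ?thesis using False by (simp add: N)
    qed
    ultimately show ?thesis by simp
  qed
next
  fix h :: 'a
  show "continuous_on UNIV (\<lambda>y::'a. real N * norm y ^ (N - 2) * (y \<bullet> h))"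
    by (intro continuous_intros)
qed

lemma bounded_bilinear_algebra:
  "bounded_bilinear ((*) :: 'a::{real_algebra_1,euclidean_space} \<Rightarrow> 'a \<Rightarrow> 'a)"
  unfolding bilinear_conv_bounded_bilinear[symmetric] bilinear_def
  by (auto intro!: linearI simp: algebra_simps)

text \<open>The functional equation of Gamma at (m+1)/2. It ties the constant of the Cauchy kernel
  to the ball volume \<omega> that governs radial integrals.\<close>

lemma sphere_area_eq: "sphere_area m = real (m + 1) * unit_ball_vol (real (m + 1))"
proof -
  have G: "Gamma ((real m + 1) / 2 + 1) = (real m + 1) / 2 * Gamma ((real m + 1) / 2)"
    by (rule Gamma_plus1) (auto elim!: nonpos_Ints_cases)
  have pos: "Gamma ((real m + 1) / 2) > 0" by (intro Gamma_real_pos) simp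
  have "sqrt pi ^ (m + 1) = sqrt pi powr real (m + 1)"
    by (rule powr_realpow[symmetric]) simp
  also have "\<dots> = (pi powr (1 / 2)) powr real (m + 1)"
    by (simp only: powr_half_sqrt[OF pi_ge_zero])
  also have "\<dots> = pi powr (real (m + 1) / 2)"
    by (simp only: powr_powr times_divide_eq_left mult_1)
  finally have "sqrt pi ^ (m + 1) = pi powr (real (m + 1) / 2)" .
  then have "sphere_area m = 2 * (pi powr ((real m + 1) / 2)) / Gamma ((real m + 1) / 2)"
    by (simp add: sphere_area_def Gamma_one_half_real add.commute)
  also have "\<dots> = (real m + 1) * (pi powr ((real m + 1) / 2) / ((real m + 1) / 2 * Gamma ((real m + 1) / 2)))"
    using pos by (simp add: divide_simps)
  also have "\<dots> = real (m + 1) * unit_ball_vol (real (m + 1))"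
    unfolding unit_ball_vol_def of_nat_add of_nat_1 G ..
  finally show ?thesis .
qed

lemma sphere_area_pos: "sphere_area m > 0"
  unfolding sphere_area_eq by simp

section \<open>Radial integrals over M\<close>

context orthonormal_frame begin

abbreviation "\<omega> \<equiv> unit_ball_vol (real (m + 1))"

text \<open>The role of polar coordinates is played by the image of the volume under \<open>|y|\<^sup>m\<^sup>+\<^sup>1\<close>.\<close>

lemma distr_norm_power:
  "distr vol borel (\<lambda>y. norm y ^ (m + 1)) = density lborel (\<lambda>u. ennreal (\<omega> * indicator {0..} u))"
proof (rule measure_eqI_generator_eq[of "range atMost" UNIV _ _ "\<lambda>n. {..real n}"])
  show "Int_stable (range atMost :: real set set)"
  proof (rule Int_stableI)
    fix A B :: "real set" assume "A \<in> range atMost" "B \<in> range atMost"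
    then obtain a b where "A = {..a}" "B = {..b}" by blast
    then have "A \<inter> B = {..min a b}" by auto
    then show "A \<inter> B \<in> range atMost" by blast
  qed
  have borel: "sets (borel :: real measure) = sigma_sets UNIV (range atMost)"
    unfolding borel_eq_atMost by (rule sets_measure_of) simp
  show "sets (distr vol borel (\<lambda>y. norm y ^ (m + 1))) = sigma_sets UNIV (range atMost)"
    "sets (density lborel (\<lambda>u::real. ennreal (\<omega> * indicator {0..} u))) = sigma_sets UNIV (range atMost)"
    unfolding sets_distr sets_density sets_lborel by (rule borel)+
  \<comment> \<open>The ball of radius r has volume \<omega> r^(m+1), which is linear in u =
    r^(m+1); for this reason the image measure has constant density on the half-line.\<close>
  have ball: "emeasure (distr vol borel (\<lambda>y. norm y ^ (m + 1))) {..u} = ennreal (\<omega> * u)" if u: "u > 0" for u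
  proof -
    define r where "r = root (m + 1) u"
    have r: "r > 0" "r ^ (m + 1) = u" 
      using u real_root_pow_pos[of "m + 1" u] by (simp_all add: r_def real_root_gt_zero)
    have "emeasure (distr vol borel (\<lambda>y. norm y ^ (m + 1))) {..u} =
        emeasure vol ((\<lambda>y. norm y ^ (m + 1)) -` {..u})"
      by (subst emeasure_distr) auto
    also have "(\<lambda>y::'a. norm y ^ (m + 1)) -` {..u} = cball 0 r"
    proof -
      have "norm y ^ (m + 1) \<le> r ^ (m + 1) \<longleftrightarrow> norm y \<le> r" for y :: 'a
        using r by (intro power_mono_iff) auto
      then show ?thesis unfolding r by auto
    qed
    also have "emeasure vol (cball 0 r) = ennreal (\<omega> * u)"
      using emeasure_cball_coord_volume[OF order_refl r(1)] r(2) by (simp add: add.commute)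
    finally show ?thesis .
  qed
  show "emeasure (distr vol borel (\<lambda>y. norm y ^ (m + 1))) A =
      emeasure (density lborel (\<lambda>u. ennreal (\<omega> * indicator {0..} u))) A" if A: "A \<in> range atMost" for A
  proof -
    obtain u where u: "A = {..u}" using A by blast
    have rhs: "emeasure (density lborel (\<lambda>u. ennreal (\<omega> * indicator {0..} u))) A = ennreal (\<omega> * max 0 u)"
    proof -
      have "emeasure (density lborel (\<lambda>u. ennreal (\<omega> * indicator {0..} u))) A =
          (\<integral>\<^sup>+ t. ennreal \<omega> * indicator {0..u} t \<partial>lborel)"
        unfolding u by (subst emeasure_density) (auto intro!: nn_integral_cong split: split_indicator)
      also have "\<dots> = ennreal (\<omega> * max 0 u)"
        by (subst nn_integral_cmult_indicator) (auto simp: ennreal_mult' max_def)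
      finally show ?thesis .
    qed
    consider "u > 0" | "u < 0" | "u = 0" by linarith
    then show ?thesis
    proof cases
      case 1
      then show ?thesis using 1 unfolding rhs unfolding u by (simp only: ball max_absorb2 less_imp_le)
    next
      case 2
      have "(\<lambda>y::'a. norm y ^ (m + 1)) -` {..u} = {}"
      proof -
        have "\<not> norm y ^ (m + 1) \<le> u" for y :: 'a
          using 2 zero_le_power[OF norm_ge_zero[of y], of "m + 1"] by linarith
        then show ?thesis by auto
      qed
      then show ?thesis using 2 unfolding rhs unfolding u by (subst emeasure_distr) auto
    next
      case 3
      have om: "\<omega> > 0" "\<omega> \<noteq> 0"
        using unit_ball_vol_pos[of "real (m + 1)"] of_nat_0_le_iff[of "m + 1"]
        by (blast, metis less_irrefl)
      \<comment> \<open>The preimage of the half-line up to 0 is the origin alone. It is null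
        because it lies in balls of arbitrarily small volume.\<close>
      have le: "emeasure (distr vol borel (\<lambda>y. norm y ^ (m + 1))) {..0} \<le> ennreal e" if "e > 0" for e
      proof -
        have "emeasure (distr vol borel (\<lambda>y. norm y ^ (m + 1))) {..0} \<le>
            emeasure (distr vol borel (\<lambda>y. norm y ^ (m + 1))) {..e / \<omega>}"
          using that by (intro emeasure_mono) auto
        also have "\<dots> = ennreal (\<omega> * (e / \<omega>))"
          using that om(1) by (intro ball divide_pos_pos)
        also have "\<omega> * (e / \<omega>) = e"
          by (subst times_divide_eq_right) (rule nonzero_mult_div_cancel_left[OF om(2)])
        finally show ?thesis .
      qed
      have "emeasure (distr vol borel (\<lambda>y. norm y ^ (m + 1))) {..0} \<le> 0"
        by (rule ennreal_le_epsilon) (unfold add_0, rule le)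
      then show ?thesis unfolding rhs unfolding u 3 by (simp only: max.idem mult_zero_right ennreal_0 le_zero_eq)
    qed
  qed
  show "(\<Union>n. {..real n}) = UNIV" by (auto intro: real_arch_simple)
  show "emeasure (distr vol borel (\<lambda>y. norm y ^ (m + 1))) {..real n} \<noteq> \<infinity>" for n
  proof -
    have "emeasure (distr vol borel (\<lambda>y. norm y ^ (m + 1))) {..real n} \<le>
        emeasure (distr vol borel (\<lambda>y. norm y ^ (m + 1))) {..real n + 1}"
      by (intro emeasure_mono) auto
    also have "\<dots> = ennreal (\<omega> * (real n + 1))" by (rule ball) simp
    finally show ?thesis by (auto simp: top_unique)
  qed
qed auto

text \<open>(m+1) / \<open>sphere_area m\<close>, that is 1/\<omega>, times the derivative of u *
  \<open>cutoff a u\<close> at u = |y|^(m+1). It is supported in the ball of radius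
  a^(1/(m+1)).\<close>

definition mollifier :: "real \<Rightarrow> 'a \<Rightarrow> real" where
  "mollifier a y = real (m + 1) / sphere_area m * (2 / a * max 0 (1 - norm y ^ (m + 1) / a))"

lemma continuous_mollifier: "continuous_on A (mollifier a)"
  unfolding mollifier_def divide_inverse by (intro continuous_intros)

lemma mollifier_nonneg: "a > 0 \<Longrightarrow> mollifier a y \<ge> 0"
  unfolding mollifier_def using sphere_area_pos[of m] by (intro mult_nonneg_nonneg) auto

lemma mollifier_zero: "a > 0 \<Longrightarrow> norm y ^ (m + 1) \<ge> a \<Longrightarrow> mollifier a y = 0"
  by (simp add: mollifier_def)

lemma integral_mollifier:
  assumes a: "a > 0" and x: "x \<in> M"
  shows "(LINT y|vol. mollifier a (y - x)) = 1"
proof -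
  have [measurable]: "mollifier a \<in> borel_measurable borel"
    by (intro borel_measurable_continuous_onI continuous_mollifier)
  define h where "h u = real (m + 1) / sphere_area m * (2 / a * max 0 (1 - u / a))" for u
  have [measurable]: "h \<in> borel_measurable borel"
    unfolding h_def divide_inverse by (intro borel_measurable_continuous_onI continuous_intros)
  have "(LINT y|vol. mollifier a (y - x)) = (LINT y|distr vol borel (\<lambda>y. y + - x). mollifier a y)"
    by (subst integral_distr) auto
  also have "distr vol borel (\<lambda>y. y + - x) = vol"
    using x by (intro distr_translate span_neg)
  also have "(LINT y|vol. mollifier a y) = (LINT y|vol. h (norm y ^ (m + 1)))"
    by (simp only: h_def mollifier_def)
  also have "\<dots> = (LINT u|distr vol borel (\<lambda>y. norm y ^ (m + 1)). h u)"
    by (rule integral_distr[symmetric]) measurable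
  also have "\<dots> = (LINT u|lborel. (\<omega> * indicator {0..} u) *\<^sub>R h u)"
    unfolding distr_norm_power by (rule integral_density) auto
  also have "\<dots> = (LINT u|lborel. indicator {0..a} u *\<^sub>R (2 / a * (1 - u / a)))"
  proof (rule Bochner_Integration.integral_cong[OF refl])
    fix u
    have "\<omega> * (real (m + 1) / sphere_area m) = 1"
      using unit_ball_vol_pos[of "real (m + 1)"] unfolding sphere_area_eq by (simp del: of_nat_add unit_ball_vol_pos)
    then have "\<omega> * h u = 2 / a * max 0 (1 - u / a)"
      unfolding h_def by (simp only: mult.assoc[symmetric] mult_1)
    then show "(\<omega> * indicator {0..} u) *\<^sub>R h u = indicator {0..a} u *\<^sub>R (2 / a * (1 - u / a))"
      using a by (auto simp: indicator_def max_def field_simps)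
  qed
  \<comment> \<open>The antiderivative is 2u/a - u^2/a^2, evaluated at a and at 0.\<close>
  also have "\<dots> = (2 * a / a - a\<^sup>2 / a\<^sup>2) - (2 * 0 / a - 0\<^sup>2 / a\<^sup>2)"
    using a
    by (intro integral_FTC_atLeastAtMost continuous_intros)
      (auto intro!: derivative_eq_intros
        simp: has_real_derivative_iff_has_vector_derivative[symmetric] field_simps power2_eq_square)
  also have "\<dots> = 1" using a by simp
  finally show ?thesis .
qed

text \<open>The integrand is |y - x|^(-m), the size of the Cauchy kernel, written as a power of u =
  |y - x|^(m+1). In that variable the exponent -m/(m+1) exceeds -1, so the singularity at 0 is
  integrable.\<close>

lemma finite_integral_norm_power:
  assumes x: "x \<in> M"
  shows "(\<integral>\<^sup>+ y. indicator (cball x R) y * ennreal ((norm (y - x) ^ (m + 1)) powr (- real m / real (m + 1))) \<partial>vol) < \<infinity>"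
proof -
  define g where "g y = indicator (cball 0 R) y * ennreal ((norm y ^ (m + 1)) powr (- real m / real (m + 1)))" for y :: 'a
  have cb [measurable]: "cball (0::'a) R \<in> sets borel" by simp
  have [measurable]: "g \<in> borel_measurable borel" unfolding g_def by measurable
  define e :: real where "e = - real m / real (m + 1)"
  have e: "e > -1" unfolding e_def by (simp add: field_simps)
  define T where "T = \<bar>R\<bar> ^ (m + 1)"
  have T: "T \<ge> 0" by (simp add: T_def)
  have "(\<integral>\<^sup>+ y. indicator (cball x R) y * ennreal ((norm (y - x) ^ (m + 1)) powr (- real m / real (m + 1))) \<partial>vol) =
      (\<integral>\<^sup>+ y. g (y + - x) \<partial>vol)"
    by (intro nn_integral_cong) (auto simp: g_def indicator_def dist_norm norm_minus_commute)
  also have "\<dots> = (\<integral>\<^sup>+ y. g y \<partial>distr vol borel (\<lambda>y. y + - x))"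
    by (subst nn_integral_distr) auto
  also have "distr vol borel (\<lambda>y. y + - x) = vol"
    using x by (intro distr_translate span_neg)
  also have "(\<integral>\<^sup>+ y. g y \<partial>vol) \<le> (\<integral>\<^sup>+ y. indicator {0..T} (norm y ^ (m + 1)) * ennreal ((norm y ^ (m + 1)) powr e) \<partial>vol)"
    by (intro nn_integral_mono)
      (auto simp: g_def e_def T_def indicator_def simp del: power_Suc intro!: power_mono)
  also have "\<dots> = (\<integral>\<^sup>+ u. indicator {0..T} u * ennreal (u powr e) \<partial>distr vol borel (\<lambda>y. norm y ^ (m + 1)))"
    by (subst nn_integral_distr) auto
  also have "\<dots> = (\<integral>\<^sup>+ u. ennreal (\<omega> * indicator {0..} u) * (indicator {0..T} u * ennreal (u powr e)) \<partial>lborel)"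
    unfolding distr_norm_power by (subst nn_integral_density) auto
  also have "\<dots> = (\<integral>\<^sup>+ u. ennreal \<omega> * ennreal (indicator {0..T} u * u powr e) \<partial>lborel)"
    by (intro nn_integral_cong) (auto simp: indicator_def)
  also have "\<dots> = ennreal \<omega> * (\<integral>\<^sup>+ u. ennreal (indicator {0..T} u * u powr e) \<partial>lborel)"
    by (rule nn_integral_cmult) measurable
  also have "(\<integral>\<^sup>+ u. ennreal (indicator {0..T} u * u powr e) \<partial>lborel) = ennreal (integral {0..T} (\<lambda>u. u powr e))"
  proof (rule nn_integral_has_integral_lborel)
    have "(\<lambda>u. indicator {0..T} u * u powr e) = (\<lambda>u. if u \<in> {0..T} then u powr e else 0)"
      by auto
    then show "((\<lambda>u. indicator {0..T} u * u powr e) has_integral integral {0..T} (\<lambda>u. u powr e)) UNIV"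
      using integrable_integral[OF integrable_on_powr_from_0[OF e T]]
      by (simp only: has_integral_restrict_UNIV)
  qed auto
  finally show ?thesis by (simp add: ennreal_mult_less_top order_le_less_trans)
qed

end

section \<open>The Cauchy-Pompeiu formula\<close>

lemma C1_translate:
  assumes f: "C1 f f'"
  shows "C1 (\<lambda>y. f (y - x)) (\<lambda>y h. f' (y - x) h)"
  unfolding C1_def
proof safe
  fix y
  have "((\<lambda>y. y - x) has_derivative (\<lambda>h. h)) (at y)" by (auto intro!: derivative_eq_intros)
  from has_derivative_compose[OF this C1_has_derivative[OF f]]
  show "((\<lambda>y. f (y - x)) has_derivative f' (y - x)) (at y)" .
next
  fix h show "continuous_on UNIV (\<lambda>y. f' (y - x) h)"
    by (intro continuous_on_compose2[OF C1_deriv_continuous[OF f, of UNIV]] continuous_intros) auto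
qed

context C1_domain begin

lemma G_subset: "G \<subseteq> M"
  using open_G openin_imp_subset by blast

lemma continuous_bounded_on_G:
  fixes g :: "'a \<Rightarrow> 'b::euclidean_space"
  assumes g: "continuous_on UNIV g"
  obtains C where "C \<ge> 0" "\<And>y. y \<in> G \<Longrightarrow> norm (g y) \<le> C"
proof -
  have "compact (g ` closure G)"
    by (intro compact_continuous_image continuous_on_subset[OF g]) (simp_all add: compact_closure bounded_G)
  then obtain C where "\<And>y. y \<in> closure G \<Longrightarrow> norm (g y) \<le> C"
    using compact_imp_bounded bounded_iff by (metis image_eqI)
  then have C: "norm (g y) \<le> max C 0" if "y \<in> G" for y
    using that closure_subset[of G] by (meson in_mono max.coboundedI1)
  show ?thesis by (rule that[of "max C 0"]) (use C in auto)
qed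

lemma set_integrable_G:
  fixes g :: "'a \<Rightarrow> 'b::euclidean_space"
  assumes g: "continuous_on UNIV g"
  shows "set_integrable vol G g"
proof -
  obtain C where C: "C \<ge> 0" "\<And>y. y \<in> G \<Longrightarrow> norm (g y) \<le> C"
    using continuous_bounded_on_G[OF g] by blast
  obtain R where R: "G \<subseteq> ball 0 R" using bounded_subset_ballD[OF bounded_G, of 0] by blast
  have [measurable]: "g \<in> borel_measurable borel" using g by (rule borel_measurable_continuous_onI)
  show ?thesis
    unfolding set_integrable_def
    by (rule integrable_coord_volume[of _ _ C R]) (use C R in \<open>auto simp: indicator_def\<close>)
qed

lemma normal_in_M:
  assumes y: "y \<in> bd M G"
  shows "\<nu> y \<in> M"
proof -
  obtain W i sg \<gamma> \<gamma>' where W: "y \<in> W" "graph_chart M v m G W i sg \<gamma>"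
    "chart G W i sg (\<lambda>y. \<gamma> (proj y)) \<gamma>'"
    using bd_chart[OF y] by blast
  show ?thesis
    unfolding outward_normal_eq[OF open_G W(2,3,1) y] by (rule chart_normal_in_M[OF W(3)])
qed

lemma mollifier_integrable:
  fixes g :: "'a \<Rightarrow> 'b::euclidean_space"
  assumes a: "a > 0" and g: "continuous_on UNIV g"
  shows "integrable vol (\<lambda>y. mollifier a (y - x) *\<^sub>R g y)"
proof -
  \<comment> \<open>The maximum with 1 ensures that the power m + 1 of the distance is at least the
    distance itself, hence at least a.\<close>
  have "mollifier a (y - x) = 0" if "norm y > norm x + max 1 a" for y
  proof (rule mollifier_zero[OF a])
    have *: "norm (y - x) > max 1 a" using that norm_triangle_ineq2[of y x] by linarith
    then have "norm (y - x) \<le> norm (y - x) ^ (m + 1)" by (intro self_le_power) auto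
    then show "a \<le> norm (y - x) ^ (m + 1)" using * by linarith
  qed
  then have "bounded_support (\<lambda>y. mollifier a (y - x) *\<^sub>R g y)"
    unfolding bounded_support_def by (intro exI[of _ "norm x + max 1 a"]) auto
  moreover have "continuous_on UNIV (\<lambda>y. mollifier a (y - x) *\<^sub>R g y)"
    by (intro continuous_intros g continuous_on_compose2[OF continuous_mollifier[of UNIV]]) auto
  ultimately show ?thesis
    using integrable_continuous_bounded_support[of "{..m}" _ UNIV] by fastforce
qed

text \<open>For x in \<open>G\<close> the part of the support lying in \<open>M\<close> is
  eventually inside \<open>G\<close>, so the integral extends over all of \<open>M\<close> and the
  total mass 1 applies. For x off the closure the support eventually misses
  \<open>G\<close>.\<close>

lemma mollifier_limit:
  fixes \<Phi> :: "'a \<Rightarrow> 'b::euclidean_space"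
  assumes \<Phi>: "continuous_on UNIV \<Phi>" and x: "x \<in> G \<union> (M - closure G)"
    and a: "\<And>n. a n > 0" "a \<longlonglongrightarrow> 0"
  shows "(\<lambda>n. LINT y:G|vol. mollifier (a n) (y - x) *\<^sub>R \<Phi> y) \<longlonglongrightarrow> (if x \<in> G then \<Phi> x else 0)"
proof (cases "x \<in> G")
  case True
  then have xM: "x \<in> M" using G_subset by blast
  obtain U where U: "open U" "G = M \<inter> U" using open_G unfolding openin_open by blast
  then obtain \<delta> where \<delta>: "\<delta> > 0" "ball x \<delta> \<subseteq> U" using True open_contains_ball by blast
  have "(\<lambda>n. LINT y:G|vol. mollifier (a n) (y - x) *\<^sub>R \<Phi> y) \<longlonglongrightarrow> \<Phi> x"
  proof (rule metric_LIMSEQ_I)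
    fix e :: real assume e: "e > 0"
    obtain \<delta>1 where \<delta>1: "\<delta>1 > 0" "\<And>y. dist y x < \<delta>1 \<Longrightarrow> dist (\<Phi> y) (\<Phi> x) < e / 2"
      using \<Phi> e unfolding continuous_on_iff by (metis UNIV_I half_gt_zero)
    \<comment> \<open>\<delta> keeps the support inside \<open>G\<close> and \<delta>1 controls the
      oscillation of \<Phi>. The support has radius below \<rho> as soon as a n <
      \<rho>^(m+1).\<close>
    define \<rho> where "\<rho> = min \<delta> \<delta>1"
    have \<rho>: "\<rho> > 0" "\<rho> \<le> \<delta>" "\<rho> \<le> \<delta>1" using \<delta> \<delta>1 by (auto simp: \<rho>_def)
    have "\<forall>\<^sub>F n in sequentially. a n < \<rho> ^ (m + 1)"
      using a(2) \<rho>(1) by (intro order_tendstoD(2)) auto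
    then obtain n0 where n0: "\<And>n. n \<ge> n0 \<Longrightarrow> a n < \<rho> ^ (m + 1)"
      unfolding eventually_sequentially by blast
    have "dist (LINT y:G|vol. mollifier (a n) (y - x) *\<^sub>R \<Phi> y) (\<Phi> x) < e" if n: "n \<ge> n0" for n
    proof -
      have far: "mollifier (a n) (y - x) = 0" if "\<rho> \<le> norm (y - x)" for y
        using power_mono[OF that, of "m + 1"] n0[OF n] \<rho>(1) a(1)
        by (intro mollifier_zero) auto
      note int = mollifier_integrable[OF a(1)[of n]]
      note [measurable] = borel_measurable_integrable[OF int[OF \<Phi>, of x]]
      have "(LINT y:G|vol. mollifier (a n) (y - x) *\<^sub>R \<Phi> y) = (LINT y|vol. mollifier (a n) (y - x) *\<^sub>R \<Phi> y)"
        unfolding set_lebesgue_integral_def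
      proof (rule integral_cong_AE)
        show "AE y in vol. indicator G y *\<^sub>R mollifier (a n) (y - x) *\<^sub>R \<Phi> y = mollifier (a n) (y - x) *\<^sub>R \<Phi> y"
        proof (rule eventually_mono[OF AE_coord_volume[OF order_refl]])
          fix y assume "y \<in> M \<and> (\<forall>s\<le>m. s \<notin> {..m} \<longrightarrow> y \<bullet> v s = 0)"
          then have "y \<in> M" by blast
          show "indicator G y *\<^sub>R mollifier (a n) (y - x) *\<^sub>R \<Phi> y = mollifier (a n) (y - x) *\<^sub>R \<Phi> y"
          proof (cases "y \<in> G")
            case False
            then have "y \<notin> ball x \<delta>" using U \<delta>(2) \<open>y \<in> M\<close> by blast
            then have "\<rho> \<le> norm (y - x)" using \<rho>(2) by (simp add: dist_norm norm_minus_commute)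
            from far[OF this] show ?thesis by simp
          qed simp
        qed
      qed measurable
      also have "\<dots> = (LINT y|vol. mollifier (a n) (y - x) *\<^sub>R (\<Phi> y - \<Phi> x)) + (LINT y|vol. mollifier (a n) (y - x) *\<^sub>R \<Phi> x)"
        by (subst Bochner_Integration.integral_add[symmetric])
          (auto intro!: int continuous_intros \<Phi> simp: scaleR_diff_right)
      also have "(LINT y|vol. mollifier (a n) (y - x) *\<^sub>R \<Phi> x) = \<Phi> x"
      proof -
        have "integrable vol (\<lambda>y. mollifier (a n) (y - x))"
          using int[of "\<lambda>_. 1::real"] by simp
        then show ?thesis using integral_mollifier[OF a(1) xM] by simp
      qed
      finally have "dist (LINT y:G|vol. mollifier (a n) (y - x) *\<^sub>R \<Phi> y) (\<Phi> x) =
          norm (LINT y|vol. mollifier (a n) (y - x) *\<^sub>R (\<Phi> y - \<Phi> x))"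
        by (simp add: dist_norm)
      also have "\<dots> \<le> (LINT y|vol. norm (mollifier (a n) (y - x) *\<^sub>R (\<Phi> y - \<Phi> x)))"
        by (rule integral_norm_bound)
      also have "\<dots> \<le> (LINT y|vol. mollifier (a n) (y - x) *\<^sub>R (e / 2))"
      proof (rule integral_mono)
        show "integrable vol (\<lambda>y. norm (mollifier (a n) (y - x) *\<^sub>R (\<Phi> y - \<Phi> x)))"
          by (intro integrable_norm int continuous_intros \<Phi>)
        show "integrable vol (\<lambda>y. mollifier (a n) (y - x) *\<^sub>R (e / 2))"
          by (intro int continuous_intros)
        fix y
        show "norm (mollifier (a n) (y - x) *\<^sub>R (\<Phi> y - \<Phi> x)) \<le> mollifier (a n) (y - x) *\<^sub>R (e / 2)"
        proof (cases "\<rho> \<le> norm (y - x)")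
          case False
          then have "norm (\<Phi> y - \<Phi> x) \<le> e / 2"
            using \<delta>1(2)[of y] \<rho>(3) by (simp add: dist_norm less_imp_le)
          from mult_left_mono[OF this mollifier_nonneg[OF a(1), of n "y - x"]] show ?thesis
            using mollifier_nonneg[OF a(1), of n "y - x"] by simp
        qed (simp add: far)
      qed
      also have "\<dots> = e / 2" using integral_mollifier[OF a(1) xM, of n] by simp
      finally show ?thesis using e by simp
    qed
    then show "\<exists>n0. \<forall>n\<ge>n0. dist (LINT y:G|vol. mollifier (a n) (y - x) *\<^sub>R \<Phi> y) (\<Phi> x) < e" by blast
  qed
  then show ?thesis using True by simp
next
  case False
  then have "x \<in> - closure G" using x by blast
  then obtain \<delta> where \<delta>: "\<delta> > 0" "ball x \<delta> \<subseteq> - closure G"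
    using open_contains_ball[of "- closure G"] by auto
  have "\<forall>\<^sub>F n in sequentially. a n < \<delta> ^ (m + 1)"
    using a(2) \<delta>(1) by (intro order_tendstoD(2)) auto
  then have "\<forall>\<^sub>F n in sequentially. (LINT y:G|vol. mollifier (a n) (y - x) *\<^sub>R \<Phi> y) = 0"
  proof (rule eventually_mono)
    fix n assume n: "a n < \<delta> ^ (m + 1)"
    have "indicator G y *\<^sub>R mollifier (a n) (y - x) *\<^sub>R \<Phi> y = 0" for y
    proof (cases "y \<in> G")
      case True
      then have "y \<notin> ball x \<delta>" using \<delta>(2) closure_subset[of G] by blast
      then have "\<delta> \<le> norm (y - x)" by (simp add: dist_norm norm_minus_commute)
      from power_mono[OF this, of "m + 1"] have "mollifier (a n) (y - x) = 0"
        using n \<delta>(1) a(1) by (intro mollifier_zero) auto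
      then show ?thesis by simp
    qed simp
    then show "(LINT y:G|vol. mollifier (a n) (y - x) *\<^sub>R \<Phi> y) = 0"
      unfolding set_lebesgue_integral_def by (simp only: Bochner_Integration.integral_zero)
  qed
  then show ?thesis using False by (simp add: tendsto_eventually)
qed

end

section \<open>The Cauchy kernel of a hypercomplex basis\<close>

locale hypercomplex_domain = C1_domain v m G
  for v :: "nat \<Rightarrow> 'a::{real_algebra_1,euclidean_space}" and m G +
  fixes c :: "'a \<Rightarrow> 'a"
  assumes linear_c: "linear c" and m_pos: "m \<ge> 1"
    and conj_same: "\<And>s. s \<le> m \<Longrightarrow> c (v s) * v s = 1"
    and conj_diff: "\<And>s u. s \<le> m \<Longrightarrow> u \<le> m \<Longrightarrow> s \<noteq> u \<Longrightarrow> c (v s) * v u + c (v u) * v s = 0"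
begin

lemma norm_sq_M:
  assumes "y \<in> M"
  shows "(norm y)\<^sup>2 = (\<Sum>s\<le>m. (y \<bullet> v s)\<^sup>2)"
proof -
  have "y \<bullet> y = (\<Sum>s\<le>m. (y \<bullet> v s) * (y \<bullet> v s))"
    by (subst (2) expand_M[OF assms]) (simp add: inner_sum_right)
  then show ?thesis unfolding power2_norm_eq_inner unfolding power2_eq_square .
qed

lemma conj_mult_self:
  assumes y: "y \<in> M"
  shows "c y * y = (norm y)\<^sup>2 *\<^sub>R 1"
proof -
  define q where "q s = y \<bullet> v s" for s
  have y': "y = (\<Sum>s\<le>m. q s *\<^sub>R v s)" using expand_M[OF y] by (simp add: q_def)
  have cy: "c y = (\<Sum>s\<le>m. q s *\<^sub>R c (v s))"
    by (subst y') (simp add: linear_sum[OF linear_c] linear_cmul[OF linear_c])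
  \<comment> \<open>The double sum is kept in two versions with s and u exchanged. In their sum each
    off-diagonal term vanishes by \<open>conj_diff\<close>, which accounts for the factor 2
    below.\<close>
  have e: "c y * y = (\<Sum>s\<le>m. \<Sum>u\<le>m. (q s * q u) *\<^sub>R (c (v s) * v u))"
    using arg_cong2[where f = "(*)", OF cy y'] by (simp add: sum_product mult.commute)
  also have "\<dots> = (\<Sum>s\<le>m. \<Sum>u\<le>m. (q s * q u) *\<^sub>R (c (v u) * v s))"
    by (subst sum.swap) (simp add: mult.commute)
  finally have e': "c y * y = (\<Sum>s\<le>m. \<Sum>u\<le>m. (q s * q u) *\<^sub>R (c (v u) * v s))" .
  have "2 *\<^sub>R (c y * y) = c y * y + c y * y" by (simp add: scaleR_2)
  also have "\<dots> = (\<Sum>s\<le>m. \<Sum>u\<le>m. (q s * q u) *\<^sub>R (c (v s) * v u + c (v u) * v s))"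
    by (subst e, subst e') (simp add: sum.distrib scaleR_add_right)
  also have "\<dots> = (\<Sum>s\<le>m. \<Sum>u\<le>m. if s = u then (2 * (q s)\<^sup>2) *\<^sub>R 1 else 0)"
  proof (intro sum.cong refl)
    fix s u assume "s \<in> {..m}" "u \<in> {..m}"
    then show "(q s * q u) *\<^sub>R (c (v s) * v u + c (v u) * v s) = (if s = u then (2 * (q s)\<^sup>2) *\<^sub>R 1 else 0)"
      using conj_same[of s] conj_diff[of s u]
      by (auto simp: power2_eq_square scaleR_2[symmetric])
  qed
  also have "\<dots> = (2 * (norm y)\<^sup>2) *\<^sub>R 1"
    by (simp add: norm_sq_M[OF y] q_def sum_distrib_left scaleR_sum_left)
  finally have "2 *\<^sub>R (c y * y) = 2 *\<^sub>R ((norm y)\<^sup>2 *\<^sub>R 1)" by simp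
  then show ?thesis by (subst (asm) real_vector.scale_left_imp_eq[of 2]) auto
qed

definition kernel :: "real \<Rightarrow> 'a \<Rightarrow> 'a" where
  "kernel a y = (1 / sphere_area m) *\<^sub>R (cutoff a (norm y ^ (m + 1)) *\<^sub>R c y)"

definition kernel' :: "real \<Rightarrow> 'a \<Rightarrow> 'a \<Rightarrow> 'a" where
  "kernel' a y h = (1 / sphere_area m) *\<^sub>R (cutoff a (norm y ^ (m + 1)) *\<^sub>R c h +
     (cutoff' a (norm y ^ (m + 1)) * (real (m + 1) * norm y ^ (m + 1 - 2) * (y \<bullet> h))) *\<^sub>R c y)"

lemma C1_kernel:
  assumes a: "a > 0"
  shows "C1 (kernel a) (kernel' a)"
proof -
  have m: "m + 1 \<ge> 2" using m_pos by simp
  have "C1 (\<lambda>y. (1 / sphere_area m) *\<^sub>R (cutoff a (norm y ^ (m + 1)) *\<^sub>R c y))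
      (\<lambda>y h. (1 / sphere_area m) *\<^sub>R (cutoff a (norm y ^ (m + 1)) *\<^sub>R c h +
         (cutoff' a (norm y ^ (m + 1)) * (real (m + 1) * norm y ^ (m + 1 - 2) * (y \<bullet> h))) *\<^sub>R c y) +
         0 *\<^sub>R (cutoff a (norm y ^ (m + 1)) *\<^sub>R c y))"
    by (intro C1_scaleR C1_const C1_linear linear_c
        C1_compose_real[OF C1_norm_power[OF m] cutoff_deriv[OF a] continuous_cutoff'[OF a]])
  then show ?thesis unfolding kernel_def[abs_def] kernel'_def[abs_def] by simp
qed

text \<open>The basis vectors multiply from the right, as they will after the product rule. The
  factor c(y) contributes (m+1) \<open>cutoff\<close> by \<open>conj_same\<close>; the radial factor
  contributes (m+1) u \<open>cutoff'\<close>, because c(y) y = |y|^2. Together they form the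
  derivative of u * \<open>cutoff a u\<close>.\<close>

lemma divergence_kernel:
  assumes a: "a > 0" and y: "y \<in> M"
  shows "(\<Sum>s\<le>m. kernel' a y (v s) * v s) = mollifier a y *\<^sub>R 1"
proof -
  define u where "u = norm y ^ (m + 1)"
  define k where "k = cutoff' a u * (real (m + 1) * norm y ^ (m + 1 - 2))"
  have "(\<Sum>s\<le>m. kernel' a y (v s) * v s) =
      (\<Sum>s\<le>m. (1 / sphere_area m) *\<^sub>R (cutoff a u *\<^sub>R (c (v s) * v s) + k *\<^sub>R (c y * ((y \<bullet> v s) *\<^sub>R v s))))"
    by (intro sum.cong refl) (simp add: kernel'_def u_def k_def algebra_simps)
  also have "\<dots> = (1 / sphere_area m) *\<^sub>R (cutoff a u *\<^sub>R (\<Sum>s\<le>m. c (v s) * v s) +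
      k *\<^sub>R (c y * (\<Sum>s\<le>m. (y \<bullet> v s) *\<^sub>R v s)))"
    by (simp add: sum.distrib scaleR_sum_right sum_distrib_left scaleR_add_right)
  also have "(\<Sum>s\<le>m. c (v s) * v s) = real (m + 1) *\<^sub>R 1"
    by (simp add: conj_same scaleR_conv_of_real)
  also have "(\<Sum>s\<le>m. (y \<bullet> v s) *\<^sub>R v s) = y" using expand_M[OF y] by simp
  also have "c y * y = (norm y)\<^sup>2 *\<^sub>R 1" by (rule conj_mult_self[OF y])
  also have "(1 / sphere_area m) *\<^sub>R (cutoff a u *\<^sub>R real (m + 1) *\<^sub>R 1 + k *\<^sub>R (norm y)\<^sup>2 *\<^sub>R (1::'a)) =
      ((1 / sphere_area m) * (cutoff a u * real (m + 1) + k * (norm y)\<^sup>2)) *\<^sub>R 1"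
    by (simp add: algebra_simps)
  also have "k * (norm y)\<^sup>2 = real (m + 1) * (u * cutoff' a u)"
  proof -
    have "norm y ^ (m + 1 - 2) * (norm y)\<^sup>2 = norm y ^ (m + 1 - 2 + 2)" by (rule power_add[symmetric])
    \<comment> \<open>The truncated subtraction is harmless because m \<ge> 1.\<close>
    also have "m + 1 - 2 + 2 = m + 1" using m_pos by simp
    finally show ?thesis by (simp add: k_def u_def mult_ac)
  qed
  also have "(1 / sphere_area m) * (cutoff a u * real (m + 1) + real (m + 1) * (u * cutoff' a u)) =
      real (m + 1) / sphere_area m * (cutoff a u + u * cutoff' a u)"
    by (simp add: algebra_simps add_divide_distrib)
  also have "\<dots> = mollifier a y"
    using cutoff_identity[OF a, of u] by (simp add: mollifier_def u_def)
  finally show ?thesis .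
qed

abbreviation "E \<equiv> cauchy_kernel c m"

lemma kernel_eq: "a > 0 \<Longrightarrow> norm y ^ (m + 1) > a \<Longrightarrow> kernel a y = E y"
  by (simp add: kernel_def cauchy_kernel_def cutoff_def divide_inverse)

lemma continuous_c: "continuous_on A c"
  using linear_c linear_continuous_on linear_conv_bounded_linear by blast

text \<open>One constant serves the Cauchy kernel and all of its regularizations, so a single
  integrable function dominates the whole family.\<close>

lemma kernel_bound:
  obtains C where "C \<ge> 0"
    "\<And>a y. a > 0 \<Longrightarrow> norm (kernel a y) \<le> C * (norm y ^ (m + 1)) powr (- real m / real (m + 1))"
    "\<And>y. norm (E y) \<le> C * (norm y ^ (m + 1)) powr (- real m / real (m + 1))"
proof -
  obtain B where B: "B > 0" "\<And>y. norm (c y) \<le> B * norm y"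
    using linear_c linear_bounded_pos by blast
  define C where "C = B / sphere_area m"
  have C: "C \<ge> 0" using B sphere_area_pos[of m] by (simp add: C_def)
  have c0: "c 0 = 0" using linear_0[OF linear_c] .
  have main: "norm ((1 / sphere_area m) *\<^sub>R (t *\<^sub>R c y)) \<le> C * (norm y ^ (m + 1)) powr (- real m / real (m + 1))"
    if "0 \<le> t" "t \<le> 1 / norm y ^ (m + 1)" "y \<noteq> 0" for t y
  proof -
    have "norm ((1 / sphere_area m) *\<^sub>R (t *\<^sub>R c y)) = (1 / sphere_area m) * (t * norm (c y))"
      using that(1) sphere_area_pos[of m] by simp
    also have "\<dots> \<le> (1 / sphere_area m) * (1 / norm y ^ (m + 1) * (B * norm y))"
      using that B sphere_area_pos[of m] by (intro mult_left_mono mult_mono) auto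
    also have "\<dots> = C * (1 / norm y ^ m)"
      using that(3) by (simp add: C_def)
    also have "1 / norm y ^ m = (norm y ^ (m + 1)) powr (- real m / real (m + 1))"
    proof -
      have "(norm y ^ (m + 1)) powr (- real m / real (m + 1)) = (norm y powr real (m + 1)) powr (- real m / real (m + 1))"
        using powr_realpow[of "norm y" "m + 1"] that(3) by simp
      also have "\<dots> = norm y powr (real (m + 1) * (- real m / real (m + 1)))" by (rule powr_powr)
      also have "real (m + 1) * (- real m / real (m + 1)) = - real m" by simp
      also have "norm y powr (- real m) = 1 / norm y ^ m"
        using that(3) by (simp add: powr_minus powr_realpow divide_inverse)
      finally show ?thesis ..
    qed
    finally show ?thesis .
  qed
  show ?thesis
  proof (rule that[OF C])
    fix a y assume a: "(a::real) > 0"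
    show "norm (kernel a y) \<le> C * (norm y ^ (m + 1)) powr (- real m / real (m + 1))"
    proof (cases "y = 0")
      case False
      then have "norm y ^ (m + 1) > 0" by simp
      from main[OF cutoff_bounds[OF a this] False] show ?thesis by (simp add: kernel_def)
    qed (simp add: kernel_def c0 C)
  next
    fix y
    show "norm (E y) \<le> C * (norm y ^ (m + 1)) powr (- real m / real (m + 1))"
    proof (cases "y = 0")
      case False
      from main[of "1 / norm y ^ (m + 1)" y] False show ?thesis
        by (simp add: cauchy_kernel_def divide_inverse)
    \<comment> \<open>At y = 0 both sides are 0: c 0 = 0 on the left, and \<open>powr\<close> with
      base 0 is 0 on the right.\<close>
    qed (simp add: cauchy_kernel_def c0 C)
  qed
qed

text \<open>The divergence theorem is applied to K (v s \<Phi>) in direction \<open>v s\<close> and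
  summed over s. By the product rule and associativity the volume terms regroup into K times the
  operator on \<Phi> and the divergence of K times \<Phi>; on the boundary the components of the
  normal reassemble into the normal between the two factors.\<close>

lemma regularized_formula:
  assumes \<Phi>: "C1 \<Phi> \<Phi>'" and x: "x \<in> M" and a: "a > 0"
  shows "(LINT y:G|vol. kernel a (y - x) * (\<Sum>s\<le>m. v s * \<Phi>' y (v s))) +
      (LINT y:G|vol. mollifier a (y - x) *\<^sub>R \<Phi> y) =
    (LINT y:bd M G|S. kernel a (y - x) * \<nu> y * \<Phi> y)"
proof -
  note mult = bounded_bilinear_algebra[where 'a='a]
  note cmult = bounded_bilinear.continuous_on[OF mult]
  define K where "K y = kernel a (y - x)" for y
  define K' where "K' y h = kernel' a (y - x) h" for y h
  have K: "C1 K K'" unfolding K_def[abs_def] K'_def[abs_def] by (rule C1_translate[OF C1_kernel[OF a]])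
  define f where "f s y = K y * (v s * \<Phi> y)" for s y
  define f' where "f' s y h = K y * (v s * \<Phi>' y h) + K' y h * (v s * \<Phi> y)" for s y h
  have f: "C1 (f s) (f' s)" for s
    using C1_bilinear[OF mult K C1_bilinear[OF mult C1_const[of "v s"] \<Phi>]]
    unfolding f_def[abs_def] f'_def[abs_def] by simp
  have "(\<Sum>s\<le>m. (LINT y:G|vol. f' s y (v s))) = (\<Sum>s\<le>m. (LINT y:bd M G|S. (\<nu> y \<bullet> v s) *\<^sub>R f s y))"
    by (intro sum.cong refl divergence_theorem[OF f]) simp
  also have "(\<Sum>s\<le>m. (LINT y:G|vol. f' s y (v s))) = (LINT y:G|vol. (\<Sum>s\<le>m. f' s y (v s)))"
    using set_integrable_G[OF C1_deriv_continuous[OF f]]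
    unfolding set_lebesgue_integral_def set_integrable_def scaleR_sum_right
    by (intro Bochner_Integration.integral_sum[symmetric]) auto
  also have "\<dots> = (LINT y:G|vol. K y * (\<Sum>s\<le>m. v s * \<Phi>' y (v s)) + mollifier a (y - x) *\<^sub>R \<Phi> y)"
  proof (rule set_lebesgue_integral_cong)
    show "\<forall>y. y \<in> G \<longrightarrow> (\<Sum>s\<le>m. f' s y (v s)) =
        K y * (\<Sum>s\<le>m. v s * \<Phi>' y (v s)) + mollifier a (y - x) *\<^sub>R \<Phi> y"
    proof (intro allI impI)
      fix y assume "y \<in> G"
      then have yx: "y - x \<in> M" using G_subset x by (auto intro: span_diff)
      have "(\<Sum>s\<le>m. f' s y (v s)) = K y * (\<Sum>s\<le>m. v s * \<Phi>' y (v s)) + (\<Sum>s\<le>m. K' y (v s) * v s) * \<Phi> y"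
        by (simp add: f'_def sum.distrib sum_distrib_left sum_distrib_right mult.assoc)
      also have "(\<Sum>s\<le>m. K' y (v s) * v s) = mollifier a (y - x) *\<^sub>R 1"
        unfolding K'_def by (rule divergence_kernel[OF a yx])
      finally show "(\<Sum>s\<le>m. f' s y (v s)) =
          K y * (\<Sum>s\<le>m. v s * \<Phi>' y (v s)) + mollifier a (y - x) *\<^sub>R \<Phi> y" by simp
    qed
  qed simp
  also have "\<dots> = (LINT y:G|vol. K y * (\<Sum>s\<le>m. v s * \<Phi>' y (v s))) + (LINT y:G|vol. mollifier a (y - x) *\<^sub>R \<Phi> y)"
    by (intro set_integral_add set_integrable_G continuous_intros cmult C1_continuous[OF K]
        C1_continuous[OF \<Phi>] C1_deriv_continuous[OF \<Phi>] continuous_on_compose2[OF continuous_mollifier[of UNIV]])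
      auto
  also have "(\<Sum>s\<le>m. (LINT y:bd M G|S. (\<nu> y \<bullet> v s) *\<^sub>R f s y)) = (LINT y:bd M G|S. (\<Sum>s\<le>m. (\<nu> y \<bullet> v s) *\<^sub>R f s y))"
    using set_integrable_bd[OF continuous_normal_component[OF C1_continuous[OF f]]]
    unfolding set_lebesgue_integral_def set_integrable_def scaleR_sum_right
    by (intro Bochner_Integration.integral_sum[symmetric]) auto
  also have "\<dots> = (LINT y:bd M G|S. K y * \<nu> y * \<Phi> y)"
  proof (rule set_lebesgue_integral_cong)
    show "\<forall>y. y \<in> bd M G \<longrightarrow> (\<Sum>s\<le>m. (\<nu> y \<bullet> v s) *\<^sub>R f s y) = K y * \<nu> y * \<Phi> y"
    proof (intro allI impI)
      fix y assume "y \<in> bd M G"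
      have "(\<Sum>s\<le>m. (\<nu> y \<bullet> v s) *\<^sub>R f s y) = K y * (\<Sum>s\<le>m. (\<nu> y \<bullet> v s) *\<^sub>R v s) * \<Phi> y"
        by (simp add: f_def sum_distrib_left sum_distrib_right mult.assoc)
      then show "(\<Sum>s\<le>m. (\<nu> y \<bullet> v s) *\<^sub>R f s y) = K y * \<nu> y * \<Phi> y"
        using expand_M[OF normal_in_M[OF \<open>y \<in> bd M G\<close>]] by simp
    qed
  qed simp
  finally show ?thesis by (simp add: K_def)
qed

text \<open>As a tends to 0, the boundary integral is eventually constant, the volume integral
  converges by domination, and the mollifier term produces the value at x or 0.\<close>

theorem cauchy_pompeiu_C1:
  assumes \<Phi>: "C1 \<Phi> \<Phi>'" and x: "x \<in> G \<union> (M - closure G)"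
  defines "D \<equiv> \<lambda>y. \<Sum>s\<le>m. v s * \<Phi>' y (v s)"
  shows "set_integrable S (bd M G) (\<lambda>y. E (y - x) * \<nu> y * \<Phi> y)"
    and "set_integrable vol G (\<lambda>y. E (y - x) * D y)"
    and "(LINT y:bd M G|S. E (y - x) * \<nu> y * \<Phi> y) - (LINT y:G|vol. E (y - x) * D y) =
      (if x \<in> G then \<Phi> x else 0)"
proof -
  note mult = bounded_bilinear_algebra[where 'a='a]
  note cmult = bounded_bilinear.continuous_on[OF mult]
  have xM: "x \<in> M" using x G_subset by blast
  have D: "continuous_on UNIV D"
    unfolding D_def by (intro continuous_intros cmult C1_deriv_continuous[OF \<Phi>])
  have xbd: "x \<notin> bd M G"
    using x bd_iff[OF open_G, of x] closure_M[OF G_subset] by auto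
  have "closed (bd M G)" using compact_bd(1)[OF open_G bounded_G] by (rule compact_imp_closed)
  then obtain \<delta> where "\<delta> > 0" "ball x \<delta> \<subseteq> - bd M G"
    using xbd open_contains_ball[of "- bd M G"] by (meson ComplI open_Compl)
  then have \<delta>: "\<delta> > 0" "ball x \<delta> \<inter> bd M G = {}" by blast+
  have far: "norm (y - x) \<ge> \<delta>" if "y \<in> bd M G" for y
  proof -
    have "y \<notin> ball x \<delta>" using \<delta>(2) that by blast
    then show ?thesis by (simp add: dist_norm norm_minus_commute)
  qed
  have E: "continuous_on (bd M G) (\<lambda>y. E (y - x))"
    unfolding cauchy_kernel_def divide_inverse
  proof (intro continuous_intros continuous_on_compose2[OF continuous_c[of UNIV]])
    show "\<forall>y\<in>bd M G. norm (y - x) ^ (m + 1) \<noteq> 0" using xbd by auto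
  qed auto
  show "set_integrable S (bd M G) (\<lambda>y. E (y - x) * \<nu> y * \<Phi> y)"
    by (intro set_integrable_bd cmult E continuous_normal C1_continuous[OF \<Phi>])
  have [measurable]: "c \<in> borel_measurable borel" "D \<in> borel_measurable borel"
    using continuous_c D by (auto intro: borel_measurable_continuous_onI)
  have Em [measurable]: "E \<in> borel_measurable borel"
    unfolding cauchy_kernel_def[abs_def] by measurable
  have prod_meas: "(\<lambda>y. p y * q y) \<in> borel_measurable borel"
    if "p \<in> borel_measurable borel" "q \<in> borel_measurable borel" for p q :: "'a \<Rightarrow> 'a"
    using that by (rule borel_measurable_continuous_Pair)
      (auto intro!: cmult continuous_intros)
  obtain C where C: "C \<ge> 0"
    "\<And>a y. a > 0 \<Longrightarrow> norm (kernel a y) \<le> C * (norm y ^ (m + 1)) powr (- real m / real (m + 1))"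
    "\<And>y. norm (E y) \<le> C * (norm y ^ (m + 1)) powr (- real m / real (m + 1))"
    by (rule kernel_bound) blast
  obtain B where B: "B \<ge> 0" "\<And>y. y \<in> G \<Longrightarrow> norm (D y) \<le> B"
    using continuous_bounded_on_G[OF D] by blast
  \<comment> \<open>The Euclidean norm on the algebra need not be submultiplicative; L is the
    operator bound of the multiplication.\<close>
  obtain L where L: "L \<ge> 0" "\<And>p q :: 'a. norm (p * q) \<le> norm p * norm q * L"
    using bounded_bilinear.nonneg_bounded[OF mult] by blast
  obtain R where R: "G \<subseteq> ball x R" using bounded_subset_ballD[OF bounded_G, of x] by blast
  \<comment> \<open>The product of the bounds for kernel, derivative term and multiplication;
    integrable over bounded sets although the kernel is singular at x.\<close>
  define w where "w y = (C * B * L) * (indicator (cball x R) y * ((norm (y - x) ^ (m + 1)) powr (- real m / real (m + 1))))" for y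
  have wm [measurable]: "w \<in> borel_measurable borel"
  proof -
    have [measurable]: "cball x R \<in> sets borel" by simp
    show ?thesis unfolding w_def by measurable
  qed
  have w: "integrable vol w"
    unfolding w_def
  proof (intro integrable_mult_right integrableI_nonneg)
    have [measurable]: "cball x R \<in> sets borel" by simp
    show "(\<lambda>y. indicator (cball x R) y * ((norm (y - x) ^ (m + 1)) powr (- real m / real (m + 1)))) \<in> borel_measurable vol"
      by measurable
    show "(\<integral>\<^sup>+ y. ennreal (indicator (cball x R) y * ((norm (y - x) ^ (m + 1)) powr (- real m / real (m + 1)))) \<partial>vol) < \<infinity>"
      using finite_integral_norm_power[OF xM, of R] by (simp add: ennreal_mult' ennreal_indicator)
  qed simp
  have dom: "norm (indicator G y *\<^sub>R (p * D y)) \<le> w y"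
    if "norm p \<le> C * (norm (y - x) ^ (m + 1)) powr (- real m / real (m + 1))" for p y
  proof (cases "y \<in> G")
    case True
    have "norm (p * D y) \<le> norm p * norm (D y) * L" by (rule L)
    also have "\<dots> \<le> (C * (norm (y - x) ^ (m + 1)) powr (- real m / real (m + 1))) * B * L"
      using that B L C True by (intro mult_right_mono mult_mono) auto
    finally show ?thesis using True R by (auto simp: w_def mult_ac subset_iff)
  next
    case False
    then show ?thesis using C(1) B(1) L(1) by (simp add: w_def)
  qed
  have meas: "(\<lambda>y. indicator G y *\<^sub>R (p (y - x) * D y)) \<in> borel_measurable vol"
    if "p \<in> borel_measurable borel" for p :: "'a \<Rightarrow> 'a"
  proof -
    have "(\<lambda>y. p (y - x)) \<in> borel_measurable borel" using that by measurable
    note [measurable] = prod_meas[OF this \<open>D \<in> _\<close>]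
    show ?thesis by measurable
  qed
  show "set_integrable vol G (\<lambda>y. E (y - x) * D y)"
    unfolding set_integrable_def
    by (rule Bochner_Integration.integrable_bound[OF w meas[OF Em]])
      (use order_trans[OF dom[OF C(3)] abs_ge_self] in \<open>auto\<close>)
  define a where "a n = 1 / real (Suc n)" for n
  have a: "a n > 0" for n by (simp add: a_def)
  have a0: "a \<longlonglongrightarrow> 0" unfolding a_def using LIMSEQ_inverse_real_of_nat by (simp add: divide_inverse)
  have lim1: "(\<lambda>n. LINT y:G|vol. kernel (a n) (y - x) * D y) \<longlonglongrightarrow> (LINT y:G|vol. E (y - x) * D y)"
    unfolding set_lebesgue_integral_def
  proof (rule integral_dominated_convergence[OF meas[OF Em] meas w])
    show "kernel (a n) \<in> borel_measurable borel" for n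
      by (rule C1_measurable[OF C1_kernel[OF a]])
    show "AE y in vol. norm (indicator G y *\<^sub>R (kernel (a n) (y - x) * D y)) \<le> w y" for n
      using dom[OF C(2)[OF a]] by auto
    show "AE y in vol. (\<lambda>n. indicator G y *\<^sub>R (kernel (a n) (y - x) * D y)) \<longlonglongrightarrow> indicator G y *\<^sub>R (E (y - x) * D y)"
    proof (rule AE_I2)
      fix y
      have "\<forall>\<^sub>F n in sequentially. kernel (a n) (y - x) = E (y - x)"
      proof (cases "y = x")
        \<comment> \<open>At y = x both kernels take the value 0, because c 0 = 0, so pointwise
          convergence holds there too.\<close>
        case True
        then show ?thesis by (simp add: kernel_def cauchy_kernel_def linear_0[OF linear_c])
      next
        case False
        then have "\<forall>\<^sub>F n in sequentially. a n < norm (y - x) ^ (m + 1)"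
          using a0 by (intro order_tendstoD(2)) auto
        then show ?thesis by (rule eventually_mono) (rule kernel_eq[OF a])
      qed
      then have "\<forall>\<^sub>F n in sequentially. indicator G y *\<^sub>R (kernel (a n) (y - x) * D y) =
          indicator G y *\<^sub>R (E (y - x) * D y)" by (rule eventually_mono) simp
      then show "(\<lambda>n. indicator G y *\<^sub>R (kernel (a n) (y - x) * D y)) \<longlonglongrightarrow> indicator G y *\<^sub>R (E (y - x) * D y)"
        by (rule tendsto_eventually)
    qed
  qed
  note lim2 = mollifier_limit[OF C1_continuous[OF \<Phi>] x a a0]
  have "\<forall>\<^sub>F n in sequentially. a n < \<delta> ^ (m + 1)"
    using a0 \<delta>(1) by (intro order_tendstoD(2)) auto
  then have "\<forall>\<^sub>F n in sequentially. (LINT y:G|vol. kernel (a n) (y - x) * D y) +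
      (LINT y:G|vol. mollifier (a n) (y - x) *\<^sub>R \<Phi> y) = (LINT y:bd M G|S. E (y - x) * \<nu> y * \<Phi> y)"
  proof (rule eventually_mono)
    fix n assume n: "a n < \<delta> ^ (m + 1)"
    \<comment> \<open>Boundary points stay at distance at least \<delta> from x, beyond the region
      where the kernel was modified. Hence the boundary integral is the same for all large
      n.\<close>
    have "kernel (a n) (y - x) = E (y - x)" if "y \<in> bd M G" for y
      using power_mono[OF far[OF that], of "m + 1"] n \<delta>(1) by (intro kernel_eq[OF a]) auto
    then have "(LINT y:bd M G|S. kernel (a n) (y - x) * \<nu> y * \<Phi> y) = (LINT y:bd M G|S. E (y - x) * \<nu> y * \<Phi> y)"
      by (intro set_lebesgue_integral_cong) auto
    then show "(LINT y:G|vol. kernel (a n) (y - x) * D y) +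
      (LINT y:G|vol. mollifier (a n) (y - x) *\<^sub>R \<Phi> y) = (LINT y:bd M G|S. E (y - x) * \<nu> y * \<Phi> y)"
      using regularized_formula[OF \<Phi> xM a, of n] by (simp add: D_def)
  qed
  from tendsto_eventually[OF this] tendsto_add[OF lim1 lim2]
  have "(LINT y:bd M G|S. E (y - x) * \<nu> y * \<Phi> y) = (LINT y:G|vol. E (y - x) * D y) + (if x \<in> G then \<Phi> x else 0)"
    by (rule LIMSEQ_unique)
  then show "(LINT y:bd M G|S. E (y - x) * \<nu> y * \<Phi> y) - (LINT y:G|vol. E (y - x) * D y) =
      (if x \<in> G then \<Phi> x else 0)" by simp
qed

end

section \<open>From functions on the closure to ambient C^1 functions\<close>

context C1_domain begin

text \<open>The given extension F lives only on a relatively open set \<open>U\<close>. Composed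
  with the projection it is C^1 on the preimage \<open>V\<close> of \<open>U\<close>; a C^1 cutoff
  \<zeta>, equal to 1 on the closure and vanishing off a compact subset of \<open>V\<close>, extends
  it by 0.\<close>

lemma C1_closure_extension:
  fixes \<phi> :: "'a \<Rightarrow> 'b::euclidean_space"
  assumes "C1_closure M G \<phi>"
  shows "\<exists>\<Phi> \<Phi>'. C1 \<Phi> \<Phi>' \<and> (\<forall>y\<in>closure G. \<Phi> y = \<phi> y)"
proof -
  obtain U F where U: "openin (top_of_set M) U" "top_of_set M closure_of G \<subseteq> U" and F: "C1_on M U F"
    and eq: "\<forall>y\<in>top_of_set M closure_of G. \<phi> y = F y"
    using assms unfolding C1_closure_def by blast
  have GU: "closure G \<subseteq> U" and \<phi>: "\<And>y. y \<in> closure G \<Longrightarrow> \<phi> y = F y"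
    using U(2) eq closure_M[OF G_subset] by auto
  obtain F' where F': "\<And>y. y \<in> U \<Longrightarrow> (F has_derivative F' y) (at y within M)"
    "\<And>h. h \<in> M \<Longrightarrow> continuous_on U (\<lambda>y. F' y h)"
    using F unfolding C1_on_def by blast
  obtain O' where O': "open O'" "U = M \<inter> O'" using U(1) unfolding openin_open by blast
  have GM: "closure G \<subseteq> M" using closure_minimal[OF G_subset closed_span] .
  define V where "V = proj -` U"
  have "V = proj -` O'" unfolding V_def O' by auto
  then have V: "open V" using open_vimage[OF O'(1) continuous_proj[of UNIV]] by simp
  have GV: "closure G \<subseteq> V" unfolding V_def using GU GM by (auto simp: subset_iff)
  have compG: "compact (closure G)" by (simp add: compact_closure bounded_G)
  \<comment> \<open>A partition of unity for the one-set cover by \<open>V\<close>; its sum is the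
    cutoff \<zeta>.\<close>
  have "\<exists>n \<eta> W C Z. C1_partition (closure G) {V} n \<eta> W C Z"
    using V GV by (intro C1_partition_of_unity[OF compG]) auto
  then obtain n \<eta> W C Z where "C1_partition (closure G) {V} n \<eta> W C Z"
    by (elim exE) (rule that)
  note part = this[unfolded C1_partition_def]
  have "\<exists>f'. C1 (\<eta> k) f'" if "k < n" for k using part that by blast
  then obtain \<eta>' where \<eta>': "\<And>k. k < n \<Longrightarrow> C1 (\<eta> k) (\<eta>' k)" by metis
  define K where "K = (\<Union>k<n. C k)"
  have "compact K" unfolding K_def using part by (intro compact_UN) auto
  then have K: "open (- K)" "K \<subseteq> V"
    using part by (auto simp: K_def intro!: open_Compl compact_imp_closed)
  define \<zeta> where "\<zeta> y = (\<Sum>k<n. \<eta> k y)" for y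
  define \<zeta>' where "\<zeta>' y h = (\<Sum>k<n. \<eta>' k y h)" for y h
  have \<zeta>: "C1 \<zeta> \<zeta>'"
    unfolding \<zeta>_def[abs_def] \<zeta>'_def[abs_def] using \<eta>' by (intro C1_sum) auto
  have \<zeta>0: "\<zeta> y = 0" if "y \<notin> K" for y
    unfolding \<zeta>_def using that part by (intro sum.neutral) (auto simp: K_def)
  have \<zeta>'0: "\<zeta>' y = (\<lambda>_. 0)" if "y \<notin> K" for y
    by (rule C1_deriv_eq_on_open[OF \<zeta> has_derivative_const K(1)]) (use that \<zeta>0 in auto)
  have \<zeta>1: "\<zeta> y = 1" if "y \<in> closure G" for y using part that by (auto simp: \<zeta>_def)
  define \<Phi> where "\<Phi> y = \<zeta> y *\<^sub>R F (proj y)" for y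
  define \<Phi>' where "\<Phi>' y h = \<zeta> y *\<^sub>R F' (proj y) (proj h) + \<zeta>' y h *\<^sub>R F (proj y)" for y h
  have "C1 \<Phi> \<Phi>'"
    unfolding C1_def
  proof safe
    fix y
    show "(\<Phi> has_derivative \<Phi>' y) (at y)"
    proof (cases "y \<in> K")
      case True
      then have "proj y \<in> U" using K(2) by (auto simp: V_def)
      from has_derivative_scaleR[OF C1_has_derivative[OF \<zeta>] C1_on_proj(1)[OF F' this]]
      show ?thesis by (simp add: \<Phi>_def[abs_def] \<Phi>'_def[abs_def])
    next
      case False
      have "((\<lambda>_. 0) has_derivative \<Phi>' y) (at y)"
        using \<zeta>0[OF False] \<zeta>'0[OF False] by (simp add: \<Phi>'_def[abs_def])
      then show ?thesis
        by (rule has_derivative_transform_within_open[OF _ K(1)]) (use False \<zeta>0 in \<open>auto simp: \<Phi>_def\<close>)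
    qed
  next
    fix h
    have contF: "continuous_on V (\<lambda>y. F (proj y))"
      unfolding V_def continuous_on_eq_continuous_within
      using C1_on_proj(1)[OF F'] has_derivative_continuous continuous_at_imp_continuous_at_within by blast
    have "continuous_on V (\<lambda>y. \<Phi>' y h)"
      unfolding \<Phi>'_def
      by (intro continuous_intros C1_continuous[OF \<zeta>] C1_deriv_continuous[OF \<zeta>] contF
          C1_on_proj(2)[OF F', folded V_def])
    moreover have "continuous_on (- K) (\<lambda>y. \<Phi>' y h)"
    proof (rule continuous_on_eq[OF continuous_on_const[of _ 0]])
      show "0 = \<Phi>' y h" if "y \<in> - K" for y using that \<zeta>0 \<zeta>'0 by (simp add: \<Phi>'_def)
    qed
    ultimately have "continuous_on (V \<union> - K) (\<lambda>y. \<Phi>' y h)"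
      using V K(1) by (intro continuous_on_open_Un)
    moreover have "V \<union> - K = UNIV" using K(2) by blast
    ultimately show "continuous_on UNIV (\<lambda>y. \<Phi>' y h)" by simp
  qed
  moreover have "\<Phi> y = \<phi> y" if "y \<in> closure G" for y
    using \<zeta>1[OF that] \<phi>[OF that] GM that by (simp add: \<Phi>_def subset_iff)
  ultimately show ?thesis by blast
qed

end

text \<open>Both integrals depend only on \<phi> over the closure. On the relatively open set
  \<open>G\<close> its partial derivatives coincide with those of the ambient extension, so
  \<open>dbar\<close> of \<phi> may be replaced by the operator applied to the extension.\<close>

theorem (in hypercomplex_domain) cauchy_pompeiu:
  assumes \<phi>: "C1_closure M G \<phi>" and x: "x \<in> G \<union> (M - top_of_set M closure_of G)"
  shows "set_integrable S (bd M G) (\<lambda>y. E (y - x) * \<nu> y * \<phi> y)"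
    and "set_integrable vol G (\<lambda>y. E (y - x) * dbar v m \<phi> y)"
    and "(LINT y:bd M G|S. E (y - x) * \<nu> y * \<phi> y) - (LINT y:G|vol. E (y - x) * dbar v m \<phi> y) =
      (if x \<in> G then \<phi> x else 0)"
proof -
  have x': "x \<in> G \<union> (M - closure G)" using x closure_M[OF G_subset] by simp
  obtain \<Phi> \<Phi>' where \<Phi>: "C1 \<Phi> \<Phi>'" "\<And>y. y \<in> closure G \<Longrightarrow> \<Phi> y = \<phi> y"
    using C1_closure_extension[OF \<phi>] by blast
  have bd: "\<Phi> y = \<phi> y" if "y \<in> bd M G" for y
    using that bd_iff[OF open_G] closure_M[OF G_subset] \<Phi>(2) by blast
  have G: "\<Phi> y = \<phi> y" if "y \<in> G" for y using that closure_subset \<Phi>(2) by blast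
  have D: "(\<Sum>s\<le>m. v s * \<Phi>' y (v s)) = dbar v m \<phi> y" if y: "y \<in> G" for y
    unfolding dbar_def
  proof (rule sum.cong[OF refl])
    fix s assume "s \<in> {..m}"
    then have "partial v s \<phi> y = \<Phi>' y (v s)"
      using y G_subset G by (intro C1_line_partial[OF \<Phi>(1) _ open_G]) auto
    then show "v s * \<Phi>' y (v s) = v s * partial v s \<phi> y" by simp
  qed
  note * = cauchy_pompeiu_C1[OF \<Phi>(1) x']
  have 1: "set_integrable S (bd M G) (\<lambda>y. E (y - x) * \<nu> y * \<Phi> y) =
      set_integrable S (bd M G) (\<lambda>y. E (y - x) * \<nu> y * \<phi> y)"
    by (rule set_integrable_cong) (use bd in auto)
  have 2: "set_integrable vol G (\<lambda>y. E (y - x) * (\<Sum>s\<le>m. v s * \<Phi>' y (v s))) =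
      set_integrable vol G (\<lambda>y. E (y - x) * dbar v m \<phi> y)"
    by (rule set_integrable_cong) (use D in auto)
  have 3: "(LINT y:bd M G|S. E (y - x) * \<nu> y * \<Phi> y) = (LINT y:bd M G|S. E (y - x) * \<nu> y * \<phi> y)"
    by (rule set_lebesgue_integral_cong) (use bd in auto)
  have 4: "(LINT y:G|vol. E (y - x) * (\<Sum>s\<le>m. v s * \<Phi>' y (v s))) = (LINT y:G|vol. E (y - x) * dbar v m \<phi> y)"
    by (rule set_lebesgue_integral_cong) (use D in auto)
  show "set_integrable S (bd M G) (\<lambda>y. E (y - x) * \<nu> y * \<phi> y)"
    using *(1) unfolding 1 .
  show "set_integrable vol G (\<lambda>y. E (y - x) * dbar v m \<phi> y)"
    using *(2) unfolding 2 .
  show "(LINT y:bd M G|S. E (y - x) * \<nu> y * \<phi> y) - (LINT y:G|vol. E (y - x) * dbar v m \<phi> y) =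
      (if x \<in> G then \<phi> x else 0)"
    using *(3) G unfolding 3 4 by simp
qed

text \<open>These relations are the polarized form of c(y) y = |y|^2 on \<open>M\<close>. Trace 0
  gives c(v s) = - v s for s \<ge> 1, then norm 1 gives v s v s = -1; the mixed relations follow
  from anticommutation, and from c(1) = 1 when one index is 0.\<close>

lemma hypercomplex_basis_conj:
  fixes v :: "nat \<Rightarrow> 'a::real_algebra_1"
  assumes c: "star_involution c" and v: "hypercomplex_basis c M m v"
  shows "s \<le> m \<Longrightarrow> c (v s) * v s = 1"
    and "s \<le> m \<Longrightarrow> u \<le> m \<Longrightarrow> s \<noteq> u \<Longrightarrow> c (v s) * v u + c (v u) * v s = 0"
proof -
  have v0: "v 0 = 1" using v by (simp add: hypercomplex_basis_def)
  have "c 1 = 1"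
  proof -
    have "1 = c (c 1 * 1)" using c by (simp add: star_involution_def)
    also have "\<dots> = c 1 * c (c 1)" using c unfolding star_involution_def by blast
    also have "\<dots> = c 1" using c by (simp add: star_involution_def)
    finally show ?thesis ..
  qed
  then have c0: "c (v 0) = 1" using v0 by simp
  have cs: "c (v s) = - v s" "v s * v s = - 1" if "s \<in> {1..m}" for s
  proof -
    have "v s \<in> imag_units c" using v that by (simp add: hypercomplex_basis_def)
    then have t: "v s + c (v s) = 0" "v s * c (v s) = 1"
      by (simp_all add: imag_units_def star_trace_def star_norm_def)
    then show "c (v s) = - v s" by (simp add: add_eq_0_iff)
    then show "v s * v s = - 1" using t(2) by (simp add: minus_equation_iff)
  qed
  have anti: "v s * v u = - (v u * v s)" if "s \<in> {1..m}" "u \<in> {1..m}" "s \<noteq> u" for s u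
    using v that unfolding hypercomplex_basis_def by blast
  show "c (v s) * v s = 1" if "s \<le> m"
    using that c0 v0 cs[of s] by (cases "s = 0") auto
  show "c (v s) * v u + c (v u) * v s = 0" if su: "s \<le> m" "u \<le> m" "s \<noteq> u"
  proof -
    consider "s = 0" "u \<in> {1..m}" | "u = 0" "s \<in> {1..m}" | "s \<in> {1..m}" "u \<in> {1..m}"
      using su by force
    then show ?thesis
    proof cases
      case 3
      then show ?thesis using cs anti[of s u] su(3) by simp
    qed (use c0 v0 cs in auto)
  qed
qed

text \<open>The Bochner integral of a non-integrable function is 0 by convention, so integrability
  is part of the conclusion: it shows that the integrals, and in particular the singular volume
  integral, genuinely exist.\<close>

theorem theorem3p14:
  fixes c :: "'a::{real_algebra_1, euclidean_space} \<Rightarrow> 'a"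
    and M G :: "'a set" and v :: "nat \<Rightarrow> 'a" and m d :: nat
    and \<phi> :: "'a \<Rightarrow> 'a" and x :: 'a
  assumes "star_involution c" and "imag_units c \<noteq> {}"
    and "hypercomplex_subspace c M" and "hypercomplex_basis c M m v"
    and "m \<le> d" and "ordered_basis v d UNIV" and "orthonormal_family v d"
    and "bounded_domain M G" and "C1_boundary M v m G"
    and "C1_closure M G \<phi>"
    and "x \<in> G \<union> (M - top_of_set M closure_of G)"
  shows "set_integrable (surface_measure M v m G) (bd M G)
           (\<lambda>y. cauchy_kernel c m (y - x) * outward_normal M v m G y * \<phi> y) \<and>
    set_integrable (coord_volume v {..m}) G
           (\<lambda>y. cauchy_kernel c m (y - x) * dbar v m \<phi> y) \<and>
    (LINT y:bd M G|surface_measure M v m G.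
            cauchy_kernel c m (y - x) * outward_normal M v m G y * \<phi> y)
         - (LINT y:G|coord_volume v {..m}. cauchy_kernel c m (y - x) * dbar v m \<phi> y)
         = (if x \<in> G then \<phi> x else 0)"
proof -
  \<comment> \<open>In the locales \<open>M\<close> abbreviates the span of the frame; this equation
    moves the assumptions there and the result back.\<close>
  have M: "M = span (v ` {..m})"
    using assms(4) by (simp add: hypercomplex_basis_def ordered_basis_def)
  have "orthonormal_family v m"
    using assms(5,7) by (auto simp: orthonormal_family_def)
  moreover have "openin (top_of_set (span (v ` {..m}))) G" "bounded G"
    using assms(8) by (simp_all add: bounded_domain_def M)
  moreover have "C1_boundary (span (v ` {..m})) v m G"
    using assms(9) unfolding M .
  moreover have "linear c" "m \<ge> 1"
    using assms(1,4) by (simp_all add: star_involution_def hypercomplex_basis_def)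
  ultimately interpret hypercomplex_domain v m G c
    by (intro hypercomplex_domain.intro C1_domain.intro orthonormal_frame.intro
        C1_domain_axioms.intro hypercomplex_domain_axioms.intro hypercomplex_basis_conj[OF assms(1,4)])
  show ?thesis
    using cauchy_pompeiu[of \<phi> x, folded M, OF assms(10,11)] by (intro conjI)
qed

end
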